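(* Let $L=2\pi$. Then $0\in L^{2}(0,L)$ is locally asymptotically stable for the nonlinear KdV system \[ y_{t}+y_{x}+yy_{x}+y_{xxx}=0,\quad y(t,0)=y(t,L)=0,\quad y_{x}(t,L)=0,\quad y(0,x)=y_{0}\in L^{2}(0,L). \] More precisely: (i) for every $\varepsilon>0$ there exists $\delta=\delta(\varepsilon)>0$ such that if $\|y_{0}\|_{L^{2}(0,L)}<\delta$, then $\|y(t,\cdot)\|_{L^{2}(0,L)}<\varepsilon$ for all $t\geq0$; (ii) there exists $\delta_{1}>0$ such that if $\|y_{0}\|_{L^{2}(0,L)}<\delta_{1}$, then $\lim_{t\to+\infty}\|y(t,\cdot)\|_{L^{2}(0,L)}=0$.
   Context: We consider the initial-boundary-value problem for the Korteweg-de Vries equation on the interval $(0,L)$ with $L=2\pi$: $y_{t}+y_{x}+yy_{x}+y_{xxx}=0$, $y(t,0)=y(t,L)=0$, $y_{x}(t,L)=0$, $y(0,x)=y_{0}\in L^{2}(0,L)$. The length $L=2\pi$ is a critical length, i.e. it belongs to Rosier's set $\{2\pi\sqrt{(j^{2}+l^{2}+jl)/3};\ j,l\in\mathbb{N}^{*}\}$, for which the linearized system around $0$ (obtained by dropping $yy_{x}$) has the nontrivial steady states $a(1-\cos x)$, $a\in\mathbb{R}$, so $0$ is not asymptotically stable for the linearized system. *)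

theory Defs
  imports "HOL-Analysis.Analysis"
begin

text \<open>Functions of space are of type real => real; only their values on [0,L] matter.
  A state y at time t is y t, a function of x.\<close>

definition in_L2 :: "real \<Rightarrow> (real \<Rightarrow> real) \<Rightarrow> bool" where
  "in_L2 L f \<longleftrightarrow> set_borel_measurable lborel {0..L} f \<and>
                    set_integrable lborel {0..L} (\<lambda>x. (f x)^2)"

definition L2norm :: "real \<Rightarrow> (real \<Rightarrow> real) \<Rightarrow> real" where
  "L2norm L f = sqrt (LINT x:{0..L}|lborel. (f x)^2)"

text \<open>Test functions: the domain of the adjoint operator, i.e. C^3 functions b with
  b(0) = b(L) = 0 and b'(0) = 0 (b1, b2, b3 are the first three derivatives).\<close>

definition kdv_test :: "real \<Rightarrow> (real \<Rightarrow> real) \<Rightarrow> (real \<Rightarrow> real) \<Rightarrow> (real \<Rightarrow> real)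
    \<Rightarrow> (real \<Rightarrow> real) \<Rightarrow> bool" where
  "kdv_test L b b1 b2 b3 \<longleftrightarrow>
     (\<forall>x. (b has_real_derivative b1 x) (at x)) \<and>
     (\<forall>x. (b1 has_real_derivative b2 x) (at x)) \<and>
     (\<forall>x. (b2 has_real_derivative b3 x) (at x)) \<and>
     continuous_on UNIV b3 \<and> b 0 = 0 \<and> b L = 0 \<and> b1 0 = 0"

text \<open>Global (t \<ge> 0) solution of
  y_t + y_x + y y_x + y_xxx = 0, y(t,0)=y(t,L)=0, y_x(t,L)=0, y(0)=y0,
  in the class C([0,T];L^2(0,L)) \<inter> L^2(0,T;H^1_0(0,L)) for every T,
  with the equation holding in the weak sense against the domain of the adjoint
  (this encodes the boundary condition y_x(t,L)=0).\<close>

definition kdv_solution :: "real \<Rightarrow> (real \<Rightarrow> real) \<Rightarrow> (real \<Rightarrow> real \<Rightarrow> real) \<Rightarrow> bool" where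
  "kdv_solution L y0 y \<longleftrightarrow>
     in_L2 L y0 \<and>
     set_borel_measurable lborel ({0..} \<times> {0..L}) (\<lambda>(t,x). y t x) \<and>
     (\<forall>t\<ge>0. in_L2 L (y t)) \<and>
     (\<forall>t0\<ge>0. ((\<lambda>t. L2norm L (\<lambda>x. y t x - y t0 x)) \<longlongrightarrow> 0) (at t0 within {0..})) \<and>
     L2norm L (\<lambda>x. y 0 x - y0 x) = 0 \<and>
     (\<exists>yx :: real \<Rightarrow> real \<Rightarrow> real.
        set_borel_measurable lborel ({0..} \<times> {0..L}) (\<lambda>(t,x). yx t x) \<and>
        (\<forall>T\<ge>0. set_integrable lborel ({0..T} \<times> {0..L}) (\<lambda>(t,x). (yx t x)^2)) \<and>
        (AE t in lborel. t \<ge> 0 \<longrightarrow>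
           (\<forall>x\<in>{0..L}. set_integrable lborel {0..x} (yx t) \<and>
                        y t x = (LINT s:{0..x}|lborel. yx t s)) \<and> y t L = 0)) \<and>
     (\<forall>b b1 b2 b3. kdv_test L b b1 b2 b3 \<longrightarrow>
        (\<forall>t\<ge>0. (LINT x:{0..L}|lborel. y t x * b x) - (LINT x:{0..L}|lborel. y0 x * b x) =
           (LINT s:{0..t}|lborel. LINT x:{0..L}|lborel.
               y s x * (b1 x + b3 x) + (y s x)^2 / 2 * b1 x)))"

end

theory Submission
  imports Defs
begin

text \<open>
  Write \<open>y = a phi + w\<close> with \<open>phi = 1 - cos\<close>, which spans the kernel of the linearization and of its adjoint,
  and \<open>w\<close> orthogonal to \<open>phi\<close>. On the complement of \<open>phi\<close> the Poincare constant is 1, so for the linear flow the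
  multiplier \<open>(1 + x) w\<close> gives
  \<open>d/dt 1/2 \<integral> (1 + x) w\<^sup>2 \<le> 1/2 \<integral> w\<^sup>2 - 3/2 \<integral> w'\<^sup>2 \<le> - \<integral> w'\<^sup>2\<close>. The quadratic coupling
  of \<open>a\<close> with \<open>w\<close> is removed by a corrector \<open>b\<close> with \<open>b' + b''' = phi phi'\<close> in the domain of the adjoint, and what
  remains is the cubic damping \<open>3 \<pi> a a' = - \<pi>\<^sup>2/2 a\<^sup>4 + ...\<close>. Hence, for small \<open>K\<close>, the functional
  \<open>(3\<pi>/2 - \<integral> y b) a\<^sup>2 + K/2 \<integral> (1 + x) w\<^sup>2\<close> is equivalent to the squared norm near \<open>0\<close> and decays at a
  rate of order \<open>|y|\<^sup>4\<close>.

  A weak solution is too rough for these computations. They are carried out for its Steklov averages \<open>u\<close> over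
  \<open>[t, t + h]\<close>: their time derivative is a difference quotient in L2, so the weak equation makes them \<open>C\<^sup>2\<close> in space
  with all boundary conditions. The averaged nonlinearity differs from \<open>u\<^sup>2/2\<close> by a variance in time, which vanishes
  as \<open>h \<rightarrow> 0\<close> because \<open>y\<close> is uniformly continuous in time with values in L2.
\<close>

section \<open>The inner product of L2(0,L)\<close>

text \<open>On the line spanned by \<open>phi\<close> the linear flow is stationary, and the
  quadratic term projected on it vanishes because \<integral> phi^2 phi' = 0. Damping comes only
  from the response of w to the forcing a^2 phi phi'. The corrector extracts it without solving for
  w: the derivative of - a^2 \<integral> y b cancels a^2 \<integral> w phi phi' and leaves -
  \<pi>^2/2 a^4. The Poincare constant 1 is essential. Dirichlet conditions alone give \<integral>
  w^2 \<le> 4 \<integral> w'^2, attained by sin (x/2), and 1/2 * 4 exceeds 3/2. The dissipation a^4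
  + |w|^2 is degenerate, so every error has to be compared with this quantity; this comparison fixes
  \<open>Kw\<close> and the radius 10^-7. The averaging error is not small at each time: its L2 norm
  involves the supremum of y^2, which has only an integrable bound in time. It is estimated by
  \<omega>^2, with \<omega> the modulus of continuity of y, times a difference quotient of the
  primitive of that bound. This is an exact time derivative, so it is harmless after integration,
  uniformly in h.\<close>

definition ip :: "real \<Rightarrow> (real \<Rightarrow> real) \<Rightarrow> (real \<Rightarrow> real) \<Rightarrow> real" where
  "ip L f g = (LINT x:{0..L}|lborel. f x * g x)"

lemma L2norm_eq_ip: "L2norm L f = sqrt (ip L f f)"
  by (simp add: L2norm_def ip_def power2_eq_square)

lemma ip_commute: "ip L f g = ip L g f"
  by (simp add: ip_def mult.commute)

section \<open>Measurability and square integrability on (0,L)\<close>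

lemma set_borel_measurable_times:
  fixes f g :: "'a \<Rightarrow> real"
  assumes "set_borel_measurable M A f" "set_borel_measurable M A g"
  shows "set_borel_measurable M A (\<lambda>x. f x * g x)"
proof -
  have "(\<lambda>x. (indicator A x *\<^sub>R f x) * (indicator A x *\<^sub>R g x)) \<in> borel_measurable M"
    using assms unfolding set_borel_measurable_def by (rule borel_measurable_times)
  moreover have "(\<lambda>x. (indicator A x *\<^sub>R f x) * (indicator A x *\<^sub>R g x)) = (\<lambda>x. indicator A x *\<^sub>R (f x * g x))"
    by (auto simp: indicator_def)
  ultimately show ?thesis by (simp add: set_borel_measurable_def)
qed

lemma set_borel_measurable_add:
  fixes f g :: "'a \<Rightarrow> real"
  assumes "set_borel_measurable M A f" "set_borel_measurable M A g"
  shows "set_borel_measurable M A (\<lambda>x. f x + g x)"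
proof -
  have "(\<lambda>x. (indicator A x *\<^sub>R f x) + (indicator A x *\<^sub>R g x)) \<in> borel_measurable M"
    using assms unfolding set_borel_measurable_def by (rule borel_measurable_add)
  then show ?thesis by (simp add: set_borel_measurable_def distrib_left)
qed

lemma set_integrable_boundI:
  fixes f g :: "'a \<Rightarrow> real"
  assumes "set_integrable M A g" "set_borel_measurable M A f" "\<And>x. x \<in> A \<Longrightarrow> \<bar>f x\<bar> \<le> g x"
  shows "set_integrable M A f"
proof (rule set_integrable_bound[OF assms(1,2)])
  show "AE x in M. x \<in> A \<longrightarrow> norm (f x) \<le> norm (g x)"
    using assms(3) by (fastforce intro!: AE_I2)
qed

lemma set_borel_measurable_continuous_Icc:
  fixes f :: "real \<Rightarrow> real"
  assumes "continuous_on {a..b} f"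
  shows "set_borel_measurable lborel {a..b} f"
  using borel_integrable_atLeastAtMost'[OF assms]
  unfolding set_integrable_def set_borel_measurable_def by (rule borel_measurable_integrable)

lemma set_integrable_mult_L2:
  assumes "in_L2 L f" "in_L2 L g"
  shows "set_integrable lborel {0..L} (\<lambda>x. f x * g x)"
proof (rule set_integrable_boundI[where g = "\<lambda>x. (f x)^2 + (g x)^2"])
  show "set_integrable lborel {0..L} (\<lambda>x. (f x)^2 + (g x)^2)"
    using assms by (auto simp: in_L2_def)
  show "set_borel_measurable lborel {0..L} (\<lambda>x. f x * g x)"
    using assms by (auto simp: in_L2_def intro: set_borel_measurable_times)
  show "\<bar>f x * g x\<bar> \<le> (f x)\<^sup>2 + (g x)\<^sup>2" for x
  proof -
    have "0 \<le> (\<bar>f x\<bar> - \<bar>g x\<bar>)\<^sup>2" by simp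
    then have "2 * (\<bar>f x\<bar> * \<bar>g x\<bar>) \<le> (f x)\<^sup>2 + (g x)\<^sup>2" by (simp add: power2_diff)
    moreover have "0 \<le> \<bar>f x\<bar> * \<bar>g x\<bar>" by simp
    ultimately show ?thesis unfolding abs_mult by linarith
  qed
qed

lemma in_L2_continuous: "continuous_on {0..L} f \<Longrightarrow> in_L2 L f"
  unfolding in_L2_def
  by (auto intro!: set_borel_measurable_continuous_Icc borel_integrable_atLeastAtMost' continuous_intros)

lemma in_L2_integrable: "in_L2 L f \<Longrightarrow> set_integrable lborel {0..L} f"
  using set_integrable_mult_L2[of L f "\<lambda>_. 1"] in_L2_continuous[of L "\<lambda>_. 1"] by simp

lemma in_L2_mult_continuous:
  assumes "in_L2 L f" "continuous_on {0..L} g"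
  shows "in_L2 L (\<lambda>x. g x * f x)"
proof -
  have "bounded (g ` {0..L})"
    using assms(2) compact_continuous_image compact_imp_bounded by blast
  then obtain B where "\<forall>x\<in>{0..L}. \<bar>g x\<bar> \<le> B"
    by (auto simp: bounded_iff)
  then have B: "\<bar>g x\<bar> \<le> B" if "x \<in> {0..L}" for x
    using that by blast
  have meas: "set_borel_measurable lborel {0..L} (\<lambda>x. g x * f x)"
    using assms by (intro set_borel_measurable_times[OF set_borel_measurable_continuous_Icc]) (auto simp: in_L2_def)
  moreover have "set_integrable lborel {0..L} (\<lambda>x. (g x * f x)\<^sup>2)"
  proof (rule set_integrable_boundI[where g = "\<lambda>x. B^2 * (f x)^2"])
    show "set_integrable lborel {0..L} (\<lambda>x. B^2 * (f x)^2)" using assms by (auto simp: in_L2_def)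
    show "set_borel_measurable lborel {0..L} (\<lambda>x. (g x * f x)\<^sup>2)"
      unfolding power2_eq_square by (intro set_borel_measurable_times[OF meas meas])
    show "\<bar>(g x * f x)\<^sup>2\<bar> \<le> B\<^sup>2 * (f x)\<^sup>2" if "x \<in> {0..L}" for x
    proof -
      have "\<bar>g x\<bar>\<^sup>2 \<le> B\<^sup>2" by (intro power_mono B that) simp
      then show ?thesis by (simp add: power_mult_distrib mult_right_mono)
    qed
  qed
  ultimately show ?thesis by (simp add: in_L2_def)
qed

lemma in_L2_scale: "in_L2 L f \<Longrightarrow> in_L2 L (\<lambda>x. c * f x)"
  using in_L2_mult_continuous[of L f "\<lambda>_. c"] by simp

lemma in_L2_add:
  assumes "in_L2 L f" "in_L2 L g"
  shows "in_L2 L (\<lambda>x. f x + g x)"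
proof -
  have "set_integrable lborel {0..L} (\<lambda>x. (f x)^2 + 2 * (f x * g x) + (g x)^2)"
    using assms set_integrable_mult_L2[OF assms] by (intro set_integral_add) (auto simp: in_L2_def)
  moreover have "(\<lambda>x. (f x)^2 + 2 * (f x * g x) + (g x)^2) = (\<lambda>x. (f x + g x)^2)"
    by (auto simp: power2_sum)
  ultimately show ?thesis
    using assms by (auto simp: in_L2_def intro: set_borel_measurable_add)
qed

lemma in_L2_diff: "in_L2 L f \<Longrightarrow> in_L2 L g \<Longrightarrow> in_L2 L (\<lambda>x. f x - g x)"
  using in_L2_add[OF _ in_L2_scale[where c = "-1"], of L f g] by simp

section \<open>Bilinearity, Cauchy-Schwarz and the triangle inequality\<close>

lemma ip_add_left:
  "in_L2 L f \<Longrightarrow> in_L2 L g \<Longrightarrow> in_L2 L k \<Longrightarrow> ip L (\<lambda>x. f x + g x) k = ip L f k + ip L g k"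
  unfolding ip_def distrib_right by (intro set_integral_add set_integrable_mult_L2)

lemma ip_diff_left:
  "in_L2 L f \<Longrightarrow> in_L2 L g \<Longrightarrow> in_L2 L k \<Longrightarrow> ip L (\<lambda>x. f x - g x) k = ip L f k - ip L g k"
  unfolding ip_def left_diff_distrib by (intro set_integral_diff set_integrable_mult_L2)

lemma ip_scale_left: "ip L (\<lambda>x. c * f x) k = c * ip L f k"
  by (simp add: ip_def mult.assoc)

lemma ip_add_right:
  "in_L2 L f \<Longrightarrow> in_L2 L g \<Longrightarrow> in_L2 L k \<Longrightarrow> ip L k (\<lambda>x. f x + g x) = ip L k f + ip L k g"
  by (simp add: ip_commute[of L k] ip_add_left)

lemma ip_diff_right:
  "in_L2 L f \<Longrightarrow> in_L2 L g \<Longrightarrow> in_L2 L k \<Longrightarrow> ip L k (\<lambda>x. f x - g x) = ip L k f - ip L k g"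
  by (simp add: ip_commute[of L k] ip_diff_left)

lemma ip_scale_right: "ip L k (\<lambda>x. c * f x) = c * ip L k f"
  by (simp add: ip_commute[of L k] ip_scale_left)

lemma ip_cong: "(\<And>x. x \<in> {0..L} \<Longrightarrow> f x * g x = f' x * g' x) \<Longrightarrow> ip L f g = ip L f' g'"
  unfolding ip_def by (rule set_lebesgue_integral_cong) auto

lemma ip_nonneg: "0 \<le> ip L f f"
  unfolding ip_def set_lebesgue_integral_def by (rule integral_nonneg_AE) (auto simp: indicator_def)

lemma L2norm_nonneg: "0 \<le> L2norm L f"
  by (simp add: L2norm_eq_ip ip_nonneg)

lemma L2norm_power2: "(L2norm L f)\<^sup>2 = ip L f f"
  by (simp add: L2norm_eq_ip ip_nonneg)

lemma ip_diff_scale_self: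
  assumes "in_L2 L f" "in_L2 L g"
  shows "ip L (\<lambda>x. f x - k * g x) (\<lambda>x. f x - k * g x) = ip L f f - 2 * k * ip L f g + k\<^sup>2 * ip L g g"
  using assms in_L2_scale[OF assms(2), of k] in_L2_diff[OF assms(1) in_L2_scale[OF assms(2)], of k]
  by (simp add: ip_diff_left ip_diff_right ip_scale_left ip_scale_right ip_commute[of L g f]
      algebra_simps power2_eq_square)

lemma ip_bound:
  assumes f: "in_L2 L f" and g: "in_L2 L g"
  shows "\<bar>ip L f g\<bar> \<le> L2norm L f * L2norm L g"
proof -
  have quad: "0 \<le> ip L f f + 2 * t * ip L f g + t\<^sup>2 * ip L g g" for t
  proof -
    have tg: "in_L2 L (\<lambda>x. t * g x)" by (rule in_L2_scale[OF g])
    note s = in_L2_add[OF f tg]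
    have "0 \<le> ip L (\<lambda>x. f x + t * g x) (\<lambda>x. f x + t * g x)" by (rule ip_nonneg)
    also have "\<dots> = ip L f f + 2 * t * ip L f g + t\<^sup>2 * ip L g g"
      using f g tg s by (simp add: ip_add_left ip_add_right ip_scale_left ip_scale_right
          ip_commute[of L g f] algebra_simps power2_eq_square)
    finally show ?thesis .
  qed
  have "(ip L f g)\<^sup>2 \<le> ip L f f * ip L g g"
  proof (cases "ip L g g = 0")
    case True
    have "ip L f g = 0"
    proof (rule ccontr)
      assume "ip L f g \<noteq> 0"
      \<comment> \<open>When g has norm zero the quadratic in \<open>t\<close> is affine, and this
        value of \<open>t\<close> makes it equal to -1.\<close>
      then show False
        using quad[of "- (ip L f f + 1) / (2 * ip L f g)"] True by (simp add: field_simps)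
    qed
    then show ?thesis using True by simp
  next
    case False
    then have pos: "0 < ip L g g" using ip_nonneg[of L g] by simp
    have "0 \<le> ip L f f - (ip L f g)\<^sup>2 / ip L g g"
      using quad[of "- ip L f g / ip L g g"] pos by (simp add: field_simps power2_eq_square)
    then show ?thesis using pos by (simp add: field_simps)
  qed
  then have "sqrt ((ip L f g)\<^sup>2) \<le> sqrt (ip L f f * ip L g g)" by (rule real_sqrt_le_mono)
  then show ?thesis by (simp add: L2norm_eq_ip real_sqrt_mult)
qed

lemma L2norm_add_le:
  assumes f: "in_L2 L f" and g: "in_L2 L g"
  shows "L2norm L (\<lambda>x. f x + g x) \<le> L2norm L f + L2norm L g"
proof (rule power2_le_imp_le)
  have "(L2norm L (\<lambda>x. f x + g x))\<^sup>2 = ip L f f + 2 * ip L f g + ip L g g"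
    using f g in_L2_add[OF f g] by (simp add: L2norm_power2 ip_add_left ip_add_right ip_commute[of L g f])
  also have "\<dots> \<le> (L2norm L f + L2norm L g)\<^sup>2"
    using ip_bound[OF f g] by (simp add: power2_sum L2norm_power2)
  finally show "(L2norm L (\<lambda>x. f x + g x))\<^sup>2 \<le> (L2norm L f + L2norm L g)\<^sup>2" .
qed (simp add: L2norm_nonneg)

lemma L2norm_minus_commute: "L2norm L (\<lambda>x. f x - g x) = L2norm L (\<lambda>x. g x - f x)"
  by (simp add: L2norm_def power2_commute)

lemma L2norm_triangle:
  assumes "in_L2 L f" "in_L2 L g" "in_L2 L k"
  shows "L2norm L (\<lambda>x. f x - k x) \<le> L2norm L (\<lambda>x. f x - g x) + L2norm L (\<lambda>x. g x - k x)"
  using L2norm_add_le[OF in_L2_diff[OF assms(1,2)] in_L2_diff[OF assms(2,3)]] by simp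

lemma L2norm_diff_bound:
  assumes "in_L2 L f" "in_L2 L g"
  shows "\<bar>L2norm L f - L2norm L g\<bar> \<le> L2norm L (\<lambda>x. f x - g x)"
proof -
  have "L2norm L f \<le> L2norm L (\<lambda>x. f x - g x) + L2norm L g"
    using L2norm_add_le[OF in_L2_diff[OF assms] assms(2)] by simp
  moreover have "L2norm L g \<le> L2norm L (\<lambda>x. f x - g x) + L2norm L f"
    using L2norm_add_le[OF in_L2_diff[OF assms(2,1)] assms(1)] by (simp add: L2norm_minus_commute[of L f])
  ultimately show ?thesis by linarith
qed

section \<open>Integration over compact intervals and multiplication by bounded functions\<close>

lemma LINT_Icc_FTC:
  fixes f F :: "real \<Rightarrow> real"
  assumes "a \<le> b" "\<And>x. x \<in> {a..b} \<Longrightarrow> (F has_real_derivative f x) (at x within {a..b})"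
    and "continuous_on {a..b} f"
  shows "(LINT x:{a..b}|lborel. f x) = F b - F a"
  using assms unfolding set_lebesgue_integral_def
  by (intro integral_FTC_atLeastAtMost) (auto simp: has_real_derivative_iff_has_vector_derivative)

lemma LINT_Icc_combine:
  fixes f :: "real \<Rightarrow> real"
  assumes "a \<le> b" "b \<le> c" "set_integrable lborel {a..c} f"
  shows "(LINT x:{a..c}|lborel. f x) = (LINT x:{a..b}|lborel. f x) + (LINT x:{b..c}|lborel. f x)"
proof -
  have "set_integrable lborel {a..b} f" "set_integrable lborel {b..c} f"
    using assms by (auto intro: set_integrable_subset)
  then show ?thesis
    using Henstock_Kurzweil_Integration.integral_combine[OF assms(1,2) set_borel_integral_eq_integral(1)[OF assms(3)]] assms(3)
    by (simp add: set_borel_integral_eq_integral(2))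
qed

lemma ip_self_eq_0_imp:
  fixes e :: "real \<Rightarrow> real"
  assumes "0 < L" "continuous_on {0..L} e" "ip L e e = 0" "x \<in> {0..L}"
  shows "e x = 0"
proof -
  have c: "continuous_on {0..L} (\<lambda>x. e x * e x)" by (intro continuous_intros assms)
  have "integral {0..L} (\<lambda>x. e x * e x) = 0"
    using assms(3) set_borel_integral_eq_integral(2)[OF borel_integrable_atLeastAtMost'[OF c]] by (simp add: ip_def)
  then show ?thesis using integral_eq_0_iff[OF c assms(1)] assms(4) by simp
qed

lemma L2norm_mult_bound:
  assumes f: "in_L2 L f" and g: "continuous_on {0..L} g"
    and B: "\<And>x. x \<in> {0..L} \<Longrightarrow> \<bar>g x\<bar> \<le> B" "0 \<le> B"
  shows "L2norm L (\<lambda>x. g x * f x) \<le> B * L2norm L f"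
proof (rule power2_le_imp_le)
  note gf = in_L2_mult_continuous[OF f g]
  have "(L2norm L (\<lambda>x. g x * f x))\<^sup>2 = (LINT x:{0..L}|lborel. (g x * f x)\<^sup>2)"
    by (simp only: L2norm_power2 ip_def power2_eq_square[of "_ * _"])
  also have "\<dots> \<le> (LINT x:{0..L}|lborel. B\<^sup>2 * (f x)\<^sup>2)"
  proof (rule set_integral_mono)
    show "(g x * f x)\<^sup>2 \<le> B\<^sup>2 * (f x)\<^sup>2" if "x \<in> {0..L}" for x
      using power_mono[OF B(1)[OF that], of 2] by (simp add: power_mult_distrib mult_right_mono)
  qed (use f gf in \<open>auto simp: in_L2_def\<close>)
  also have "\<dots> = (B * L2norm L f)\<^sup>2"
    by (simp only: power_mult_distrib L2norm_power2 ip_def set_integral_mult_right power2_eq_square[of "f _"])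
  finally show "(L2norm L (\<lambda>x. g x * f x))\<^sup>2 \<le> (B * L2norm L f)\<^sup>2" .
qed (use B in \<open>simp add: L2norm_nonneg\<close>)

lemma ip_mult_bounded:
  assumes f: "in_L2 L f" and h: "in_L2 L h" and g: "continuous_on {0..L} g"
    and B: "\<And>x. x \<in> {0..L} \<Longrightarrow> \<bar>g x\<bar> \<le> B" "0 \<le> B"
  shows "\<bar>ip L f (\<lambda>x. g x * h x)\<bar> \<le> B * L2norm L f * L2norm L h"
proof -
  have "\<bar>ip L f (\<lambda>x. g x * h x)\<bar> \<le> L2norm L f * L2norm L (\<lambda>x. g x * h x)"
    by (intro ip_bound f in_L2_mult_continuous h g)
  also have "\<dots> \<le> L2norm L f * (B * L2norm L h)"
    by (intro mult_left_mono L2norm_mult_bound h g B L2norm_nonneg)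
  finally show ?thesis by (simp add: mult_ac)
qed

section \<open>Spatial regularity of weak solutions of the stationary problem\<close>

lemma integrable_lborel_pair_mult:
  fixes f g :: "real \<Rightarrow> real"
  assumes f: "integrable lborel f" and g: "integrable lborel g"
  shows "integrable (lborel \<Otimes>\<^sub>M lborel) (\<lambda>(x, y). f x * g y)"
proof (rule lborel_pair.Fubini_integrable)
  have [measurable]: "f \<in> borel_measurable lborel" "g \<in> borel_measurable lborel"
    using f g by auto
  show "(\<lambda>(x, y). f x * g y) \<in> borel_measurable (lborel \<Otimes>\<^sub>M lborel)"
    by measurable
  show "integrable lborel (\<lambda>x. LINT y|lborel. norm (case (x, y) of (x, y) \<Rightarrow> f x * g y))"
    using f by (simp add: abs_mult integrable_norm)
  show "AE x in lborel. integrable lborel (\<lambda>y. case (x, y) of (x, y) \<Rightarrow> f x * g y)"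
    using g by simp
qed

text \<open>Integration by parts against the primitive of a merely integrable function; this is Fubini's theorem
  on the triangle \<open>x \<le> s\<close>.\<close>

lemma LINT_by_parts_primitive:
  fixes D f f' :: "real \<Rightarrow> real"
  assumes L: "0 \<le> L" and D: "set_integrable lborel {0..L} D"
    and f: "\<And>x. x \<in> {0..L} \<Longrightarrow> (f has_real_derivative f' x) (at x within {0..L})"
    and f': "continuous_on {0..L} f'" and fL: "f L = 0"
  shows "ip L D f = - ip L (\<lambda>x. LINT s:{0..x}|lborel. D s) f'"
proof -
  define D' where "D' x = indicator {0..L} x * D x" for x
  define g where "g x = indicator {0..L} x * f' x" for x
  have iD: "integrable lborel D'" using D by (simp add: D'_def[abs_def] set_integrable_def)
  have ig: "integrable lborel g"
    using borel_integrable_atLeastAtMost'[OF f'] by (simp add: g_def[abs_def] set_integrable_def)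
  have [measurable]: "D' \<in> borel_measurable borel" "g \<in> borel_measurable borel" using iD ig by auto
  have iH: "integrable (lborel \<Otimes>\<^sub>M lborel) (\<lambda>(x, s). D' x * g s * (if x \<le> s then 1 else 0))"
  proof (rule Bochner_Integration.integrable_bound[OF integrable_lborel_pair_mult[OF iD ig]])
    show "(\<lambda>(x, s). D' x * g s * (if x \<le> s then 1 else 0)) \<in> borel_measurable (lborel \<Otimes>\<^sub>M lborel)"
      by measurable
  qed auto
  have swap: "(LINT s|lborel. LINT x|lborel. D' x * g s * (if x \<le> s then 1 else 0))
      = (LINT x|lborel. LINT s|lborel. D' x * g s * (if x \<le> s then 1 else 0))"
    by (rule lborel_pair.Fubini_integral[OF iH])
  have inner_x: "(LINT x|lborel. D' x * g s * (if x \<le> s then 1 else 0))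
      = indicator {0..L} s *\<^sub>R ((LINT x:{0..s}|lborel. D x) * f' s)" for s
  proof -
    have "(LINT x|lborel. D' x * g s * (if x \<le> s then 1 else 0))
        = (LINT x|lborel. g s * (indicator {0..s} x *\<^sub>R D x))"
      by (rule Bochner_Integration.integral_cong) (auto simp: D'_def g_def indicator_def)
    also have "\<dots> = indicator {0..L} s *\<^sub>R ((LINT x:{0..s}|lborel. D x) * f' s)"
      by (simp add: set_lebesgue_integral_def g_def)
    finally show ?thesis .
  qed
  have inner_s: "(LINT s|lborel. D' x * g s * (if x \<le> s then 1 else 0))
      = - (indicator {0..L} x *\<^sub>R (D x * f x))" for x
  proof (cases "x \<in> {0..L}")
    case True
    have "(LINT s|lborel. D' x * g s * (if x \<le> s then 1 else 0))
        = (LINT s|lborel. D x * (indicator {x..L} s *\<^sub>R f' s))"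
      using True by (intro Bochner_Integration.integral_cong) (auto simp: D'_def g_def indicator_def)
    also have "\<dots> = D x * (LINT s:{x..L}|lborel. f' s)" by (simp add: set_lebesgue_integral_def)
    also have "(LINT s:{x..L}|lborel. f' s) = f L - f x"
    proof (rule LINT_Icc_FTC)
      show "(f has_real_derivative f' s) (at s within {x..L})" if "s \<in> {x..L}" for s
        using f[of s] True that by (auto intro: has_field_derivative_subset)
      show "continuous_on {x..L} f'" using f' True by (auto intro: continuous_on_subset)
    qed (use True in auto)
    finally show ?thesis using True fL by simp
  qed (simp add: D'_def)
  show ?thesis
    using swap unfolding inner_x inner_s by (simp add: ip_def set_lebesgue_integral_def)
qed

lemma ip_by_parts:
  assumes L: "0 \<le> L"
    and f: "\<And>x. x \<in> {0..L} \<Longrightarrow> (f has_real_derivative f' x) (at x within {0..L})"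
    and g: "\<And>x. x \<in> {0..L} \<Longrightarrow> (g has_real_derivative g' x) (at x within {0..L})"
    and f': "continuous_on {0..L} f'" and g': "continuous_on {0..L} g'"
  shows "ip L f g' = f L * g L - f 0 * g 0 - ip L f' g"
proof -
  have cf: "continuous_on {0..L} f" using f DERIV_continuous_on by blast
  have cg: "continuous_on {0..L} g" using g DERIV_continuous_on by blast
  have "(LINT x:{0..L}|lborel. f x * g' x + f' x * g x) = f L * g L - f 0 * g 0"
    using L f g by (intro LINT_Icc_FTC continuous_intros f' g' cf cg)
      (auto intro!: derivative_eq_intros)
  moreover have "(LINT x:{0..L}|lborel. f x * g' x + f' x * g x) = ip L f g' + ip L f' g"
    unfolding ip_def by (intro set_integral_add borel_integrable_atLeastAtMost' continuous_intros f' g' cf cg)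
  ultimately show ?thesis by simp
qed

text \<open>Test functions in \<open>kdv_test\<close> are differentiable on the whole line, so
  primitives on a compact interval do not suffice.\<close>

lemma continuous_antiderivative:
  fixes f :: "real \<Rightarrow> real"
  assumes "continuous_on UNIV f"
  obtains F where "\<And>x. (F has_real_derivative f x) (at x)"
proof -
  have "\<exists>F. \<forall>x::real. - \<infinity> < ereal x \<longrightarrow> ereal x < \<infinity> \<longrightarrow> (F has_vector_derivative f x) (at x)"
    by (rule einterval_antiderivative) (use assms in \<open>auto simp: continuous_on_eq_continuous_at\<close>)
  then show ?thesis using that by (auto simp: has_real_derivative_iff_has_vector_derivative)
qed

text \<open>Read as D + (u + u'' + q)' = 0, the equation gives u'' up to a constant from the
  primitive of \<open>D\<close>. The three boundary conditions then single out a candidate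
  \<open>U\<close>, and u = U follows from testing with a b such that b''' = u - U. The last
  conclusion extends the identity to functions f with only f 0 = f L = 0; the multiplier (1 + x) w
  is of this kind, but lies outside the test class since its slope at 0 need not vanish.\<close>

lemma kdv_weak_regularity:
  assumes L: "0 < L" and D: "in_L2 L D"
    and u: "continuous_on {0..L} u" and q: "continuous_on {0..L} q"
    and u0: "u 0 = 0" and uL: "u L = 0"
    and weak: "\<And>b b1 b2 b3. kdv_test L b b1 b2 b3 \<Longrightarrow>
      ip L D b = ip L u (\<lambda>x. b1 x + b3 x) + ip L q b1"
  obtains u1 u2 where
    "\<And>x. x \<in> {0..L} \<Longrightarrow> (u has_real_derivative u1 x) (at x within {0..L})"
    "\<And>x. x \<in> {0..L} \<Longrightarrow> (u1 has_real_derivative u2 x) (at x within {0..L})"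
    "continuous_on {0..L} u2" "u1 L = 0"
    "\<And>f f'. (\<And>x. x \<in> {0..L} \<Longrightarrow> (f has_real_derivative f' x) (at x within {0..L})) \<Longrightarrow>
       continuous_on {0..L} f' \<Longrightarrow> f 0 = 0 \<Longrightarrow> f L = 0 \<Longrightarrow>
       ip L D f = ip L f' (\<lambda>x. q x + u x + u2 x)"
proof -
  note Dint = in_L2_integrable[OF D]
  define E where "E x = (LINT s:{0..x}|lborel. D s)" for x
  have E_eq: "E x = integral {0..x} D" if "x \<in> {0..L}" for x
    unfolding E_def using that
    by (intro set_borel_integral_eq_integral(2) set_integrable_subset[OF Dint]) auto
  have E: "continuous_on {0..L} E"
    using indefinite_integral_continuous_1[OF set_borel_integral_eq_integral(1)[OF Dint]]
    by (rule continuous_on_eq) (simp add: E_eq)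
  define p where "p x = - E x - q x - u x" for x
  have p: "continuous_on {0..L} p" unfolding p_def[abs_def] by (intro continuous_intros E q u)
  define P where "P x = integral {0..x} p" for x
  have dP: "(P has_real_derivative p x) (at x within {0..L})" if "x \<in> {0..L}" for x
    unfolding P_def[abs_def] by (rule integral_has_real_derivative[OF p that])
  have P: "continuous_on {0..L} P" using dP DERIV_continuous_on by blast
  define PP where "PP x = integral {0..x} P" for x
  have dPP: "(PP has_real_derivative P x) (at x within {0..L})" if "x \<in> {0..L}" for x
    unfolding PP_def[abs_def] by (rule integral_has_real_derivative[OF P that])
  \<comment> \<open>This value gives U L = 0; the form of \<open>U\<close> below already ensures U 0
    = 0 and U' L = 0.\<close>
  define c where "c = 2 * (PP L - P L * L) / L\<^sup>2"
  define U where "U x = c * (x\<^sup>2 / 2 - L * x) + PP x - P L * x" for x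
  define U1 where "U1 x = c * (x - L) + P x - P L" for x
  define U2 where "U2 x = c + p x" for x
  have dU: "(U has_real_derivative U1 x) (at x within {0..L})" if "x \<in> {0..L}" for x
    unfolding U_def[abs_def] U1_def by (auto intro!: derivative_eq_intros dPP[OF that])
  have dU1: "(U1 has_real_derivative U2 x) (at x within {0..L})" if "x \<in> {0..L}" for x
    unfolding U1_def[abs_def] U2_def by (auto intro!: derivative_eq_intros dP[OF that])
  have U2: "continuous_on {0..L} U2" unfolding U2_def[abs_def] by (intro continuous_intros p)
  have U1: "continuous_on {0..L} U1" using dU1 DERIV_continuous_on by blast
  have U: "continuous_on {0..L} U" using dU DERIV_continuous_on by blast
  have bU: "U 0 = 0" "U L = 0" "U1 L = 0"
    using L by (simp_all add: U_def U1_def c_def PP_def power2_eq_square field_simps)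

  \<comment> \<open>Clamping the argument to [0,L] extends u - U continuously to the line, as
    required of the third derivative of a test function.\<close>
  define e where "e x = u (max 0 (min L x)) - U (max 0 (min L x))" for x
  have e_eq: "e x = u x - U x" if "x \<in> {0..L}" for x using that by (simp add: e_def)
  have e: "continuous_on UNIV e"
  proof -
    have "continuous_on UNIV (\<lambda>x. (\<lambda>z. u z - U z) (max 0 (min L x)))"
      by (rule continuous_on_compose2[where s = UNIV and t = "{0..L}"])
        (use L in \<open>auto intro!: continuous_intros u U\<close>)
    then show ?thesis by (simp add: e_def[abs_def])
  qed
  obtain B2 where B2: "\<And>x. (B2 has_real_derivative e x) (at x)"
    using continuous_antiderivative[OF e] by blast
  have "continuous_on UNIV B2" using B2 DERIV_isCont continuous_at_imp_continuous_on by blast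
  then obtain B1 where B1: "\<And>x. (B1 has_real_derivative B2 x) (at x)"
    using continuous_antiderivative by blast
  have "continuous_on UNIV B1" using B1 DERIV_isCont continuous_at_imp_continuous_on by blast
  then obtain B0 where B0: "\<And>x. (B0 has_real_derivative B1 x) (at x)"
    using continuous_antiderivative by blast
  \<comment> \<open>\<open>d\<close> is chosen for b L = 0; subtracting the value and the slope of
    \<open>B0\<close> at 0 handles b 0 and b' 0.\<close>
  define d where "d = - 2 * (B0 L - B1 0 * L - B0 0) / L\<^sup>2"
  define b2 where "b2 x = B2 x + d" for x
  define b1 where "b1 x = B1 x + d * x - B1 0" for x
  define b where "b x = B0 x + d * x\<^sup>2 / 2 - B1 0 * x - B0 0" for x
  have db: "(b has_real_derivative b1 x) (at x)" for x
    unfolding b_def[abs_def] b1_def by (auto intro!: derivative_eq_intros B0)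
  have db1: "(b1 has_real_derivative b2 x) (at x)" for x
    unfolding b1_def[abs_def] b2_def by (auto intro!: derivative_eq_intros B1)
  have db2: "(b2 has_real_derivative e x) (at x)" for x
    unfolding b2_def[abs_def] by (auto intro!: derivative_eq_intros B2)
  have bb: "b 0 = 0" "b L = 0" "b1 0 = 0"
    using L by (simp_all add: b_def b1_def d_def power2_eq_square field_simps)
  have test: "kdv_test L b b1 b2 e"
    unfolding kdv_test_def using db db1 db2 e bb by blast
  have cb: "continuous_on {0..L} b" "continuous_on {0..L} b1" "continuous_on {0..L} b2" "continuous_on {0..L} e"
    using db db1 db2 e continuous_on_subset[of UNIV _ "{0..L}"] DERIV_isCont
    by (blast intro: continuous_at_imp_continuous_on)+
  note L2 = in_L2_continuous
  have Db: "ip L D b = - ip L E b1"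
    unfolding E_def using L db
    by (intro LINT_by_parts_primitive Dint cb bb) (auto intro: has_field_derivative_at_within)
  \<comment> \<open>The weak identity for \<open>u\<close> and integration by parts for
    \<open>U\<close> produce the same number, so u - U is orthogonal to e, that is, to
    itself.\<close>
  have "ip L u e = ip L p b1"
  proof -
    have "ip L p b1 = - ip L E b1 - ip L q b1 - ip L u b1"
    proof -
      have "ip L p b1 = ip L (\<lambda>x. (-1) * E x) b1 - ip L q b1 - ip L u b1"
        unfolding p_def[abs_def]
        using in_L2_diff[OF L2 L2] E q u cb
        by (simp add: ip_diff_left L2 in_L2_diff continuous_intros)
      then show ?thesis by (simp only: ip_scale_left) 
    qed
    moreover have "ip L D b = ip L u b1 + ip L u e + ip L q b1"
      using weak[OF test] by (simp add: ip_add_right L2 u cb)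
    ultimately show ?thesis using Db by simp
  qed
  moreover have "ip L U e = ip L p b1"
  proof -
    have w: "(b has_real_derivative b1 x) (at x within {0..L})"
       "(b1 has_real_derivative b2 x) (at x within {0..L})"
       "(b2 has_real_derivative e x) (at x within {0..L})" for x
      using db db1 db2 has_field_derivative_at_within by blast+
    have "ip L U e = - ip L U1 b2"
      using L by (subst ip_by_parts[OF _ dU w(3) U1 cb(4)]) (auto simp: bU)
    also have "ip L U1 b2 = - ip L U2 b1"
      using L by (subst ip_by_parts[OF _ dU1 w(2) U2 cb(3)]) (auto simp: bU bb)
    also have "ip L U2 b1 = ip L (\<lambda>_. c) b1 + ip L p b1"
      unfolding U2_def[abs_def] by (intro ip_add_left L2 continuous_intros p cb)
    also have "ip L (\<lambda>_. c) b1 = 0"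
      using L by (subst ip_by_parts[OF _ _ w(1) _ cb(2), where f' = "\<lambda>_. 0"]) (auto simp: bb ip_def)
    finally show ?thesis by simp
  qed
  moreover have "ip L e e = ip L u e - ip L U e"
    by (subst ip_diff_left[symmetric]) (auto intro!: L2 u U cb ip_cong simp: e_eq)
  ultimately have "ip L e e = 0" by simp
  then have "e x = 0" if "x \<in> {0..L}" for x using ip_self_eq_0_imp[OF L cb(4)] that by blast
  then have uU: "u x = U x" if "x \<in> {0..L}" for x using e_eq that by fastforce

  have du: "(u has_real_derivative U1 x) (at x within {0..L})" if "x \<in> {0..L}" for x
    using uU by (intro has_field_derivative_transform_within[OF dU[OF that] zero_less_one that]) simp
  show ?thesis
  proof (rule that[OF du dU1 U2 bU(3)])
    fix f f' :: "real \<Rightarrow> real"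
    assume f: "\<And>x. x \<in> {0..L} \<Longrightarrow> (f has_real_derivative f' x) (at x within {0..L})"
      and f': "continuous_on {0..L} f'" and f0: "f 0 = 0" and fL: "f L = 0"
    have "ip L D f = - ip L E f'"
      unfolding E_def using L by (intro LINT_by_parts_primitive Dint f f' fL) auto
    also have "ip L E f' = ip L (\<lambda>x. c - (q x + u x + U2 x)) f'"
      by (rule ip_cong) (simp add: U2_def p_def)
    also have "\<dots> = ip L (\<lambda>_. c) f' - ip L (\<lambda>x. q x + u x + U2 x) f'"
      by (intro ip_diff_left L2 continuous_intros q u U2 f')
    also have "ip L (\<lambda>_. c) f' = 0"
      using L by (subst ip_by_parts[OF _ _ f _ f', where f' = "\<lambda>_. 0"]) (auto simp: f0 fL ip_def)
    finally show "ip L D f = ip L f' (\<lambda>x. q x + u x + U2 x)" by (simp add: ip_commute)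
  qed
qed

section \<open>Time averages of a trajectory\<close>

text \<open>The spatial derivative of a solution enters the argument only through a locally integrable bound \<open>m\<close> for
  the square of the supremum norm.\<close>

locale kdv_trajectory =
  fixes L :: real and y0 :: "real \<Rightarrow> real" and y :: "real \<Rightarrow> real \<Rightarrow> real" and m :: "real \<Rightarrow> real"
  assumes L: "0 < L"
    and y_meas: "set_borel_measurable lborel ({0..} \<times> {0..L}) (\<lambda>(t, x). y t x)"
    and y_L2: "\<And>t. 0 \<le> t \<Longrightarrow> in_L2 L (y t)"
    and y_cont: "\<And>t0. 0 \<le> t0 \<Longrightarrow> ((\<lambda>t. L2norm L (\<lambda>x. y t x - y t0 x)) \<longlongrightarrow> 0) (at t0 within {0..})"
    and m_nonneg: "\<And>s. 0 \<le> m s"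
    and m_int: "\<And>T. 0 \<le> T \<Longrightarrow> set_integrable lborel {0..T} m"
    and y_bound: "AE s in lborel. 0 \<le> s \<longrightarrow> continuous_on {0..L} (y s) \<and> y s 0 = 0 \<and> y s L = 0
                   \<and> (\<forall>x\<in>{0..L}. (y s x)\<^sup>2 \<le> m s)"
    and y_weak: "\<And>b b1 b2 b3 t. kdv_test L b b1 b2 b3 \<Longrightarrow> 0 \<le> t \<Longrightarrow>
        ip L (y t) b - ip L y0 b =
        (LINT s:{0..t}|lborel. LINT x:{0..L}|lborel. y s x * (b1 x + b3 x) + (y s x)\<^sup>2 / 2 * b1 x)"

text \<open>The majorant k(\<tau>) |f(x)| is integrable on the product, which justifies the
  exchange. Joint measurability is known only on the half-strip, so \<open>Z\<close> is first cut
  off outside it.\<close>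

lemma Fubini_dominated:
  fixes Z :: "real \<Rightarrow> real \<Rightarrow> real"
  assumes st: "0 \<le> s"
    and Z: "set_borel_measurable lborel ({0..} \<times> {0..L}) (\<lambda>(t, x). Z t x)"
    and bnd: "AE \<tau> in lborel. 0 \<le> \<tau> \<longrightarrow> (\<forall>x\<in>{0..L}. \<bar>Z \<tau> x\<bar> \<le> k \<tau>)"
    and k: "set_integrable lborel {s..t} k" and f: "set_integrable lborel {0..L} f"
  shows "set_integrable lborel {s..t} (\<lambda>\<tau>. LINT x:{0..L}|lborel. Z \<tau> x * f x)" (is ?A)
    and "(LINT x:{0..L}|lborel. (LINT \<tau>:{s..t}|lborel. Z \<tau> x) * f x)
       = (LINT \<tau>:{s..t}|lborel. LINT x:{0..L}|lborel. Z \<tau> x * f x)" (is ?B)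
proof -
  define Z' where "Z' \<tau> x = indicator ({0..} \<times> {0..L}) (\<tau>, x) * Z \<tau> x" for \<tau> x
  define k' where "k' \<tau> = indicator {s..t} \<tau> * k \<tau>" for \<tau>
  define f' where "f' x = indicator {0..L} x * f x" for x
  have Zm: "(\<lambda>(\<tau>, x). Z' \<tau> x) \<in> borel_measurable (lborel \<Otimes>\<^sub>M lborel)"
    using Z unfolding set_borel_measurable_def lborel_prod Z'_def[abs_def]
    by (simp add: case_prod_unfold)
  have kI: "integrable lborel k'" using k by (simp add: k'_def[abs_def] set_integrable_def)
  have fI: "integrable lborel f'" using f by (simp add: f'_def[abs_def] set_integrable_def)
  have [measurable]: "(\<lambda>z. Z' (fst z) (snd z)) \<in> borel_measurable (lborel \<Otimes>\<^sub>M lborel)"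
    "f' \<in> borel_measurable lborel" "k' \<in> borel_measurable lborel"
    using Zm kI fI by (auto simp: case_prod_unfold)
  define H where "H \<tau> x = indicator {s..t} \<tau> * (Z' \<tau> x * f' x)" for \<tau> x
  have Hm[measurable]: "case_prod H \<in> borel_measurable (lborel \<Otimes>\<^sub>M lborel)"
    unfolding H_def[abs_def] case_prod_unfold by measurable
  have Hm1: "H \<tau> \<in> borel_measurable lborel" for \<tau>
    using measurable_Pair2[OF Hm, of \<tau>] by simp
  have Hb: "AE \<tau> in lborel. \<forall>x. \<bar>H \<tau> x\<bar> \<le> k' \<tau> * \<bar>f' x\<bar>"
    using bnd
  proof eventually_elim
    case (elim \<tau>)
    show ?case
    proof
      fix x
      show "\<bar>H \<tau> x\<bar> \<le> k' \<tau> * \<bar>f' x\<bar>"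
      proof (cases "\<tau> \<in> {s..t} \<and> x \<in> {0..L}")
        case True
        then have "\<bar>Z \<tau> x\<bar> \<le> k \<tau>" using elim st by auto
        then show ?thesis using True st by (auto simp: H_def Z'_def k'_def f'_def abs_mult intro!: mult_right_mono)
      next
        case False
        then show ?thesis by (auto simp: H_def k'_def f'_def)
      qed
    qed
  qed
  have HI: "integrable (lborel \<Otimes>\<^sub>M lborel) (case_prod H)"
  proof (rule lborel_pair.Fubini_integrable[OF Hm])
    show "AE \<tau> in lborel. integrable lborel (\<lambda>x. case (\<tau>, x) of (a, b) \<Rightarrow> H a b)"
      using Hb
    proof eventually_elim
      case (elim \<tau>)
      show ?case
        unfolding prod.case
      proof (rule Bochner_Integration.integrable_bound)
        show "integrable lborel (\<lambda>x. k' \<tau> * \<bar>f' x\<bar>)" using fI by simp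
        show "AE x in lborel. norm (H \<tau> x) \<le> norm (k' \<tau> * \<bar>f' x\<bar>)"
          using elim by (auto intro!: AE_I2 order_trans[OF _ abs_ge_self])
      qed (rule Hm1)
    qed
    show "integrable lborel (\<lambda>\<tau>. LINT x|lborel. norm (case (\<tau>, x) of (a, b) \<Rightarrow> H a b))"
    proof (rule Bochner_Integration.integrable_bound)
      show "integrable lborel (\<lambda>\<tau>. k' \<tau> * (LINT x|lborel. \<bar>f' x\<bar>))" using kI by simp
      show "(\<lambda>\<tau>. LINT x|lborel. norm (case (\<tau>, x) of (a, b) \<Rightarrow> H a b)) \<in> borel_measurable lborel"
        by measurable
      show "AE \<tau> in lborel. norm (LINT x|lborel. norm (case (\<tau>, x) of (a, b) \<Rightarrow> H a b)) \<le> norm (k' \<tau> * (LINT x|lborel. \<bar>f' x\<bar>))"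
        using Hb
      proof eventually_elim
        case (elim \<tau>)
        have fi: "integrable lborel (\<lambda>x. k' \<tau> * \<bar>f' x\<bar>)" using fI by simp
        have "integrable lborel (\<lambda>x. \<bar>H \<tau> x\<bar>)"
          using elim Hm1 by (intro Bochner_Integration.integrable_bound[OF fi]) (auto intro!: AE_I2 order_trans[OF _ abs_ge_self])
        then have "(LINT x|lborel. \<bar>H \<tau> x\<bar>) \<le> (LINT x|lborel. k' \<tau> * \<bar>f' x\<bar>)"
          using elim fi by (intro integral_mono) auto
        moreover have "0 \<le> (LINT x|lborel. \<bar>H \<tau> x\<bar>)" by (rule integral_nonneg_AE) auto
        ultimately show ?case by simp
      qed
    qed
  qed
  have inner: "(LINT x|lborel. H \<tau> x) = indicator {s..t} \<tau> *\<^sub>R (LINT x:{0..L}|lborel. Z \<tau> x * f x)" for \<tau>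
  proof -
    have "(LINT x|lborel. H \<tau> x) = (LINT x|lborel. indicator {s..t} \<tau> * (indicator {0..L} x *\<^sub>R (Z \<tau> x * f x)))"
      using st by (intro Bochner_Integration.integral_cong) (auto simp: H_def Z'_def f'_def indicator_def)
    then show ?thesis by (simp add: set_lebesgue_integral_def)
  qed
  have inner2: "(LINT \<tau>|lborel. H \<tau> x) = indicator {0..L} x *\<^sub>R ((LINT \<tau>:{s..t}|lborel. Z \<tau> x) * f x)" for x
  proof -
    have "(LINT \<tau>|lborel. H \<tau> x) = (LINT \<tau>|lborel. f' x * (indicator {s..t} \<tau> *\<^sub>R Z \<tau> x))"
      using st by (intro Bochner_Integration.integral_cong) (auto simp: H_def Z'_def f'_def indicator_def)
    then show ?thesis by (simp add: set_lebesgue_integral_def f'_def)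
  qed
  show ?A using lborel_pair.integrable_fst[OF HI] unfolding inner by (simp add: set_integrable_def)
  show ?B using lborel_pair.Fubini_integral[OF HI] unfolding inner inner2 by (simp add: set_lebesgue_integral_def)
qed

lemma dominated_slice:
  fixes Z :: "real \<Rightarrow> real \<Rightarrow> real"
  assumes st: "0 \<le> s"
    and Z: "set_borel_measurable lborel ({0..} \<times> {0..L}) (\<lambda>(t, x). Z t x)"
    and bnd: "AE \<tau> in lborel. 0 \<le> \<tau> \<longrightarrow> (\<forall>x\<in>{0..L}. \<bar>Z \<tau> x\<bar> \<le> k \<tau>)"
    and k: "set_integrable lborel {s..t} k" and x: "x \<in> {0..L}"
  shows "set_integrable lborel {s..t} (\<lambda>\<tau>. Z \<tau> x)"
proof (rule set_integrable_bound[OF k])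
  have "(\<lambda>z. indicator ({0..} \<times> {0..L}) z *\<^sub>R (case z of (t, x) \<Rightarrow> Z t x)) \<in> borel_measurable (lborel \<Otimes>\<^sub>M lborel)"
    using Z unfolding set_borel_measurable_def lborel_prod .
  from measurable_Pair1[OF this, of x]
  have [measurable]: "(\<lambda>\<tau>. indicator ({0..} \<times> {0..L}) (\<tau>, x) * Z \<tau> x) \<in> borel_measurable lborel"
    by simp
  have "(\<lambda>\<tau>. indicator {s..t} \<tau> * (indicator ({0..} \<times> {0..L}) (\<tau>, x) * Z \<tau> x)) \<in> borel_measurable lborel"
    by measurable
  also have "(\<lambda>\<tau>. indicator {s..t} \<tau> * (indicator ({0..} \<times> {0..L}) (\<tau>, x) * Z \<tau> x)) = (\<lambda>\<tau>. indicator {s..t} \<tau> *\<^sub>R Z \<tau> x)"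
    using st x by (auto simp: indicator_def)
  finally show "set_borel_measurable lborel {s..t} (\<lambda>\<tau>. Z \<tau> x)" unfolding set_borel_measurable_def .
  show "AE \<tau> in lborel. \<tau> \<in> {s..t} \<longrightarrow> norm (Z \<tau> x) \<le> norm (k \<tau>)"
    using bnd by eventually_elim (use st x in fastforce)
qed

lemma continuous_on_dominated_LINT:
  fixes Z :: "real \<Rightarrow> real \<Rightarrow> real"
  assumes st: "0 \<le> s"
    and Z: "set_borel_measurable lborel ({0..} \<times> {0..L}) (\<lambda>(t, x). Z t x)"
    and bnd: "AE \<tau> in lborel. 0 \<le> \<tau> \<longrightarrow> (\<forall>x\<in>{0..L}. \<bar>Z \<tau> x\<bar> \<le> k \<tau>)"
    and cont: "AE \<tau> in lborel. 0 \<le> \<tau> \<longrightarrow> continuous_on {0..L} (Z \<tau>)"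
    and k: "set_integrable lborel {s..t} k"
  shows "continuous_on {0..L} (\<lambda>x. LINT \<tau>:{s..t}|lborel. Z \<tau> x)"
  unfolding continuous_on_sequentially
proof (intro allI ballI impI, elim conjE)
  fix X a assume a: "a \<in> {0..L}" and X: "\<forall>n. X n \<in> {0..L}" and lim: "X \<longlonglongrightarrow> a"
  note sl = dominated_slice[OF st Z bnd k]
  have "(\<lambda>n. LINT \<tau>|lborel. indicator {s..t} \<tau> *\<^sub>R Z \<tau> (X n)) \<longlonglongrightarrow> (LINT \<tau>|lborel. indicator {s..t} \<tau> *\<^sub>R Z \<tau> a)"
  proof (rule integral_dominated_convergence[where w = "\<lambda>\<tau>. indicator {s..t} \<tau> *\<^sub>R k \<tau>"])
    show "integrable lborel (\<lambda>\<tau>. indicator {s..t} \<tau> *\<^sub>R k \<tau>)" using k by (simp add: set_integrable_def)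
    show "(\<lambda>\<tau>. indicator {s..t} \<tau> *\<^sub>R Z \<tau> a) \<in> borel_measurable lborel"
      using sl[OF a] unfolding set_integrable_def by (rule borel_measurable_integrable)
    show "(\<lambda>\<tau>. indicator {s..t} \<tau> *\<^sub>R Z \<tau> (X n)) \<in> borel_measurable lborel" for n
      using sl[of "X n"] X unfolding set_integrable_def by (blast intro: borel_measurable_integrable)
    show "AE \<tau> in lborel. norm (indicator {s..t} \<tau> *\<^sub>R Z \<tau> (X n)) \<le> indicator {s..t} \<tau> *\<^sub>R k \<tau>" for n
      using bnd by eventually_elim (use st X in \<open>auto simp: indicator_def\<close>)
    show "AE \<tau> in lborel. (\<lambda>n. indicator {s..t} \<tau> *\<^sub>R Z \<tau> (X n)) \<longlonglongrightarrow> indicator {s..t} \<tau> *\<^sub>R Z \<tau> a"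
      using cont
    proof eventually_elim
      case (elim \<tau>)
      show ?case
      proof (cases "\<tau> \<in> {s..t}")
        case True
        then have "continuous_on {0..L} (Z \<tau>)" using elim st by auto
        then have "(\<lambda>n. Z \<tau> (X n)) \<longlonglongrightarrow> Z \<tau> a"
          using a X lim unfolding continuous_on_sequentially comp_def by blast
        then show ?thesis by (intro tendsto_intros)
      qed simp
    qed
  qed
  then show "((\<lambda>x. LINT \<tau>:{s..t}|lborel. Z \<tau> x) \<circ> X) \<longlonglongrightarrow> (LINT \<tau>:{s..t}|lborel. Z \<tau> a)"
    by (simp add: comp_def set_lebesgue_integral_def)
qed

section \<open>Steklov averages and the equation they satisfy\<close>

context kdv_trajectory
begin

lemma y2_meas: "set_borel_measurable lborel ({0..} \<times> {0..L}) (\<lambda>(t, x). (y t x)\<^sup>2)"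
  using set_borel_measurable_times[OF y_meas y_meas] by (simp add: case_prod_unfold power2_eq_square)

text \<open>From 2 |y| \<le> 1 + y^2. The majorant inherits local integrability in time from
  \<open>m\<close>.\<close>

lemma y_dom: "AE s in lborel. 0 \<le> s \<longrightarrow> (\<forall>x\<in>{0..L}. \<bar>y s x\<bar> \<le> 1 + m s)"
  using y_bound
proof eventually_elim
  case (elim s)
  show ?case
  proof (intro impI ballI)
    fix x assume "0 \<le> s" "x \<in> {0..L}"
    then have "(y s x)\<^sup>2 \<le> m s" using elim by auto
    moreover have "2 * \<bar>y s x\<bar> \<le> 1 + (y s x)\<^sup>2"
      using zero_le_power2[of "\<bar>y s x\<bar> - 1"] by (simp add: power2_diff)
    ultimately show "\<bar>y s x\<bar> \<le> 1 + m s" by (smt (verit) zero_le_power2)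
  qed
qed

lemma y2_dom: "AE s in lborel. 0 \<le> s \<longrightarrow> (\<forall>x\<in>{0..L}. \<bar>(y s x)\<^sup>2\<bar> \<le> m s)"
  using y_bound by eventually_elim auto

lemma m_int': "0 \<le> s \<Longrightarrow> set_integrable lborel {s..t} m"
  using m_int[of "max 0 t"] by (rule set_integrable_subset) auto

lemma m1_int: "0 \<le> s \<Longrightarrow> set_integrable lborel {s..t} (\<lambda>\<tau>. 1 + m \<tau>)"
  by (intro set_integral_add m_int' borel_integrable_atLeastAtMost' continuous_intros)

lemmas y_Fubini = Fubini_dominated[OF _ y_meas y_dom m1_int]
lemmas y2_Fubini = Fubini_dominated[OF _ y2_meas y2_dom m_int']

definition av :: "real \<Rightarrow> real \<Rightarrow> real \<Rightarrow> real" where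
  "av h t x = (1 / h) * (LINT s:{t..t+h}|lborel. y s x)"

text \<open>The averaged flux y^2/2; its excess over half the square of \<open>av\<close> is half
  the variance of y over the time window.\<close>

definition qv :: "real \<Rightarrow> real \<Rightarrow> real \<Rightarrow> real" where
  "qv h t x = (1 / (2 * h)) * (LINT s:{t..t+h}|lborel. (y s x)\<^sup>2)"

text \<open>The time derivative of \<open>av h\<close>, in the sense of
  \<open>ip_av_derivative\<close>. It is in L2, while y itself is only continuous in time.\<close>

definition dq :: "real \<Rightarrow> real \<Rightarrow> real \<Rightarrow> real" where
  "dq h t x = (1 / h) * (y (t + h) x - y t x)"

lemma av_continuous: "0 \<le> t \<Longrightarrow> continuous_on {0..L} (av h t)"
  unfolding av_def[abs_def]
proof (intro continuous_intros continuous_on_dominated_LINT[OF _ y_meas y_dom _ m1_int])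
  show "AE \<tau> in lborel. 0 \<le> \<tau> \<longrightarrow> continuous_on {0..L} (y \<tau>)"
    using y_bound by eventually_elim auto
qed

lemma qv_continuous: "0 \<le> t \<Longrightarrow> continuous_on {0..L} (qv h t)"
  unfolding qv_def[abs_def]
proof (intro continuous_intros continuous_on_dominated_LINT[OF _ y2_meas y2_dom _ m_int'])
  show "AE \<tau> in lborel. 0 \<le> \<tau> \<longrightarrow> continuous_on {0..L} (\<lambda>x. (y \<tau> x)\<^sup>2)"
    using y_bound by eventually_elim (auto intro!: continuous_intros)
qed

lemma av_boundary:
  assumes "0 \<le> t" shows "av h t 0 = 0" "av h t L = 0"
proof -
  have "(LINT s:{t..t+h}|lborel. y s x) = 0" if "x = 0 \<or> x = L" for x
  proof -
    have "(LINT s|lborel. indicator {t..t+h} s *\<^sub>R y s x) = 0"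
    proof (rule integral_eq_zero_AE)
      show "AE s in lborel. indicator {t..t+h} s *\<^sub>R y s x = 0"
        using y_bound by eventually_elim (use assms that in \<open>auto simp: indicator_def\<close>)
    qed
    then show ?thesis by (simp add: set_lebesgue_integral_def)
  qed
  then show "av h t 0 = 0" "av h t L = 0" by (auto simp: av_def)
qed

lemma ip_av:
  assumes "0 \<le> t" "in_L2 L f"
  shows "ip L (av h t) f = (1 / h) * (LINT s:{t..t+h}|lborel. ip L (y s) f)"
  using y_Fubini(2)[OF assms(1,1) in_L2_integrable[OF assms(2)], of "t+h"]
  by (simp add: ip_def av_def)

lemma ip_qv:
  assumes "0 \<le> t" "in_L2 L f"
  shows "ip L (qv h t) f = (1 / (2 * h)) * (LINT s:{t..t+h}|lborel. LINT x:{0..L}|lborel. (y s x)\<^sup>2 * f x)"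
  using y2_Fubini(2)[OF assms(1,1) in_L2_integrable[OF assms(2)], of "t+h"]
  by (simp add: ip_def qv_def)

lemma dq_L2: "0 \<le> t \<Longrightarrow> 0 < h \<Longrightarrow> in_L2 L (dq h t)"
  unfolding dq_def[abs_def] by (intro in_L2_scale in_L2_diff y_L2) auto

text \<open>Subtract the weak formulations at times t + h and t and divide by h. At each fixed time
  the averages thus solve a stationary weak problem of the form treated by
  \<open>kdv_weak_regularity\<close>.\<close>

lemma av_weak:
  assumes t: "0 \<le> t" and h: "0 < h" and b: "kdv_test L b b1 b2 b3"
  shows "ip L (dq h t) b = ip L (av h t) (\<lambda>x. b1 x + b3 x) + ip L (qv h t) b1"
proof -
  have cb: "continuous_on {0..L} b" "continuous_on {0..L} b1" "continuous_on {0..L} b3"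
    using b continuous_on_subset[of UNIV _ "{0..L}"] unfolding kdv_test_def
    by (blast intro: DERIV_isCont continuous_at_imp_continuous_on)+
  have c13: "continuous_on {0..L} (\<lambda>x. b1 x + b3 x)" by (intro continuous_intros cb)
  note L2 = in_L2_continuous
  define G1 where "G1 s = (LINT x:{0..L}|lborel. y s x * (b1 x + b3 x))" for s
  define G2 where "G2 s = (LINT x:{0..L}|lborel. (y s x)\<^sup>2 * b1 x)" for s
  define G where "G s = (LINT x:{0..L}|lborel. y s x * (b1 x + b3 x) + (y s x)\<^sup>2 / 2 * b1 x)" for s
  have G: "G s = G1 s + 1 / 2 * G2 s" if "0 \<le> s" for s
  proof -
    have "set_integrable lborel {0..L} (\<lambda>x. (y s x)\<^sup>2 * b1 x)"
      using set_integrable_mult_L2[OF y_L2[OF that] in_L2_mult_continuous[OF y_L2[OF that] cb(2)]]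
      by (simp add: power2_eq_square mult_ac)
    then have "set_integrable lborel {0..L} (\<lambda>x. 1 / 2 * ((y s x)\<^sup>2 * b1 x))" by simp
    moreover have "set_integrable lborel {0..L} (\<lambda>x. y s x * (b1 x + b3 x))"
      by (intro set_integrable_mult_L2 y_L2 that L2 c13)
    ultimately have "(LINT x:{0..L}|lborel. y s x * (b1 x + b3 x) + 1 / 2 * ((y s x)\<^sup>2 * b1 x)) = G1 s + 1 / 2 * G2 s"
      unfolding G1_def G2_def by (simp only: set_integral_add(2) set_integral_mult_right)
    then show ?thesis unfolding G_def by simp
  qed
  have i1: "set_integrable lborel {s..t'} G1" if "0 \<le> s" for s t'
    unfolding G1_def using that by (intro y_Fubini in_L2_integrable L2 c13)
  have i2: "set_integrable lborel {s..t'} G2" if "0 \<le> s" for s t'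
    unfolding G2_def using that by (intro y2_Fubini in_L2_integrable L2 cb)
  have iG: "set_integrable lborel {s..t'} G" if "0 \<le> s" for s t'
  proof -
    have "set_integrable lborel {s..t'} (\<lambda>s. G1 s + 1 / 2 * G2 s)"
      using i1[OF that] i2[OF that] by (intro set_integral_add(1)) auto
    then show ?thesis by (rule set_integrable_cong[THEN iffD1, rotated -1]) (use that in \<open>auto simp: G\<close>)
  qed
  have "ip L (y (t + h)) b - ip L (y t) b = (LINT s:{0..t+h}|lborel. G s) - (LINT s:{0..t}|lborel. G s)"
    using y_weak[OF b, of t] y_weak[OF b, of "t + h"] t h unfolding G_def by simp
  also have "\<dots> = (LINT s:{t..t+h}|lborel. G s)"
    using LINT_Icc_combine[OF t _ iG[OF order_refl], of "t + h"] h by simp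
  also have "\<dots> = (LINT s:{t..t+h}|lborel. G1 s + 1 / 2 * G2 s)"
    using t by (intro set_lebesgue_integral_cong) (auto simp: G)
  also have "\<dots> = (LINT s:{t..t+h}|lborel. G1 s) + 1 / 2 * (LINT s:{t..t+h}|lborel. G2 s)"
    using i1[OF t] i2[OF t] by (simp only: set_integral_add(2) set_integral_mult_right set_integrable_mult_right)
  finally have "ip L (y (t + h)) b - ip L (y t) b
      = (LINT s:{t..t+h}|lborel. G1 s) + 1 / 2 * (LINT s:{t..t+h}|lborel. G2 s)" .
  moreover have "ip L (dq h t) b = (1 / h) * (ip L (y (t + h)) b - ip L (y t) b)"
    unfolding dq_def[abs_def] ip_scale_left using t h by (subst ip_diff_left) (auto intro!: y_L2 L2[OF cb(1)])
  moreover have "ip L (av h t) (\<lambda>x. b1 x + b3 x) = (1 / h) * (LINT s:{t..t+h}|lborel. G1 s)"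
    unfolding ip_av[OF t L2[OF c13]] by (simp only: ip_def G1_def)
  moreover have "ip L (qv h t) b1 = (1 / h) * (1 / 2 * (LINT s:{t..t+h}|lborel. G2 s))"
    unfolding ip_qv[OF t L2[OF cb(2)]] by (simp add: G2_def)
  ultimately show ?thesis by (simp only: distrib_left)
qed

end

section \<open>Moving averages of scalar functions of time\<close>

lemma LINT_average_le:
  fixes p :: "real \<Rightarrow> real"
  assumes "0 < h" "continuous_on {t..t+h} p" "\<And>s. s \<in> {t..t+h} \<Longrightarrow> p s \<le> C"
  shows "(1 / h) * (LINT s:{t..t+h}|lborel. p s) \<le> C"
proof -
  have "(LINT s:{t..t+h}|lborel. p s) \<le> (LINT s:{t..t+h}|lborel. C)"
    using assms by (intro set_integral_mono borel_integrable_atLeastAtMost' continuous_intros) auto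
  also have "\<dots> = h * C" using assms(1) by (simp add: set_lebesgue_integral_def)
  finally show ?thesis using assms(1) by (simp add: field_simps)
qed

lemma LINT_average_derivative:
  fixes p :: "real \<Rightarrow> real"
  assumes p: "continuous_on {0..} p" and t: "0 < t" and h: "0 \<le> h"
  shows "((\<lambda>t. LINT s:{t..t+h}|lborel. p s) has_real_derivative p (t + h) - p t) (at t)"
proof -
  define P where "P x = integral {0..x} p" for x
  have dP: "(P has_real_derivative p x) (at x)" if "0 < x" for x
  proof -
    have "continuous_on {0..x + 1} p" using p by (rule continuous_on_subset) auto
    from integral_has_real_derivative[OF this, of x] that
    have "(P has_real_derivative p x) (at x within {0..x + 1})" by (simp add: P_def[abs_def])
    moreover have "at x within {0..x + 1} = at x" using that by (intro at_within_Icc_at) auto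
    ultimately show ?thesis by simp
  qed
  have eq: "(LINT s:{t..t+h}|lborel. p s) = P (t + h) - P t" if "0 < t" for t
  proof -
    have c: "continuous_on {t..t+h} p" "continuous_on {0..t+h} p"
      using that by (auto intro: continuous_on_subset[OF p])
    show ?thesis
      unfolding P_def
      using Henstock_Kurzweil_Integration.integral_combine[of 0 t "t+h" p] that h integrable_continuous_real[OF c(2)]
        set_borel_integral_eq_integral(2)[OF borel_integrable_atLeastAtMost'[OF c(1)]] by simp
  qed
  have "((\<lambda>t. P (t + h) - P t) has_real_derivative p (t + h) - p t) (at t)"
  proof (rule DERIV_diff)
    show "((\<lambda>t. P (t + h)) has_real_derivative p (t + h)) (at t)"
      using dP[of "t + h"] t h by (simp add: DERIV_shift)
  qed (rule dP[OF t])
  then show ?thesis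
    by (rule has_field_derivative_transform_within_open[where S = "{0<..}"]) (use t in \<open>auto simp: eq\<close>)
qed

text \<open>Disposes of the second-order remainder when a quadratic form is differentiated along the
  averages.\<close>

lemma has_derivative_0_quadratic_bound:
  fixes E :: "real \<Rightarrow> real"
  assumes d: "0 < d" and E: "\<And>s. \<bar>s - t\<bar> < d \<Longrightarrow> \<bar>E s\<bar> \<le> C * (s - t)\<^sup>2"
  shows "(E has_real_derivative 0) (at t)"
  unfolding DERIV_def
proof (rule Lim_null_comparison)
  have E0: "E t = 0" using E[of t] d by simp
  show "\<forall>\<^sub>F k in at 0. norm ((E (t + k) - E t) / k) \<le> C * \<bar>k\<bar>"
    unfolding eventually_at
  proof (intro exI[of _ d] conjI d ballI impI)
    fix k :: real assume k: "k \<noteq> 0 \<and> dist k 0 < d"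
    then have "\<bar>E (t + k)\<bar> \<le> C * k\<^sup>2" using E[of "t + k"] by simp
    then have "\<bar>E (t + k)\<bar> \<le> (C * \<bar>k\<bar>) * \<bar>k\<bar>" by (simp add: power2_eq_square mult.assoc)
    then show "norm ((E (t + k) - E t) / k) \<le> C * \<bar>k\<bar>"
      using k by (simp add: E0 divide_le_eq)
  qed
  show "((\<lambda>k. C * \<bar>k\<bar>) \<longlongrightarrow> 0) (at 0)"
    by (auto intro!: tendsto_eq_intros)
qed

section \<open>Continuity in time, the averaging error, and time derivatives of the averages\<close>

context kdv_trajectory
begin

lemma tendsto_at_time:
  assumes t0: "0 \<le> t0" and b: "\<And>s. 0 \<le> s \<Longrightarrow> \<bar>F s - F t0\<bar> \<le> C * L2norm L (\<lambda>x. y s x - y t0 x)"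
  shows "(F \<longlongrightarrow> F t0) (at t0 within {0..})"
proof (rule LIM_zero_cancel, rule Lim_null_comparison)
  show "\<forall>\<^sub>F s in at t0 within {0..}. norm (F s - F t0) \<le> C * L2norm L (\<lambda>x. y s x - y t0 x)"
    using b by (simp add: eventually_at_filter)
  show "((\<lambda>s. C * L2norm L (\<lambda>x. y s x - y t0 x)) \<longlongrightarrow> 0) (at t0 within {0..})"
    using tendsto_mult_left[OF y_cont[OF t0], of C] by simp
qed

lemma ip_y_continuous:
  assumes "in_L2 L f"
  shows "continuous_on {0..} (\<lambda>s. ip L (y s) f)"
  unfolding continuous_on_def
proof
  fix t0 :: real assume t0: "t0 \<in> {0..}"
  show "((\<lambda>s. ip L (y s) f) \<longlongrightarrow> ip L (y t0) f) (at t0 within {0..})"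
  proof (rule tendsto_at_time[where F = "\<lambda>s. ip L (y s) f" and C = "L2norm L f"])
    fix s :: real assume s: "0 \<le> s"
    have "ip L (y s) f - ip L (y t0) f = ip L (\<lambda>x. y s x - y t0 x) f"
      using s t0 assms by (simp add: ip_diff_left y_L2)
    then show "\<bar>ip L (y s) f - ip L (y t0) f\<bar> \<le> L2norm L f * L2norm L (\<lambda>x. y s x - y t0 x)"
      using ip_bound[OF in_L2_diff[OF y_L2[OF s] y_L2] assms, of t0] t0 by (simp add: mult.commute)
  qed (use t0 in simp)
qed

lemma L2norm_y_continuous: "continuous_on {0..} (\<lambda>s. L2norm L (y s))"
  unfolding continuous_on_def
proof
  fix t0 :: real assume t0: "t0 \<in> {0..}"
  show "((\<lambda>s. L2norm L (y s)) \<longlongrightarrow> L2norm L (y t0)) (at t0 within {0..})"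
    by (rule tendsto_at_time[where F = "\<lambda>s. L2norm L (y s)" and C = 1])
      (use t0 L2norm_diff_bound y_L2 in auto)
qed

text \<open>Heine-Cantor for values in a seminormed space of functions: each time has a ball on
  which y varies by less than e / 2, and the Lebesgue number of this cover of {0..T} is the required
  d.\<close>

lemma y_uniformly_continuous:
  assumes e: "0 < e"
  obtains d where "0 < d" "\<And>s t. s \<in> {0..T} \<Longrightarrow> t \<in> {0..T} \<Longrightarrow> \<bar>s - t\<bar> < d \<Longrightarrow> L2norm L (\<lambda>x. y s x - y t x) \<le> e"
proof -
  have "\<exists>d>0. \<forall>s\<ge>0. dist s t < d \<longrightarrow> L2norm L (\<lambda>x. y s x - y t x) < e / 2" if "0 \<le> t" for t
  proof -
    have "\<forall>\<^sub>F s in at t within {0..}. L2norm L (\<lambda>x. y s x - y t x) < e / 2"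
      using order_tendstoD(2)[OF y_cont[OF that], of "e / 2"] e by simp
    then obtain d where "d > 0" "\<forall>s\<in>{0..}. s \<noteq> t \<and> dist s t < d \<longrightarrow> L2norm L (\<lambda>x. y s x - y t x) < e / 2"
      unfolding eventually_at by blast
    moreover have "L2norm L (\<lambda>x. y t x - y t x) < e / 2" using e by (simp add: L2norm_def)
    ultimately have "0 < d" "L2norm L (\<lambda>x. y s x - y t x) < e / 2" if "0 \<le> s" "dist s t < d" for s
      using that by (cases "s = t"; auto)+
    then show ?thesis using \<open>d > 0\<close> by blast
  qed
  then obtain d where d: "\<And>t. 0 \<le> t \<Longrightarrow> 0 < d t"
    "\<And>t s. 0 \<le> t \<Longrightarrow> 0 \<le> s \<Longrightarrow> dist s t < d t \<Longrightarrow> L2norm L (\<lambda>x. y s x - y t x) < e / 2"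
    by metis
  have cover: "{0..T} \<subseteq> \<Union> ((\<lambda>t. ball t (d t)) ` {0..T})" using d(1) by auto
  have op: "open b" if "b \<in> (\<lambda>t. ball t (d t)) ` {0..T}" for b using that by auto
  have "\<exists>\<delta>>0. \<forall>x\<in>{0..T}. \<exists>b\<in>(\<lambda>t. ball t (d t)) ` {0..T}. ball x \<delta> \<subseteq> b"
  proof (rule Heine_Borel_lemma[OF compact_Icc cover])
    fix \<epsilon> :: real
    assume "0 < \<epsilon>" "\<And>x. x \<in> {0..T} \<Longrightarrow> \<exists>b\<in>(\<lambda>t. ball t (d t)) ` {0..T}. ball x \<epsilon> \<subseteq> b"
    then show ?thesis by blast
  qed (rule op)
  then obtain \<delta> where \<delta>: "0 < \<delta>" "\<And>x. x \<in> {0..T} \<Longrightarrow> \<exists>b\<in>(\<lambda>t. ball t (d t)) ` {0..T}. ball x \<delta> \<subseteq> b"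
    by blast
  show ?thesis
  proof (rule that[OF \<delta>(1)])
    fix s t assume s: "s \<in> {0..T}" and t: "t \<in> {0..T}" and st: "\<bar>s - t\<bar> < \<delta>"
    obtain r where r: "r \<in> {0..T}" "ball s \<delta> \<subseteq> ball r (d r)" using \<delta>(2)[OF s] by auto
    have "s \<in> ball s \<delta>" "t \<in> ball s \<delta>" using st \<delta>(1) by (auto simp: dist_real_def)
    then have "s \<in> ball r (d r)" "t \<in> ball r (d r)" using r(2) by blast+
    then have "L2norm L (\<lambda>x. y s x - y r x) < e / 2" "L2norm L (\<lambda>x. y t x - y r x) < e / 2"
      using d(2)[of r s] d(2)[of r t] r(1) s t by (auto simp: dist_commute)
    moreover have "L2norm L (\<lambda>x. y s x - y t x) \<le> L2norm L (\<lambda>x. y s x - y r x) + L2norm L (\<lambda>x. y r x - y t x)"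
      using s t r by (intro L2norm_triangle y_L2) auto
    ultimately show "L2norm L (\<lambda>x. y s x - y t x) \<le> e" using L2norm_minus_commute[of L "y t" "y r"] by linarith
  qed
qed

lemma av_L2: "0 \<le> t \<Longrightarrow> in_L2 L (av h t)"
  by (intro in_L2_continuous av_continuous)

lemma ip_av_le:
  assumes "0 \<le> t" "0 < h" "in_L2 L f" "\<And>s. s \<in> {t..t+h} \<Longrightarrow> ip L (y s) f \<le> C"
  shows "ip L (av h t) f \<le> C"
  unfolding ip_av[OF assms(1,3)] using assms(1)
  by (intro LINT_average_le assms continuous_on_subset[OF ip_y_continuous[OF assms(3)]]) auto

text \<open>Minkowski's integral inequality by duality: the difference is tested against itself, so
  that only scalar averages in time occur.\<close>

lemma av_close:
  assumes t: "0 \<le> t" and h: "0 < h"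
    and om: "\<And>s. s \<in> {t..t+h} \<Longrightarrow> L2norm L (\<lambda>x. y s x - y t x) \<le> \<omega>"
  shows "L2norm L (\<lambda>x. av h t x - y t x) \<le> \<omega>"
proof -
  define z where "z = (\<lambda>x. av h t x - y t x)"
  have z: "in_L2 L z" unfolding z_def by (intro in_L2_diff av_L2 y_L2 t)
  have "ip L (av h t) z \<le> ip L (y t) z + \<omega> * L2norm L z"
  proof (rule ip_av_le[OF t h z])
    fix s assume s: "s \<in> {t..t+h}"
    have "ip L (y s) z - ip L (y t) z = ip L (\<lambda>x. y s x - y t x) z"
      using s t by (simp add: ip_diff_left y_L2 z)
    also have "\<dots> \<le> L2norm L (\<lambda>x. y s x - y t x) * L2norm L z"
      using s t by (intro order_trans[OF abs_ge_self ip_bound] in_L2_diff y_L2 z) auto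
    also have "\<dots> \<le> \<omega> * L2norm L z" by (intro mult_right_mono om s L2norm_nonneg)
    finally show "ip L (y s) z \<le> ip L (y t) z + \<omega> * L2norm L z" by simp
  qed
  moreover have "ip L z z = ip L (av h t) z - ip L (y t) z"
    unfolding z_def using z[unfolded z_def] t by (simp add: ip_diff_left[OF av_L2 y_L2])
  ultimately have "L2norm L z * L2norm L z \<le> \<omega> * L2norm L z"
    unfolding L2norm_power2[symmetric] by (simp add: power2_eq_square)
  moreover have "0 \<le> \<omega>" using om[of t] h L2norm_nonneg[of L "\<lambda>x. y t x - y t x"] by auto
  ultimately show ?thesis unfolding z_def[symmetric]
    using L2norm_nonneg[of L z] by (cases "L2norm L z = 0") auto
qed

text \<open>Expanding the square of y - \<open>av\<close> under the time integral shows that the gap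
  is half a variance, hence nonnegative.\<close>

lemma av_square_le:
  assumes t: "0 \<le> t" and h: "0 < h" and x: "x \<in> {0..L}"
  shows "(av h t x)\<^sup>2 / 2 \<le> qv h t x"
proof -
  let ?c = "av h t x"
  have i1: "set_integrable lborel {t..t+h} (\<lambda>s. y s x)"
    by (rule dominated_slice[OF t y_meas y_dom m1_int[OF t] x])
  have i2: "set_integrable lborel {t..t+h} (\<lambda>s. (y s x)\<^sup>2)"
    by (rule dominated_slice[OF t y2_meas y2_dom m_int'[OF t] x])
  have i3: "set_integrable lborel {t..t+h} (\<lambda>s. ?c\<^sup>2)" by (intro borel_integrable_atLeastAtMost' continuous_intros)
  have "0 \<le> (LINT s:{t..t+h}|lborel. (y s x - ?c)\<^sup>2)"
    unfolding set_lebesgue_integral_def by (rule integral_nonneg_AE) (auto simp: indicator_def)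
  also have "\<dots> = (LINT s:{t..t+h}|lborel. (y s x)\<^sup>2 - (2 * ?c) * y s x + ?c\<^sup>2)"
    by (simp add: power2_diff algebra_simps)
  also have "\<dots> = (LINT s:{t..t+h}|lborel. (y s x)\<^sup>2) - (2 * ?c) * (LINT s:{t..t+h}|lborel. y s x) + (LINT s:{t..t+h}|lborel. ?c\<^sup>2)"
    using i1 i2 i3 by (simp only: set_integral_add set_integral_diff set_integrable_mult_right set_integral_mult_right)
  also have "(LINT s:{t..t+h}|lborel. ?c\<^sup>2) = h * ?c\<^sup>2" using h by (simp add: set_lebesgue_integral_def)
  also have "(LINT s:{t..t+h}|lborel. y s x) = h * ?c" using h by (simp add: av_def)
  also have "(LINT s:{t..t+h}|lborel. (y s x)\<^sup>2) = 2 * h * qv h t x" using h by (simp add: qv_def)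
  finally have "0 \<le> h * (2 * qv h t x - ?c\<^sup>2)" by (simp add: algebra_simps power2_eq_square)
  then show ?thesis using h by (simp add: zero_le_mult_iff)
qed

lemma qv_le:
  assumes t: "0 \<le> t" and h: "0 < h" and x: "x \<in> {0..L}"
  shows "qv h t x \<le> (1 / (2 * h)) * (LINT s:{t..t+h}|lborel. m s)"
proof -
  have "(LINT s:{t..t+h}|lborel. (y s x)\<^sup>2) \<le> (LINT s:{t..t+h}|lborel. m s)"
  proof (rule set_integral_mono_AE)
    show "set_integrable lborel {t..t+h} (\<lambda>s. (y s x)\<^sup>2)"
      by (rule dominated_slice[OF t y2_meas y2_dom m_int'[OF t] x])
    show "AE s\<in>{t..t+h} in lborel. (y s x)\<^sup>2 \<le> m s"
      using y2_dom by eventually_elim (use t x in auto)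
  qed (rule m_int'[OF t])
  then show ?thesis unfolding qv_def using h by (intro mult_left_mono) auto
qed

text \<open>With u the average, \<integral> r is half the time mean of |y s - u|^2, and |y s - u|
  \<le> 2 \<omega> by passing through y t. The second bound is sup r times \<integral> r. Its factor
  (1 / h) \<integral> m has no pointwise bound as h tends to 0; only its integral over time is
  controlled, and \<open>av_decay\<close> uses no more.\<close>

lemma variance_bounds:
  assumes t: "0 \<le> t" and h: "0 < h"
    and om: "\<And>s. s \<in> {t..t+h} \<Longrightarrow> L2norm L (\<lambda>x. y s x - y t x) \<le> \<omega>"
  defines "r \<equiv> \<lambda>x. qv h t x - (av h t x)\<^sup>2 / 2"
  shows "ip L r (\<lambda>_. 1) \<le> 2 * \<omega>\<^sup>2"
    and "ip L r r \<le> \<omega>\<^sup>2 * ((1 / h) * (LINT s:{t..t+h}|lborel. m s))"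
proof -
  let ?u = "av h t"
  note L2 = in_L2_continuous
  have c1: "in_L2 L (\<lambda>_. 1)" by (intro L2 continuous_intros)
  have cu: "continuous_on {0..L} (\<lambda>x. (av h t x)\<^sup>2 / 2)" using t by (intro continuous_intros av_continuous) auto
  have cr: "continuous_on {0..L} r" unfolding r_def by (intro continuous_intros qv_continuous cu t)
  have "ip L (qv h t) (\<lambda>_. 1) = 1 / 2 * ((1 / h) * (LINT s:{t..t+h}|lborel. ip L (y s) (y s)))"
    unfolding ip_qv[OF t c1] by (simp add: ip_def power2_eq_square)
  moreover have "(1 / h) * (LINT s:{t..t+h}|lborel. ip L (y s) (y s)) \<le> 4 * \<omega>\<^sup>2 + ip L ?u ?u"
  proof -
    have cn: "continuous_on {t..t+h} (\<lambda>s. ip L (y s) (y s))"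
      using continuous_on_power[OF continuous_on_subset[OF L2norm_y_continuous], of "{t..t+h}" 2] t
      by (simp add: L2norm_power2)
    have cp: "continuous_on {t..t+h} (\<lambda>s. ip L (y s) ?u)"
      using ip_y_continuous[OF av_L2[OF t]] by (rule continuous_on_subset) (use t in auto)
    have "(1 / h) * (LINT s:{t..t+h}|lborel. ip L (y s) (y s) - 2 * ip L (y s) ?u) \<le> 4 * \<omega>\<^sup>2 - ip L ?u ?u"
    proof (rule LINT_average_le[OF h])
      show "continuous_on {t..t+h} (\<lambda>s. ip L (y s) (y s) - 2 * ip L (y s) ?u)" by (intro continuous_intros cn cp)
      fix s assume s: "s \<in> {t..t+h}"
      have sL: "in_L2 L (y s)" using s t by (intro y_L2) auto
      have "L2norm L (\<lambda>x. y s x - ?u x) \<le> L2norm L (\<lambda>x. y s x - y t x) + L2norm L (\<lambda>x. y t x - ?u x)"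
        by (intro L2norm_triangle sL y_L2 av_L2 t)
      also have "\<dots> \<le> \<omega> + \<omega>"
        using om[OF s] av_close[OF t h om] by (simp add: L2norm_minus_commute[of L "y t"])
      finally have "(L2norm L (\<lambda>x. y s x - 1 * ?u x))\<^sup>2 \<le> (2 * \<omega>)\<^sup>2"
        by (intro power_mono L2norm_nonneg) simp
      then show "ip L (y s) (y s) - 2 * ip L (y s) ?u \<le> 4 * \<omega>\<^sup>2 - ip L ?u ?u"
        unfolding L2norm_power2 ip_diff_scale_self[OF sL av_L2[OF t]] by (simp add: power_mult_distrib)
    qed
    moreover have "(LINT s:{t..t+h}|lborel. ip L (y s) (y s) - 2 * ip L (y s) ?u)
        = (LINT s:{t..t+h}|lborel. ip L (y s) (y s)) - 2 * (LINT s:{t..t+h}|lborel. ip L (y s) ?u)"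
      using borel_integrable_atLeastAtMost'[OF cn] borel_integrable_atLeastAtMost'[OF cp]
      by (simp only: set_integral_diff set_integrable_mult_right set_integral_mult_right)
    moreover have "ip L ?u ?u = (1 / h) * (LINT s:{t..t+h}|lborel. ip L (y s) ?u)"
      by (rule ip_av[OF t av_L2[OF t]])
    ultimately show ?thesis by (simp only: right_diff_distrib mult.left_commute[of _ 2])
  qed
  ultimately have "ip L (qv h t) (\<lambda>_. 1) \<le> 2 * \<omega>\<^sup>2 + ip L ?u ?u / 2" by linarith
  moreover have "ip L r (\<lambda>_. 1) = ip L (qv h t) (\<lambda>_. 1) - ip L (\<lambda>x. (?u x)\<^sup>2 / 2) (\<lambda>_. 1)"
    unfolding r_def by (intro ip_diff_left L2 qv_continuous cu t c1)
  moreover have "ip L (\<lambda>x. (?u x)\<^sup>2 / 2) (\<lambda>_. 1) = ip L ?u ?u / 2"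
    by (simp add: ip_def power2_eq_square)
  ultimately show 1: "ip L r (\<lambda>_. 1) \<le> 2 * \<omega>\<^sup>2" by linarith
  define B where "B = (1 / (2 * h)) * (LINT s:{t..t+h}|lborel. m s)"
  have r0: "0 \<le> r x" if "x \<in> {0..L}" for x using av_square_le[OF t h that] by (simp add: r_def)
  have rB: "r x \<le> B" if "x \<in> {0..L}" for x
    using qv_le[OF t h that] zero_le_power2[of "av h t x"] unfolding r_def B_def by linarith
  have B0: "0 \<le> B" using r0[of 0] rB[of 0] L by auto
  have "ip L r r \<le> (LINT x:{0..L}|lborel. B * (r x * 1))"
    unfolding ip_def
    by (intro set_integral_mono borel_integrable_atLeastAtMost' continuous_intros cr)
      (auto intro!: mult_right_mono r0 rB)
  also have "\<dots> = B * ip L r (\<lambda>_. 1)" by (simp only: set_integral_mult_right ip_def)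
  also have "\<dots> \<le> B * (2 * \<omega>\<^sup>2)" by (intro mult_left_mono 1 B0)
  finally show "ip L r r \<le> \<omega>\<^sup>2 * ((1 / h) * (LINT s:{t..t+h}|lborel. m s))" by (simp add: B_def mult_ac)
qed

lemma ip_av_derivative:
  assumes f: "in_L2 L f" and t: "0 < t" and h: "0 < h"
  shows "((\<lambda>t. ip L (av h t) f) has_real_derivative ip L (dq h t) f) (at t)"
proof -
  have "((\<lambda>t. (1 / h) * (LINT s:{t..t+h}|lborel. ip L (y s) f)) has_real_derivative
      (1 / h) * (ip L (y (t + h)) f - ip L (y t) f)) (at t)"
    using h t by (intro DERIV_cmult LINT_average_derivative ip_y_continuous f) auto
  then have "((\<lambda>t. ip L (av h t) f) has_real_derivative (1 / h) * (ip L (y (t + h)) f - ip L (y t) f)) (at t)"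
    by (rule has_field_derivative_transform_within_open[where S = "{0<..}"]) (use t f in \<open>auto simp: ip_av\<close>)
  moreover have "ip L (dq h t) f = (1 / h) * (ip L (y (t + h)) f - ip L (y t) f)"
    unfolding dq_def[abs_def] ip_scale_left using t h by (subst ip_diff_left) (auto intro!: y_L2 f)
  ultimately show ?thesis by simp
qed

text \<open>Duality again: the scalar function obtained by pairing with the difference z has
  derivative at most (2 B / h) |z|, so the mean value inequality applies.\<close>

lemma av_lipschitz:
  assumes s: "0 < s" "s \<le> T" and t: "0 < t" "t \<le> T" and h: "0 < h"
    and B: "\<And>\<tau>. \<tau> \<in> {0..T+h} \<Longrightarrow> L2norm L (y \<tau>) \<le> B"
  shows "L2norm L (\<lambda>x. av h s x - av h t x) \<le> 2 * B / h * \<bar>s - t\<bar>"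
proof -
  define z where "z = (\<lambda>x. av h s x - av h t x)"
  have z: "in_L2 L z" unfolding z_def using s t by (intro in_L2_diff av_L2) auto
  have bd: "\<bar>ip L (dq h \<tau>) z\<bar> \<le> 2 * B / h * L2norm L z" if "\<tau> \<in> {0..T}" for \<tau>
  proof -
    have p: "\<bar>ip L (y r) z\<bar> \<le> B * L2norm L z" if "r \<in> {0..T+h}" for r
      using order_trans[OF ip_bound[OF y_L2 z] mult_right_mono[OF B[OF that] L2norm_nonneg]] that by auto
    have "ip L (dq h \<tau>) z = (1 / h) * (ip L (y (\<tau> + h)) z - ip L (y \<tau>) z)"
      unfolding dq_def[abs_def] ip_scale_left using that h by (subst ip_diff_left) (auto intro!: y_L2 z)
    moreover have "\<bar>ip L (y (\<tau> + h)) z - ip L (y \<tau>) z\<bar> \<le> 2 * (B * L2norm L z)"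
      using p[of \<tau>] p[of "\<tau> + h"] that h by auto
    ultimately show ?thesis using h by (simp add: abs_mult divide_right_mono)
  qed
  have range: "0 < \<tau>" "\<tau> \<in> {0..T}" if "\<tau> \<in> {min s t..max s t}" for \<tau>
    using that s t by (simp_all add: min_le_iff_disj le_max_iff_disj) linarith+
  have df: "((\<lambda>\<tau>. ip L (av h \<tau>) z) has_field_derivative ip L (dq h \<tau>) z) (at \<tau> within {min s t..max s t})"
    if "\<tau> \<in> {min s t..max s t}" for \<tau>
    by (rule has_field_derivative_at_within[OF ip_av_derivative[OF z range(1)[OF that] h]])
  have dn: "norm (ip L (dq h \<tau>) z) \<le> 2 * B / h * L2norm L z" if "\<tau> \<in> {min s t..max s t}" for \<tau>
    using bd[OF range(2)[OF that]] by simp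
  have "norm (ip L (av h s) z - ip L (av h t) z) \<le> (2 * B / h * L2norm L z) * norm (s - t)"
    by (rule field_differentiable_bound[OF convex_real_interval(5) df dn, of s t]) auto
  then have "ip L (av h s) z - ip L (av h t) z \<le> (2 * B / h * \<bar>s - t\<bar>) * L2norm L z"
    by (simp add: mult_ac)
  moreover have "ip L z z = ip L (av h s) z - ip L (av h t) z"
    unfolding z_def using z[unfolded z_def] s t by (simp add: ip_diff_left[OF av_L2 av_L2])
  ultimately have sq: "L2norm L z * L2norm L z \<le> (2 * B / h * \<bar>s - t\<bar>) * L2norm L z"
    unfolding power2_eq_square[symmetric] L2norm_power2 by linarith
  have nn: "0 \<le> 2 * B / h * \<bar>s - t\<bar>"
    using B[of 0] L2norm_nonneg[of L "y 0"] s h by (intro mult_nonneg_nonneg divide_nonneg_nonneg) auto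
  have "L2norm L z \<le> 2 * B / h * \<bar>s - t\<bar>"
  proof (cases "L2norm L z = 0")
    case False
    then have "0 < L2norm L z" using L2norm_nonneg[of L z] by simp
    with sq show ?thesis by (rule mult_right_le_imp_le)
  qed (use nn in simp)
  then show ?thesis by (simp only: z_def)
qed

text \<open>Freezing one argument at time t leaves a linear functional, already differentiated. The
  remainder \<open>E\<close> is the form evaluated at the increment, which is quadratically small by
  \<open>av_lipschitz\<close>.\<close>

lemma ip_av_square_derivative:
  assumes g: "continuous_on {0..L} g" and G: "\<And>x. x \<in> {0..L} \<Longrightarrow> \<bar>g x\<bar> \<le> G" "0 \<le> G"
    and t: "0 < t" and h: "0 < h"
  shows "((\<lambda>t. ip L (av h t) (\<lambda>x. g x * av h t x)) has_real_derivative 2 * ip L (dq h t) (\<lambda>x. g x * av h t x)) (at t)"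
proof -
  define f where "f = (\<lambda>x. g x * av h t x)"
  have f: "in_L2 L f" unfolding f_def using t by (intro in_L2_mult_continuous av_L2 g) auto
  have gL2: "in_L2 L (\<lambda>x. g x * w x)" if "in_L2 L w" for w by (rule in_L2_mult_continuous[OF that g])
  define T where "T = t + 1"
  have "compact ((\<lambda>s. L2norm L (y s)) ` {0..T+h})"
    by (intro compact_continuous_image continuous_on_subset[OF L2norm_y_continuous]) auto
  then obtain B where "\<forall>s\<in>{0..T+h}. \<bar>L2norm L (y s)\<bar> \<le> B"
    using compact_imp_bounded by (fastforce simp: bounded_iff)
  then have B: "L2norm L (y s) \<le> B" if "s \<in> {0..T+h}" for s using that by fastforce
  define E where "E s = ip L (\<lambda>x. av h s x - av h t x) (\<lambda>x. g x * (av h s x - av h t x))" for s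
  have split: "ip L (av h s) (\<lambda>x. g x * av h s x) = 2 * ip L (av h s) f - ip L (av h t) f + E s" if "0 < s" for s
  proof -
    have a: "in_L2 L (av h s)" "in_L2 L (av h t)" using that t by (auto intro!: av_L2)
    have "E s = ip L (\<lambda>x. av h s x - av h t x) (\<lambda>x. g x * av h s x - f x)"
      unfolding E_def f_def by (rule ip_cong) (simp add: algebra_simps)
    also have "\<dots> = ip L (av h s) (\<lambda>x. g x * av h s x) - ip L (av h t) (\<lambda>x. g x * av h s x)
        - (ip L (av h s) f - ip L (av h t) f)"
      using a f gL2[OF a(1)] in_L2_diff[OF gL2[OF a(1)] f] in_L2_diff[OF a]
      by (simp add: ip_diff_left ip_diff_right)
    also have "ip L (av h t) (\<lambda>x. g x * av h s x) = ip L (av h s) f"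
      by (simp add: f_def ip_def mult_ac)
    finally show ?thesis by simp
  qed
  have "(E has_real_derivative 0) (at t)"
  proof (rule has_derivative_0_quadratic_bound[where d = "min 1 t" and C = "G * (2 * B / h)\<^sup>2"])
    fix s assume s: "\<bar>s - t\<bar> < min 1 t"
    then have s': "0 < s" "s \<le> T" by (auto simp: T_def)
    have a: "in_L2 L (\<lambda>x. av h s x - av h t x)" using s' t by (intro in_L2_diff av_L2) auto
    have "\<bar>E s\<bar> \<le> G * L2norm L (\<lambda>x. av h s x - av h t x) * L2norm L (\<lambda>x. av h s x - av h t x)"
    proof -
      have "L2norm L (\<lambda>x. g x * (av h s x - av h t x)) \<le> G * L2norm L (\<lambda>x. av h s x - av h t x)"
        by (rule L2norm_mult_bound[OF a g G])
      then have "L2norm L (\<lambda>x. av h s x - av h t x) * L2norm L (\<lambda>x. g x * (av h s x - av h t x))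
          \<le> L2norm L (\<lambda>x. av h s x - av h t x) * (G * L2norm L (\<lambda>x. av h s x - av h t x))"
        by (intro mult_left_mono L2norm_nonneg)
      then show ?thesis
        using ip_bound[OF a gL2[OF a]] unfolding E_def by (simp add: mult_ac)
    qed
    also have "\<dots> = G * (L2norm L (\<lambda>x. av h s x - av h t x))\<^sup>2" by (simp add: power2_eq_square)
    also have "\<dots> \<le> G * (2 * B / h * \<bar>s - t\<bar>)\<^sup>2"
      using s' t by (intro mult_left_mono power_mono av_lipschitz[where T = T] L2norm_nonneg G h B) (auto simp: T_def)
    also have "\<dots> = G * (2 * B / h)\<^sup>2 * (s - t)\<^sup>2"
      by (simp only: power_mult_distrib[of _ "\<bar>s - t\<bar>"] power2_abs mult.assoc)
    finally show "\<bar>E s\<bar> \<le> G * (2 * B / h)\<^sup>2 * (s - t)\<^sup>2" .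
  qed (use t in simp)
  then have "((\<lambda>s. 2 * ip L (av h s) f - ip L (av h t) f + E s) has_real_derivative 2 * ip L (dq h t) f) (at t)"
    using DERIV_add[OF DERIV_diff[OF DERIV_cmult[OF ip_av_derivative[OF f t h], of 2] DERIV_const]] by fastforce
  then show ?thesis
    unfolding f_def[symmetric]
    by (rule has_field_derivative_transform_within_open[where S = "{0<..}"]) (use t in \<open>auto simp: split\<close>)
qed

end

text \<open>Since y(s,0) = 0, Cauchy-Schwarz gives y(s,x)^2 \<le> L \<integral> y_x(s)^2, and the
  right-hand side is integrable in s on bounded intervals.\<close>

lemma kdv_solution_trajectory:
  assumes sol: "kdv_solution L y0 y" and L: "0 < L"
  obtains m where "kdv_trajectory L y0 y m"
proof -
  obtain yx where
    yxi: "\<And>T. 0 \<le> T \<Longrightarrow> set_integrable lborel ({0..T} \<times> {0..L}) (\<lambda>(t,x). (yx t x)^2)" and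
    tr: "AE t in lborel. t \<ge> 0 \<longrightarrow>
           (\<forall>x\<in>{0..L}. set_integrable lborel {0..x} (yx t) \<and>
                        y t x = (LINT s:{0..x}|lborel. yx t s)) \<and> y t L = 0"
    using sol unfolding kdv_solution_def by blast
  define m where "m s = L * (LINT x:{0..L}|lborel. (yx s x)\<^sup>2)" for s
  have pair: "integrable (lborel \<Otimes>\<^sub>M lborel) (\<lambda>(t, x). indicator {0..T} t * (indicator {0..L} x *\<^sub>R (yx t x)\<^sup>2))"
    if "0 \<le> T" for T
  proof -
    have eq: "(\<lambda>(t, x). indicator {0..T} t * (indicator {0..L} x *\<^sub>R (yx t x)\<^sup>2))
      = (\<lambda>z. indicator ({0..T} \<times> {0..L}) z *\<^sub>R (case z of (t, x) \<Rightarrow> (yx t x)\<^sup>2))"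
      by (auto simp: indicator_def)
    show ?thesis unfolding eq lborel_prod using yxi[OF that] by (simp add: set_integrable_def)
  qed
  have m_int: "set_integrable lborel {0..T} m" if "0 \<le> T" for T
  proof -
    have "integrable lborel (\<lambda>t. L * (LINT x|lborel. indicator {0..T} t * (indicator {0..L} x *\<^sub>R (yx t x)\<^sup>2)))"
      by (intro integrable_mult_right lborel_pair.integrable_fst[OF pair[OF that]])
    moreover have "(\<lambda>t. L * (LINT x|lborel. indicator {0..T} t * (indicator {0..L} x *\<^sub>R (yx t x)\<^sup>2)))
        = (\<lambda>t. indicator {0..T} t *\<^sub>R m t)"
      by (auto simp: m_def set_lebesgue_integral_def)
    ultimately show ?thesis by (simp only: set_integrable_def)
  qed
  \<comment> \<open>Running over natural horizons only keeps the union of the exceptional null sets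
    countable.\<close>
  have "AE t in lborel. \<forall>n::nat. integrable lborel (\<lambda>x. indicator {0..real n} t * (indicator {0..L} x *\<^sub>R (yx t x)\<^sup>2))"
    unfolding AE_all_countable using lborel_pair.AE_integrable_fst[OF pair] by auto
  then have sq: "AE t in lborel. 0 \<le> t \<longrightarrow> set_integrable lborel {0..L} (\<lambda>x. (yx t x)\<^sup>2)"
  proof eventually_elim
    case (elim t)
    obtain n :: nat where "t \<le> real n" using real_arch_simple by blast
    then show ?case using elim[rule_format, of n] by (auto simp: set_integrable_def)
  qed
  have bound: "AE s in lborel. 0 \<le> s \<longrightarrow> continuous_on {0..L} (y s) \<and> y s 0 = 0 \<and> y s L = 0
                   \<and> (\<forall>x\<in>{0..L}. (y s x)\<^sup>2 \<le> m s)"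
    using tr sq
  proof eventually_elim
    case (elim s)
    show ?case
    proof
      assume s: "0 \<le> s"
      have i: "set_integrable lborel {0..L} (yx s)" using elim s L by auto
      have rep: "y s x = (LINT r:{0..x}|lborel. yx s r)" if "x \<in> {0..L}" for x using elim s that by auto
      have ix: "set_integrable lborel {0..x} (yx s)" if "x \<in> {0..L}" for x using elim s that by auto
      have "continuous_on {0..L} (\<lambda>x. integral {0..x} (yx s))"
        by (rule indefinite_integral_continuous_1[OF set_borel_integral_eq_integral(1)[OF i]])
      then have c: "continuous_on {0..L} (y s)"
        by (rule continuous_on_eq) (simp add: rep set_borel_integral_eq_integral(2)[OF ix])
      have L2: "in_L2 L (yx s)"
        using i elim s unfolding in_L2_def set_integrable_def set_borel_measurable_def by auto
      have L2a: "in_L2 L (\<lambda>x. \<bar>yx s x\<bar>)"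
      proof -
        have "set_borel_measurable lborel {0..L} (\<lambda>x. \<bar>yx s x\<bar>)"
          using set_integrable_abs[OF i] unfolding set_integrable_def set_borel_measurable_def
          by (rule borel_measurable_integrable)
        then show ?thesis using L2 by (simp add: in_L2_def)
      qed
      have b: "(y s x)\<^sup>2 \<le> m s" if x: "x \<in> {0..L}" for x
      proof -
        have "\<bar>y s x\<bar> \<le> (LINT r:{0..x}|lborel. \<bar>yx s r\<bar>)"
          using set_integral_norm_bound[OF ix[OF x]] by (simp add: rep[OF x])
        also have "\<dots> \<le> (LINT r:{0..L}|lborel. \<bar>yx s r\<bar>)"
        proof -
          have "0 \<le> (LINT r:{x..L}|lborel. \<bar>yx s r\<bar>)"
            unfolding set_lebesgue_integral_def by (rule integral_nonneg_AE) (auto simp: indicator_def)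
          then show ?thesis using LINT_Icc_combine[OF _ _ set_integrable_abs[OF i], of x] x by auto
        qed
        also have "\<dots> = ip L (\<lambda>x. \<bar>yx s x\<bar>) (\<lambda>_. 1)" by (simp add: ip_def)
        also have "\<dots> \<le> L2norm L (\<lambda>x. \<bar>yx s x\<bar>) * L2norm L (\<lambda>_. 1)"
          by (intro order_trans[OF abs_ge_self ip_bound] L2a in_L2_continuous continuous_intros)
        finally have "\<bar>y s x\<bar>\<^sup>2 \<le> (L2norm L (\<lambda>x. \<bar>yx s x\<bar>) * L2norm L (\<lambda>_. 1))\<^sup>2"
          by (intro power_mono) auto
        also have "\<dots> = m s"
        proof -
          have "(L2norm L (\<lambda>x. \<bar>yx s x\<bar>))\<^sup>2 = (LINT x:{0..L}|lborel. (yx s x)\<^sup>2)"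
            unfolding L2norm_power2 ip_def by (simp add: power2_eq_square)
          moreover have "(L2norm L (\<lambda>_. 1))\<^sup>2 = L"
            unfolding L2norm_power2 ip_def using L by (simp add: set_lebesgue_integral_def)
          ultimately show ?thesis by (simp add: power_mult_distrib m_def)
        qed
        finally show ?thesis by simp
      qed
      have "y s 0 = 0"
      proof -
        have "y s 0 = integral {0..0} (yx s)"
          using L rep[of 0] set_borel_integral_eq_integral(2)[OF ix[of 0]] by simp
        then show ?thesis by simp
      qed
      then show "continuous_on {0..L} (y s) \<and> y s 0 = 0 \<and> y s L = 0 \<and> (\<forall>x\<in>{0..L}. (y s x)\<^sup>2 \<le> m s)"
        using c b elim s by auto
    qed
  qed
  have m0: "0 \<le> m s" for s
    unfolding m_def set_lebesgue_integral_def using L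
    by (intro mult_nonneg_nonneg integral_nonneg_AE) (auto simp: indicator_def)
  show ?thesis
  proof (rule that)
    show "kdv_trajectory L y0 y m"
    proof
      show "set_borel_measurable lborel ({0..} \<times> {0..L}) (\<lambda>(t, x). y t x)"
        "\<And>t. 0 \<le> t \<Longrightarrow> in_L2 L (y t)"
        "\<And>t0. 0 \<le> t0 \<Longrightarrow> ((\<lambda>t. L2norm L (\<lambda>x. y t x - y t0 x)) \<longlongrightarrow> 0) (at t0 within {0..})"
        using sol unfolding kdv_solution_def by blast+
      show "ip L (y t) b - ip L y0 b =
        (LINT s:{0..t}|lborel. LINT x:{0..L}|lborel. y s x * (b1 x + b3 x) + (y s x)\<^sup>2 / 2 * b1 x)"
        if "kdv_test L b b1 b2 b3" "0 \<le> t" for b b1 b2 b3 t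
        using sol that unfolding kdv_solution_def ip_def by blast
    qed (use L m0 m_int bound in auto)
  qed
qed

section \<open>A Poincare inequality on the orthogonal complement of the kernel\<close>

text \<open>Riccati trick: \<open>p = - k tan (k (x - a - \<pi>/2))\<close> solves \<open>p' + p\<^sup>2 = - k\<^sup>2\<close> and is regular on the whole
  interval as long as \<open>k < 1\<close>, so \<open>(v' - p v)\<^sup>2 = v'\<^sup>2 - k\<^sup>2 v\<^sup>2 - (p v\<^sup>2)'\<close>.\<close>

lemma wirtinger_Dirichlet:
  fixes v v1 :: "real \<Rightarrow> real"
  assumes dv: "\<And>x. x \<in> {a..a + pi} \<Longrightarrow> (v has_real_derivative v1 x) (at x within {a..a + pi})"
    and v1: "continuous_on {a..a + pi} v1" and va: "v a = 0" and vb: "v (a + pi) = 0"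
  shows "(LINT x:{a..a + pi}|lborel. (v x)\<^sup>2) \<le> (LINT x:{a..a + pi}|lborel. (v1 x)\<^sup>2)"
proof (rule field_le_mult_one_interval)
  fix z :: real assume z: "0 < z" "z < 1"
  \<comment> \<open>The inequality is proved with a factor z = k^2 < 1 on the left, and z is then
    sent to 1; for k = 1 the function \<open>p\<close> would blow up at both endpoints.\<close>
  define k where "k = sqrt z"
  have k: "0 < k" "k < 1" "k\<^sup>2 = z" using z by (auto simp: k_def)
  have v: "continuous_on {a..a + pi} v" using dv DERIV_continuous_on by blast
  define p where "p x = - k * tan (k * (x - a - pi / 2))" for x
  define p1 where "p1 x = - k\<^sup>2 - (p x)\<^sup>2" for x
  have cos: "cos (k * (x - a - pi / 2)) \<noteq> 0" if "x \<in> {a..a + pi}" for x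
  proof -
    have "\<bar>k * (x - a - pi / 2)\<bar> \<le> k * (pi / 2)"
      unfolding abs_mult using k that by (intro mult_mono) (auto simp: abs_le_iff field_simps)
    also have "\<dots> < 1 * (pi / 2)" using k by (intro mult_strict_right_mono) auto
    finally have "\<bar>k * (x - a - pi / 2)\<bar> < pi / 2" by simp
    then have "0 < cos (k * (x - a - pi / 2))" by (intro cos_gt_zero_pi) linarith+
    then show ?thesis by simp
  qed
  have dp: "(p has_real_derivative p1 x) (at x within {a..a + pi})" if "x \<in> {a..a + pi}" for x
  proof -
    have "(p has_real_derivative - k * (inverse ((cos (k * (x - a - pi / 2)))\<^sup>2) * k)) (at x within {a..a + pi})"
      unfolding p_def[abs_def] using cos[OF that]
      by (auto intro!: derivative_eq_intros)
    moreover have "- k * (inverse ((cos (k * (x - a - pi / 2)))\<^sup>2) * k) = p1 x"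
    proof -
      define t where "t = tan (k * (x - a - pi / 2))"
      have "inverse ((cos (k * (x - a - pi / 2)))\<^sup>2) = 1 + t\<^sup>2"
        using tan_sec[OF cos[OF that]] by (simp add: t_def power_inverse)
      moreover have "p x = - k * t" by (simp add: p_def t_def)
      ultimately show ?thesis unfolding p1_def by (simp add: power2_eq_square algebra_simps)
    qed
    ultimately show ?thesis by simp
  qed
  have p: "continuous_on {a..a + pi} p" using dp DERIV_continuous_on by blast
  have p1: "continuous_on {a..a + pi} p1" unfolding p1_def[abs_def] by (intro continuous_intros p)
  have "(LINT x:{a..a + pi}|lborel. p1 x * (v x)\<^sup>2 + p x * (2 * v x * v1 x)) = p (a + pi) * (v (a + pi))\<^sup>2 - p a * (v a)\<^sup>2"
    by (rule LINT_Icc_FTC[where F = "\<lambda>x. p x * (v x)\<^sup>2"])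
      (auto intro!: derivative_eq_intros continuous_intros dp dv p p1 v v1)
  then have F: "(LINT x:{a..a + pi}|lborel. p1 x * (v x)\<^sup>2 + p x * (2 * v x * v1 x)) = 0" by (simp add: va vb)
  have "0 \<le> (LINT x:{a..a + pi}|lborel. (v1 x - p x * v x)\<^sup>2)"
    unfolding set_lebesgue_integral_def by (rule integral_nonneg_AE) (auto simp: indicator_def)
  also have "\<dots> = (LINT x:{a..a + pi}|lborel. (v1 x)\<^sup>2 - z * (v x)\<^sup>2 - (p1 x * (v x)\<^sup>2 + p x * (2 * v x * v1 x)))"
    by (rule set_lebesgue_integral_cong) (auto simp: p1_def k(3)[symmetric] power2_eq_square algebra_simps)
  also have "\<dots> = (LINT x:{a..a + pi}|lborel. (v1 x)\<^sup>2) - (LINT x:{a..a + pi}|lborel. z * (v x)\<^sup>2)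
      - (LINT x:{a..a + pi}|lborel. p1 x * (v x)\<^sup>2 + p x * (2 * v x * v1 x))"
    by (subst set_integral_diff(2), (intro borel_integrable_atLeastAtMost' continuous_intros p p1 v v1)+)+ simp
  finally show "z * (LINT x:{a..a + pi}|lborel. (v x)\<^sup>2) \<le> (LINT x:{a..a + pi}|lborel. (v1 x)\<^sup>2)"
    using F by simp
qed

definition phi :: "real \<Rightarrow> real" where "phi x = 1 - cos x"

lemma continuous_on_phi [continuous_intros]: "continuous_on A phi"
  unfolding phi_def[abs_def] by (intro continuous_intros)

text \<open>Subtracting \<open>w \<pi> * h\<close>, where \<open>h + h'' = phi / 2\<close>, \<open>h 0 = h (2\<pi>) = 0\<close> and \<open>h \<pi> = 1\<close>, produces a function
  vanishing at \<open>0\<close>, \<open>\<pi>\<close> and \<open>2\<pi>\<close>; the cross terms disappear because \<open>w\<close> is orthogonal to \<open>phi\<close>.\<close>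

lemma poincare_orthogonal_phi:
  assumes dw: "\<And>x. x \<in> {0..2*pi} \<Longrightarrow> (w has_real_derivative w1 x) (at x within {0..2*pi})"
    and w1: "continuous_on {0..2*pi} w1" and w0: "w 0 = 0" and wL: "w (2*pi) = 0"
    and orth: "ip (2*pi) w phi = 0"
  shows "ip (2*pi) w w \<le> ip (2*pi) w1 w1"
proof -
  define k where "k = w pi"
  define h where "h x = (1 - cos x - (x - pi) * sin x / 2) / 2" for x :: real
  define h1 where "h1 x = (sin x - (x - pi) * cos x) / 4" for x :: real
  define h2 where "h2 x = (x - pi) * sin x / 4" for x :: real
  have dh: "(h has_real_derivative h1 x) (at x within A)" for x A
    unfolding h_def[abs_def] h1_def by (auto intro!: derivative_eq_intros simp: field_simps)
  have dh1: "(h1 has_real_derivative h2 x) (at x within A)" for x A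
    unfolding h1_def[abs_def] h2_def by (auto intro!: derivative_eq_intros simp: field_simps)
  have ch: "continuous_on A h" "continuous_on A h1" "continuous_on A h2" for A
    unfolding h_def[abs_def] h1_def[abs_def] h2_def[abs_def] by (intro continuous_intros; simp)+
  have hb: "h 0 = 0" "h (2*pi) = 0" "h pi = 1" by (simp_all add: h_def)
  have w: "continuous_on {0..2*pi} w" using dw DERIV_continuous_on by blast
  have h_sum: "h2 x = phi x / 2 - h x" for x by (simp add: h_def h2_def phi_def field_simps)
  note L2 = in_L2_continuous
  define v where "v x = w x - k * h x" for x
  define v1 where "v1 x = w1 x - k * h1 x" for x
  have dv: "(v has_real_derivative v1 x) (at x within A)" if "x \<in> A" "A \<subseteq> {0..2*pi}" for x A
    unfolding v_def[abs_def] v1_def using that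
    by (auto intro!: derivative_eq_intros has_field_derivative_subset[OF dw] dh)
  have cv: "continuous_on {0..2*pi} v" "continuous_on {0..2*pi} v1"
    unfolding v_def[abs_def] v1_def[abs_def] by (intro continuous_intros w w1 ch)+
  \<comment> \<open>An interval of length \<pi> has first Dirichlet eigenvalue 1; this is why a zero
    at \<pi> had to be created.\<close>
  have half: "(LINT x:{a..a + pi}|lborel. (v x)\<^sup>2) \<le> (LINT x:{a..a + pi}|lborel. (v1 x)\<^sup>2)"
    if "a = 0 \<or> a = pi" for a
    using that
    by (intro wirtinger_Dirichlet dv) (auto intro: continuous_on_subset[OF cv(2)] simp: v_def hb w0 wL k_def)
  have "ip (2*pi) v v \<le> ip (2*pi) v1 v1"
  proof -
    have "ip (2*pi) f f = (LINT x:{0..0 + pi}|lborel. (f x)\<^sup>2) + (LINT x:{pi..pi + pi}|lborel. (f x)\<^sup>2)"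
      if "continuous_on {0..2*pi} f" for f
      using LINT_Icc_combine[of 0 pi "2*pi" "\<lambda>x. (f x)\<^sup>2"] that
      by (simp add: ip_def power2_eq_square borel_integrable_atLeastAtMost' continuous_intros)
    then show ?thesis using half[of 0] half[of pi] cv by simp
  qed
  moreover have "ip (2*pi) v v = ip (2*pi) w w - 2 * k * ip (2*pi) w h + k\<^sup>2 * ip (2*pi) h h"
    unfolding v_def[abs_def] by (intro ip_diff_scale_self L2 w ch)
  moreover have "ip (2*pi) v1 v1 = ip (2*pi) w1 w1 - 2 * k * ip (2*pi) w1 h1 + k\<^sup>2 * ip (2*pi) h1 h1"
    unfolding v1_def[abs_def] by (intro ip_diff_scale_self L2 w1 ch)
  \<comment> \<open>The cross terms agree on both sides: by parts \<integral> w' h' = - \<integral>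
    w h'' with h'' = phi / 2 - h, and w is orthogonal to \<open>phi\<close>.\<close>
  moreover have "ip (2*pi) w1 h1 = ip (2*pi) w h"
  proof -
    have "ip (2*pi) h1 w1 = - ip (2*pi) h2 w"
      by (subst ip_by_parts[OF _ dh1 dw ch(3) w1]) (auto simp: w0 wL)
    also have "ip (2*pi) h2 w = ip (2*pi) (\<lambda>x. 1/2 * phi x - h x) w"
      by (rule ip_cong) (simp add: h_sum)
    also have "\<dots> = 1/2 * ip (2*pi) phi w - ip (2*pi) h w"
      by (subst ip_diff_left) (auto intro!: L2 in_L2_scale continuous_intros ch w simp only: ip_scale_left)
    finally show ?thesis using orth by (simp add: ip_commute)
  qed
  \<comment> \<open>The terms with k^2 have the favourable sign, since |h'|^2 = |h|^2 - 1/2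
    \<integral> phi h and both \<open>phi\<close> and h are nonnegative.\<close>
  moreover have "ip (2*pi) h1 h1 \<le> ip (2*pi) h h"
  proof -
    have "ip (2*pi) h1 h1 = - ip (2*pi) h2 h"
      by (subst ip_by_parts[OF _ dh1 dh ch(3) ch(2)]) (auto simp: hb)
    also have "ip (2*pi) h2 h = ip (2*pi) (\<lambda>x. 1/2 * phi x - h x) h"
      by (rule ip_cong) (simp add: h_sum)
    also have "\<dots> = 1/2 * ip (2*pi) phi h - ip (2*pi) h h"
      by (subst ip_diff_left) (auto intro!: L2 in_L2_scale continuous_intros ch simp only: ip_scale_left)
    finally have "ip (2*pi) h1 h1 = ip (2*pi) h h - 1/2 * ip (2*pi) phi h" by simp
    moreover have "0 \<le> ip (2*pi) phi h"
    proof -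
      have "0 \<le> phi x * h x" if "x \<in> {0..2*pi}" for x
      proof -
        have "(x - pi) * sin x \<le> 0"
        proof (cases "x \<le> pi")
          case True then show ?thesis using that by (intro mult_nonpos_nonneg sin_ge_zero) auto
        next
          case False then show ?thesis using that sin_le_zero[of x] by (cases "x = 2*pi") (auto intro!: mult_nonneg_nonpos)
        qed
        then have "0 \<le> 1 - cos x - (x - pi) * sin x / 2" using cos_le_one[of x] by linarith
        then have "0 \<le> h x" by (simp add: h_def)
        then show ?thesis by (simp add: phi_def)
      qed
      then show ?thesis unfolding ip_def set_lebesgue_integral_def
        by (intro integral_nonneg_AE AE_I2) (auto simp: indicator_def)
    qed
    ultimately show ?thesis by simp
  qed
  ultimately have "ip (2*pi) w w + k\<^sup>2 * ip (2*pi) h h \<le> ip (2*pi) w1 w1 + k\<^sup>2 * ip (2*pi) h1 h1" 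
    "k\<^sup>2 * ip (2*pi) h1 h1 \<le> k\<^sup>2 * ip (2*pi) h h"
    by (simp_all add: mult_left_mono)
  then show ?thesis by linarith
qed

section \<open>The Lyapunov functional\<close>

definition wgt :: "real \<Rightarrow> real" where "wgt x = 1 + x"

text \<open>The corrector solves the adjoint problem \<open>b' + b''' = phi * sin\<close>, \<open>b 0 = b (2\<pi>) = b' 0 = 0\<close>; it cancels the
  quadratic coupling of the critical mode, and \<open>\<integral> phi\<^sup>2 b' = b' (2\<pi>)\<^sup>2 = \<pi>\<^sup>2\<close> is the rate of its cubic damping.\<close>

definition bt :: "real \<Rightarrow> real" where "bt x = - (x * sin x) / 2 + (cos x - cos (2 * x)) / 12"
definition bt1 :: "real \<Rightarrow> real" where
  "bt1 x = - sin x / 2 - x * cos x / 2 + (2 * sin (2 * x) - sin x) / 12"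
definition bt2 :: "real \<Rightarrow> real" where
  "bt2 x = - cos x + x * sin x / 2 + (4 * cos (2 * x) - cos x) / 12"
definition bt3 :: "real \<Rightarrow> real" where
  "bt3 x = 3 / 2 * sin x + x * cos x / 2 + (sin x - 8 * sin (2 * x)) / 12"

text \<open>The coefficient of the orthogonal projection onto \<open>phi\<close>, because
  \<integral> phi^2 = 3 \<pi>.\<close>

definition mode :: "(real \<Rightarrow> real) \<Rightarrow> real" where
  "mode u = ip (2*pi) u phi / (3 * pi)"

text \<open>This is 1 / 48^2. In the equation for w the forcing by a^2 is at most 48 a^2 |w|, and
  Young's inequality turns it into 48^2 a^4. After weighting by \<open>Kw\<close> the cost is a^4,
  below the damping \<pi>^2/2 a^4.\<close>

definition Kw :: real where "Kw = 1 / 2304"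

text \<open>The second bracket is \<integral> (1 + x) w^2 for w = u - mode u * phi, by the last part
  of \<open>mode_split\<close>. It is expanded into linear functionals of u and a single quadratic
  form, the quantities that can be differentiated along \<open>av\<close>.\<close>

definition lyap :: "(real \<Rightarrow> real) \<Rightarrow> real" where
  "lyap u = (3 * pi / 2 - ip (2*pi) u bt) * (mode u)\<^sup>2
     + Kw / 2 * (ip (2*pi) u (\<lambda>x. wgt x * u x) - 2 * mode u * ip (2*pi) u (\<lambda>x. wgt x * phi x)
                  + (mode u)\<^sup>2 * ip (2*pi) phi (\<lambda>x. wgt x * phi x))"

text \<open>The derivative of \<open>lyap\<close> at u in the direction D, with the symmetry of the
  weighted form used for the factor 2.\<close>

definition dlyap :: "(real \<Rightarrow> real) \<Rightarrow> (real \<Rightarrow> real) \<Rightarrow> real" where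
  "dlyap u D = (3 * pi / 2 - ip (2*pi) u bt) * (2 * mode u * mode D) - ip (2*pi) D bt * (mode u)\<^sup>2
     + Kw / 2 * (2 * ip (2*pi) D (\<lambda>x. wgt x * u x)
                  - 2 * (mode D * ip (2*pi) u (\<lambda>x. wgt x * phi x) + mode u * ip (2*pi) D (\<lambda>x. wgt x * phi x))
                  + 2 * mode u * mode D * ip (2*pi) phi (\<lambda>x. wgt x * phi x))"

text \<open>The scalar core of \<open>lyap_dissipation\<close>: S, N, R1, R2 stand for |w|, |w'|,
  \<integral> r and |r|, \<open>ap\<close> for the derivative of a, and t for \<pi>^2/2. The good
  terms are - t a^4 and - Kw N^2. Errors without r carry a spare factor at most 10^-7 relative to
  A^4 + N^2, except the one with \<open>Z0\<close>.\<close>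

lemma dissipation_arith:
  fixes a ap S N R1 R2 X2 X3 Y1 Y2 Y3 Z0 Z1 Z2 Z3 V Ub t :: real
  assumes a: "\<bar>a\<bar> \<le> 1 / 10^7" and S: "0 \<le> S" "S \<le> 1 / 10^7" "S \<le> N"
    and R: "0 \<le> R1" "0 \<le> R2"
    and X: "\<bar>X2\<bar> \<le> S\<^sup>2" "\<bar>X3\<bar> \<le> R1"
    and ap: "\<bar>ap\<bar> \<le> \<bar>a\<bar> * S + S\<^sup>2 + R1"
    and Y: "\<bar>Y1\<bar> \<le> 24 * S" "\<bar>Y2\<bar> \<le> 4 * S\<^sup>2" "\<bar>Y3\<bar> \<le> 4 * R1"
    and Z: "\<bar>Z0\<bar> \<le> 48 * S" "\<bar>Z1\<bar> \<le> 18 * S * N" "\<bar>Z2\<bar> \<le> 27 * N\<^sup>2 * S" "\<bar>Z3\<bar> \<le> 9 * N * R2"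
    and V: "\<bar>V\<bar> \<le> 48 * S" and Ub: "\<bar>Ub\<bar> \<le> 72 * \<bar>a\<bar> + 12 * S" and t: "9 / 2 \<le> t"
  shows "a * X2 / 2 + a * X3 - 2 * Ub * a * ap - t * a^4 - a^3 * Y1 - a\<^sup>2 * Y2 / 2 - a\<^sup>2 * Y3
     + Kw * (S\<^sup>2 / 2 - 3 / 2 * N\<^sup>2 - a\<^sup>2 * Z0 + a * Z1 + Z2 / 2 + Z3 - ap * V)
     \<le> - Kw / 4 * (a^4 + S\<^sup>2) + 300 * R1 + R2\<^sup>2"
proof -
  define e :: real where "e = 1 / 10^7"
  define A where "A = \<bar>a\<bar>"
  have A: "0 \<le> A" "A \<le> e" "A \<le> 1" using a by (auto simp: A_def e_def)
  have Se: "S \<le> e" "S \<le> 1" using S by (auto simp: e_def)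
  have e: "0 \<le> e" "e \<le> 1" by (auto simp: e_def)
  have N: "0 \<le> N" using S by linarith
  have SN: "S\<^sup>2 \<le> N\<^sup>2" using S by (intro power_mono) auto
  have A4: "a^4 = A^4" "a\<^sup>2 = A\<^sup>2" by (auto simp: A_def power_even_abs)
  define Q where "Q = A^4 + N\<^sup>2"
  have Q: "N\<^sup>2 \<le> Q" "A^4 \<le> Q" "0 \<le> Q" by (auto simp: Q_def)
  have QQ: "N * N \<le> Q" using Q by (simp add: power2_eq_square)
  have S2Q: "S * S \<le> Q" using Q SN by (simp add: power2_eq_square)
  have SNN: "S * N \<le> N * N" using S N by (intro mult_right_mono) auto
  \<comment> \<open>The borderline product: Young's inequality bounds it by \<open>Q\<close> with
    nothing to spare. Each further factor A or S contributes an \<open>e\<close>.\<close>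
  have A2S: "2 * (A\<^sup>2 * S) \<le> Q"
  proof -
    have "0 \<le> (A\<^sup>2 - S)\<^sup>2" by simp
    then have "2 * (A\<^sup>2 * S) \<le> (A\<^sup>2)\<^sup>2 + S\<^sup>2" by (simp add: power2_diff)
    then show ?thesis using SN by (simp add: Q_def power_mult[symmetric])
  qed
  have eM: "c * x \<le> e * Q" if "0 \<le> c" "c \<le> e" "x \<le> Q" "0 \<le> x" for c x
    using that by (intro mult_mono) auto
  have A3S: "2 * (A^3 * S) \<le> e * Q"
    using eM[of A "2 * (A\<^sup>2 * S)"] A A2S S by (simp add: power3_eq_cube power2_eq_square mult_ac)
  have ASS: "A * (S * S) \<le> e * Q" using eM[of A "S*S"] A S2Q S by auto
  have SSS: "S * (S * S) \<le> e * Q" using eM[of S "S*S"] S2Q S Se by auto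
  have A2SS: "A * (A * (S * S)) \<le> e * Q"
    using mult_right_mono[of A 1 "A * (S * S)"] A S ASS by auto
  have ASSS: "A * (S * (S * S)) \<le> e * Q"
    using mult_right_mono[of A 1 "S * (S * S)"] A S SSS by auto
  have ASN: "A * (S * N) \<le> e * Q" using eM[of A "S * N"] A SNN QQ S N by auto
  have SNN': "S * (N * N) \<le> e * Q" using eM[of S "N*N"] QQ S Se N by auto
  have t1: "a * X2 / 2 \<le> e * Q"
  proof -
    have "a * X2 \<le> \<bar>a * X2\<bar>" by simp
    also have "\<dots> \<le> A * (S * S)" unfolding abs_mult A_def using X by (intro mult_left_mono) (auto simp: power2_eq_square)
    finally have "a * X2 \<le> e * Q" using ASS by linarith
    moreover have "0 \<le> e * Q" using e Q by simp
    ultimately show ?thesis by linarith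
  qed
  have t2: "a * X3 \<le> R1"
  proof -
    have "a * X3 \<le> \<bar>a * X3\<bar>" by simp
    also have "\<dots> \<le> 1 * R1" unfolding abs_mult using X A A_def by (intro mult_mono) auto
    finally show ?thesis by simp
  qed
  have t3: "- 2 * Ub * a * ap \<le> 264 * (e * Q) + 168 * R1"
  proof -
    have "- 2 * Ub * a * ap \<le> \<bar>- 2 * Ub * a * ap\<bar>" by (rule abs_ge_self)
    also have "\<dots> = 2 * (\<bar>Ub\<bar> * (A * \<bar>ap\<bar>))" by (simp add: abs_mult A_def)
    also have "\<dots> \<le> 2 * ((72 * A + 12 * S) * (A * (A * S + S\<^sup>2 + R1)))"
      using Ub ap A S N R by (intro mult_left_mono mult_mono mult_nonneg_nonneg) (auto simp: A_def)
    also have "\<dots> = 72 * (2 * (A^3 * S)) + 168 * (A * (A * (S * S))) + 24 * (A * (S * (S * S)))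
        + (144 * (A * A) + 24 * (A * S)) * R1"
      by (simp add: algebra_simps power2_eq_square power3_eq_cube)
    also have "(144 * (A * A) + 24 * (A * S)) * R1 \<le> 168 * R1"
    proof (rule mult_right_mono[OF _ R(1)])
      have "A * A \<le> 1" "A * S \<le> 1" using A S Se by (auto intro: mult_le_one)
      then show "144 * (A * A) + 24 * (A * S) \<le> 168" by linarith
    qed
    finally show ?thesis using A3S A2SS ASSS by linarith
  qed
  have t4: "- (a^3 * Y1) \<le> 12 * (e * Q)"
  proof -
    have "- (a^3 * Y1) \<le> \<bar>a^3 * Y1\<bar>" by simp
    also have "\<dots> \<le> A^3 * (24 * S)" unfolding abs_mult A_def power_abs using Y by (intro mult_left_mono) auto
    finally show ?thesis using A3S by simp
  qed
  have t5: "- (a\<^sup>2 * Y2) / 2 \<le> 2 * (e * Q)"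
  proof -
    have "- (a\<^sup>2 * Y2) \<le> \<bar>a\<^sup>2 * Y2\<bar>" by simp
    also have "\<dots> \<le> A\<^sup>2 * (4 * S\<^sup>2)" unfolding abs_mult A4(2)[symmetric] using Y by (intro mult_mono) auto
    finally show ?thesis using A2SS by (simp add: power2_eq_square algebra_simps)
  qed
  have t6: "- (a\<^sup>2 * Y3) \<le> 4 * R1"
  proof -
    have "- (a\<^sup>2 * Y3) \<le> \<bar>a\<^sup>2 * Y3\<bar>" by simp
    also have "\<dots> \<le> 1 * (4 * R1)" unfolding abs_mult using Y A R A4(2)
      by (intro mult_mono) (auto simp: power_le_one)
    finally show ?thesis by simp
  qed
  \<comment> \<open>No factor \<open>e\<close> is available here; the constant 2304 = 48^2 is the
    one compensated by \<open>Kw\<close>.\<close>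
  have k1: "- (a\<^sup>2 * Z0) \<le> N\<^sup>2 / 4 + 2304 * A^4"
  proof -
    have "- (a\<^sup>2 * Z0) \<le> \<bar>a\<^sup>2 * Z0\<bar>" by simp
    also have "\<dots> \<le> A\<^sup>2 * (48 * S)" unfolding abs_mult A4(2)[symmetric] using Z by (intro mult_mono) auto
    also have "\<dots> \<le> S\<^sup>2 / 4 + 2304 * (A\<^sup>2)\<^sup>2"
    proof -
      have "0 \<le> (S / 2 - 48 * A\<^sup>2)\<^sup>2" by simp
      then show ?thesis by (simp add: power2_diff power_divide power_mult_distrib mult_ac)
    qed
    finally show ?thesis using SN by (simp add: power_mult[symmetric])
  qed
  have k2: "a * Z1 \<le> 18 * (e * Q)"
  proof -
    have "a * Z1 \<le> \<bar>a * Z1\<bar>" by simp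
    also have "\<dots> \<le> A * (18 * S * N)" unfolding abs_mult A_def using Z by (intro mult_left_mono) auto
    finally show ?thesis using ASN by (simp add: algebra_simps)
  qed
  have k3: "Z2 / 2 \<le> 14 * (e * Q)"
  proof -
    have "Z2 \<le> 27 * (S * (N * N))" using Z(3) by (simp add: power2_eq_square algebra_simps)
    then have "Z2 \<le> 27 * (e * Q)" using SNN' by linarith
    moreover have "0 \<le> e * Q" using e Q by simp
    ultimately show ?thesis by linarith
  qed
  have k4: "Z3 \<le> N\<^sup>2 / 4 + 81 * R2\<^sup>2"
  proof -
    have "0 \<le> (N / 2 - 9 * R2)\<^sup>2" by simp
    then have "9 * N * R2 \<le> N\<^sup>2 / 4 + 81 * R2\<^sup>2" by (simp add: power2_diff power_divide power_mult_distrib)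
    then show ?thesis using Z(4) by linarith
  qed
  have k5: "- (ap * V) \<le> 96 * (e * Q) + 48 * R1"
  proof -
    have "- (ap * V) \<le> \<bar>ap * V\<bar>" by simp
    also have "\<dots> \<le> (A * S + S\<^sup>2 + R1) * (48 * S)"
      unfolding abs_mult A_def using ap V R S by (intro mult_mono) auto
    also have "\<dots> = 48 * (A * (S * S)) + 48 * (S * (S * S)) + 48 * (R1 * S)"
      by (simp add: algebra_simps power2_eq_square)
    also have "R1 * S \<le> R1 * 1" using R Se by (intro mult_left_mono) auto
    finally show ?thesis using ASS SSS by linarith
  qed
  \<comment> \<open>S \<le> N turns S^2 / 2 - 3 / 2 N^2 into at most - N^2; \<open>k1\<close> and
    \<open>k4\<close> use up a quarter of N^2 each.\<close>
  have k: "Kw * (S\<^sup>2 / 2 - 3 / 2 * N\<^sup>2 - a\<^sup>2 * Z0 + a * Z1 + Z2 / 2 + Z3 - ap * V)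
     \<le> Kw * (- (N\<^sup>2 / 2) + 2304 * A^4 + 128 * (e * Q) + 48 * R1 + 81 * R2\<^sup>2)"
    using k1 k2 k3 k4 k5 SN by (intro mult_left_mono) (auto simp: Kw_def)
  have ta: "9 / 2 * A^4 \<le> t * a^4" using mult_right_mono[OF t, of "A^4"] A4 A by simp
  \<comment> \<open>The errors add up to 279 e Q outside the \<open>Kw\<close> bracket and 128 Kw e
    Q inside it. The radius 10^-7 is what makes 500 e \<le> Kw / 4.\<close>
  have eQ: "500 * (e * Q) \<le> Kw / 4 * Q"
    using Q by (auto simp: e_def Kw_def)
  define T where "T = Kw * (S\<^sup>2 / 2 - 3 / 2 * N\<^sup>2 - a\<^sup>2 * Z0 + a * Z1 + Z2 / 2 + Z3 - ap * V)"
  define E where "E = e * Q"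
  have E: "0 \<le> E" "500 * E \<le> 1 / 9216 * (A^4 + N\<^sup>2)"
    using e Q eQ by (auto simp: E_def Q_def Kw_def)
  have T: "T \<le> 1 / 2304 * (- (N\<^sup>2 / 2) + 2304 * A^4 + 128 * E + 48 * R1 + 81 * R2\<^sup>2)"
    using k unfolding T_def E_def Kw_def .
  have nn: "0 \<le> R2\<^sup>2" "0 \<le> A^4" using A by simp_all
  have "a * X2 / 2 + a * X3 - 2 * Ub * a * ap - t * a^4 - a^3 * Y1 - a\<^sup>2 * Y2 / 2 - a\<^sup>2 * Y3 + T
    \<le> E + R1 + (264 * E + 168 * R1) - 9 / 2 * A^4 + 12 * E + 2 * E + 4 * R1 + T"
    using t1[folded E_def] t2 t3[folded E_def] t4[folded E_def] t5[folded E_def] t6 ta by linarith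
  also have "\<dots> \<le> - (1 / 9216) * (A^4 + S\<^sup>2) + 300 * R1 + R2\<^sup>2"
    using T E nn R SN unfolding distrib_left by linarith
  finally show ?thesis unfolding T_def A4 Kw_def by simp
qed

abbreviation (input) "LL \<equiv> 2 * pi"

section \<open>Bounds and integrals of the explicit functions \<open>phi\<close>, \<open>wgt\<close>
  and \<open>bt\<close>\<close>

lemma wgt_bounds: "x \<in> {0..LL} \<Longrightarrow> 1 \<le> wgt x \<and> wgt x \<le> 8"
  using pi_less_4 pi_approx(2) by (auto simp: wgt_def)

lemma bt_derivs:
  "(phi has_real_derivative sin x) (at x within A)"
  "(wgt has_real_derivative 1) (at x within A)"
  "(bt has_real_derivative bt1 x) (at x within A)"
  "(bt1 has_real_derivative bt2 x) (at x within A)"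
  "(bt2 has_real_derivative bt3 x) (at x within A)"
  unfolding phi_def[abs_def] wgt_def[abs_def] bt_def[abs_def] bt1_def[abs_def] bt2_def[abs_def] bt3_def
  by (auto intro!: derivative_eq_intros simp: field_simps)

lemma bt_sum: "bt1 x + bt3 x = phi x * sin x"
  by (simp only: bt1_def bt3_def phi_def sin_double) (simp add: field_simps)

lemma continuous_on_bt [continuous_intros]:
  "continuous_on A wgt" "continuous_on A bt" "continuous_on A bt1" "continuous_on A bt2" "continuous_on A bt3"
  unfolding wgt_def[abs_def] bt_def[abs_def] bt1_def[abs_def] bt2_def[abs_def] bt3_def[abs_def]
  by (intro continuous_intros; simp)+

lemma kdv_test_phi: "kdv_test LL phi sin cos (\<lambda>x. - sin x)"
  unfolding kdv_test_def using bt_derivs(1)[where A = UNIV]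
  by (auto intro!: derivative_eq_intros continuous_intros simp: phi_def)

lemma kdv_test_bt: "kdv_test LL bt bt1 bt2 bt3"
  unfolding kdv_test_def using bt_derivs(3-5)[where A = UNIV]
  by (auto intro!: continuous_intros simp: bt_def bt1_def)

lemma phi_bounds: "0 \<le> phi x" "phi x \<le> 2" "\<bar>phi x\<bar> \<le> 2"
  using cos_le_one[of x] cos_ge_minus_one[of x] by (auto simp: phi_def)

lemma bt_bounds:
  assumes "x \<in> {0..LL}"
  shows "\<bar>bt x\<bar> \<le> 4" "\<bar>bt1 x\<bar> \<le> 4"
proof -
  have x: "0 \<le> x" "x \<le> 6.3" using assms pi_approx by auto
  have s: "\<bar>x * sin x\<bar> \<le> 6.3 * 1" "\<bar>x * cos x\<bar> \<le> 6.3 * 1"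
    unfolding abs_mult using x by (intro mult_mono; auto)+
  have t: "\<bar>sin x\<bar> \<le> 1" "\<bar>cos x\<bar> \<le> 1" "\<bar>sin (2*x)\<bar> \<le> 1" "\<bar>cos (2*x)\<bar> \<le> 1" by auto
  have 1: "\<bar>- p / 2 + (c - d) / 12\<bar> \<le> 4" if "\<bar>p\<bar> \<le> 6.3" "\<bar>c\<bar> \<le> 1" "\<bar>d\<bar> \<le> 1" for p c d :: real
    using that unfolding diff_divide_distrib by linarith
  have 2: "\<bar>- c / 2 - p / 2 + (2 * d - c) / 12\<bar> \<le> 4" if "\<bar>p\<bar> \<le> 6.3" "\<bar>c\<bar> \<le> 1" "\<bar>d\<bar> \<le> 1" for p c d :: real
    using that unfolding diff_divide_distrib by linarith
  show "\<bar>bt x\<bar> \<le> 4" unfolding bt_def by (rule 1) (use s t in auto)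
  show "\<bar>bt1 x\<bar> \<le> 4" unfolding bt1_def by (rule 2) (use s t in auto)
qed

lemma ip_phi_phi: "ip LL phi phi = 3 * pi"
proof -
  have "ip LL phi phi = (3 * LL / 2 - 2 * sin LL + sin LL * cos LL / 2) - (3 * 0 / 2 - 2 * sin 0 + sin 0 * cos 0 / 2)"
    unfolding ip_def
  proof (rule LINT_Icc_FTC[where F = "\<lambda>x. 3 * x / 2 - 2 * sin x + sin x * cos x / 2"])
    fix x :: real
    have "3 / 2 - 2 * cos x + (cos x * cos x - sin x * sin x) / 2 = phi x * phi x"
    proof -
      have s2: "sin x * sin x = 1 - cos x * cos x"
        using sin_cos_squared_add[of x] by (simp add: power2_eq_square)
      show ?thesis unfolding s2 phi_def by (simp add: field_simps)
    qed
    then show "((\<lambda>x. 3 * x / 2 - 2 * sin x + sin x * cos x / 2) has_real_derivative phi x * phi x) (at x within {0..LL})"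
      by (auto intro!: derivative_eq_intros simp: field_simps)
  qed (auto intro!: continuous_intros)
  then show ?thesis by simp
qed

lemma ip_phi_phi_sin: "ip LL (\<lambda>x. phi x * phi x) sin = 0"
proof -
  have "ip LL (\<lambda>x. phi x * phi x) sin = phi LL ^ 3 / 3 - phi 0 ^ 3 / 3"
    unfolding ip_def
    by (rule LINT_Icc_FTC[where F = "\<lambda>x. phi x ^ 3 / 3"])
      (auto intro!: derivative_eq_intros bt_derivs continuous_intros simp: power2_eq_square)
  then show ?thesis by (simp add: phi_def)
qed

text \<open>The equation b' + b''' = phi sin makes phi^2 b' the derivative of phi^2 b - b^2 - 2 b
  b'' + b'^2. Only b'^2 survives at the ends: it is 0 at 0 and \<pi>^2 at 2 \<pi>.\<close>

lemma ip_phi_phi_bt1: "ip LL (\<lambda>x. phi x * phi x) bt1 = pi\<^sup>2"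
proof -
  define F where "F x = phi x * phi x * bt x - bt x * bt x - 2 * (bt x * bt2 x) + bt1 x * bt1 x" for x
  have "ip LL (\<lambda>x. phi x * phi x) bt1 = F LL - F 0"
    unfolding ip_def
  proof (rule LINT_Icc_FTC)
    fix x :: real
    have b3: "bt3 x = phi x * sin x - bt1 x" using bt_sum[of x] by simp
    show "(F has_real_derivative phi x * phi x * bt1 x) (at x within {0..LL})"
      unfolding F_def[abs_def]
      by (rule derivative_eq_intros bt_derivs refl)+ (simp add: b3 algebra_simps)
  qed (auto intro!: continuous_intros)
  moreover have "cos (4 * pi) = 1" using cos_npi[of 4] by simp
  moreover have "sin (4 * pi) = 0" using sin_npi[of 4] by simp
  ultimately show ?thesis by (simp add: F_def phi_def bt_def bt1_def bt2_def power2_eq_square)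
qed

section \<open>Estimates in L2(0, 2 \<pi>), the splitting along \<open>phi\<close>, and the
  functional at a fixed time\<close>

lemma L2norm_bounded:
  assumes g: "continuous_on {0..LL} g" and B: "\<And>x. x \<in> {0..LL} \<Longrightarrow> \<bar>g x\<bar> \<le> B" "0 \<le> B"
  shows "L2norm LL g \<le> 3 * B"
proof -
  have "L2norm LL (\<lambda>_. 1) = sqrt LL"
    by (simp add: L2norm_def set_lebesgue_integral_def)
  also have "\<dots> \<le> sqrt (3\<^sup>2)" using pi_approx by (intro real_sqrt_le_mono) auto
  finally have "L2norm LL (\<lambda>_. 1) \<le> 3" by simp
  moreover have "L2norm LL (\<lambda>x. g x * 1) \<le> B * L2norm LL (\<lambda>_. 1)"
    using g B by (intro L2norm_mult_bound in_L2_continuous) auto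
  ultimately show ?thesis using B(2) mult_left_mono[of "L2norm LL (\<lambda>_. 1)" 3 B] by simp
qed

lemma ip_bounded:
  assumes f: "in_L2 LL f" and g: "continuous_on {0..LL} g"
    and B: "\<And>x. x \<in> {0..LL} \<Longrightarrow> \<bar>g x\<bar> \<le> B" "0 \<le> B"
  shows "\<bar>ip LL f g\<bar> \<le> 3 * B * L2norm LL f"
proof -
  have "\<bar>ip LL f g\<bar> \<le> L2norm LL f * L2norm LL g" by (intro ip_bound f in_L2_continuous g)
  also have "\<dots> \<le> L2norm LL f * (3 * B)" by (intro mult_left_mono L2norm_bounded g B L2norm_nonneg)
  finally show ?thesis by (simp add: mult_ac)
qed

lemma mode_split:
  assumes "in_L2 LL u"
  defines "w \<equiv> \<lambda>x. u x - mode u * phi x"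
  shows "in_L2 LL w" "ip LL w phi = 0" "ip LL u u = 3 * pi * (mode u)\<^sup>2 + ip LL w w"
    "\<bar>mode u\<bar> \<le> L2norm LL u" "L2norm LL w \<le> L2norm LL u"
    "ip LL w (\<lambda>x. wgt x * w x) = ip LL u (\<lambda>x. wgt x * u x) - 2 * mode u * ip LL u (\<lambda>x. wgt x * phi x)
       + (mode u)\<^sup>2 * ip LL phi (\<lambda>x. wgt x * phi x)"
proof -
  have P: "in_L2 LL phi" by (intro in_L2_continuous continuous_intros)
  have m: "ip LL u phi = 3 * pi * mode u" by (simp add: mode_def)
  show w: "in_L2 LL w" unfolding w_def by (intro in_L2_diff in_L2_scale assms P)
  show "ip LL w phi = 0"
    unfolding w_def by (subst ip_diff_left) (auto intro!: in_L2_scale assms P simp: ip_scale_left ip_phi_phi m)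
  have "ip LL w w = ip LL u u - 3 * pi * (mode u)\<^sup>2"
    unfolding w_def by (subst ip_diff_scale_self) (auto intro!: assms P simp: ip_phi_phi m power2_eq_square)
  then show uu: "ip LL u u = 3 * pi * (mode u)\<^sup>2 + ip LL w w" by simp
  have "1 * (mode u)\<^sup>2 \<le> 3 * pi * (mode u)\<^sup>2" using pi_approx by (intro mult_right_mono) auto
  then have 1: "(mode u)\<^sup>2 \<le> (L2norm LL u)\<^sup>2" unfolding L2norm_power2
    using uu ip_nonneg[of LL w] by linarith
  show "\<bar>mode u\<bar> \<le> L2norm LL u"
    using real_sqrt_le_mono[OF 1] by (simp add: L2norm_nonneg)
  have "(L2norm LL w)\<^sup>2 \<le> (L2norm LL u)\<^sup>2" unfolding L2norm_power2 using uu by simp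
  then show "L2norm LL w \<le> L2norm LL u" using L2norm_nonneg by (rule power2_le_imp_le)
  have g: "in_L2 LL (\<lambda>x. wgt x * u x)" "in_L2 LL (\<lambda>x. wgt x * phi x)"
    by (intro in_L2_mult_continuous assms P continuous_intros)+
  have "ip LL w (\<lambda>x. wgt x * w x) = ip LL w (\<lambda>x. wgt x * u x - mode u * (wgt x * phi x))"
    by (rule ip_cong) (simp add: w_def algebra_simps)
  also have "\<dots> = ip LL w (\<lambda>x. wgt x * u x) - mode u * ip LL w (\<lambda>x. wgt x * phi x)"
    by (subst ip_diff_right) (auto intro!: w g in_L2_scale simp: ip_scale_right)
  also have "ip LL w (\<lambda>x. wgt x * u x) = ip LL u (\<lambda>x. wgt x * u x) - mode u * ip LL phi (\<lambda>x. wgt x * u x)"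
    unfolding w_def by (subst ip_diff_left) (auto intro!: assms P g in_L2_scale simp: ip_scale_left)
  also have "ip LL phi (\<lambda>x. wgt x * u x) = ip LL u (\<lambda>x. wgt x * phi x)" by (simp add: ip_def mult_ac)
  also have "ip LL w (\<lambda>x. wgt x * phi x) = ip LL u (\<lambda>x. wgt x * phi x) - mode u * ip LL phi (\<lambda>x. wgt x * phi x)"
    unfolding w_def by (subst ip_diff_left) (auto intro!: assms P g in_L2_scale simp: ip_scale_left)
  finally show "ip LL w (\<lambda>x. wgt x * w x) = ip LL u (\<lambda>x. wgt x * u x) - 2 * mode u * ip LL u (\<lambda>x. wgt x * phi x)
       + (mode u)\<^sup>2 * ip LL phi (\<lambda>x. wgt x * phi x)"
    by (simp add: algebra_simps power2_eq_square)
qed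

text \<open>Smallness keeps the coefficient 3 \<pi>/2 - \<integral> u b between 3 and 6, and the
  weight 1 + x stays between 1 and 8.\<close>

lemma lyap_equiv:
  assumes u: "in_L2 LL u" and small: "L2norm LL u \<le> 1 / 10^7"
  shows "Kw / 2 * ip LL u u \<le> lyap u" "lyap u \<le> 8 * ip LL u u"
proof -
  define w where "w x = u x - mode u * phi x" for x
  note ms = mode_split[OF u, folded w_def]
  have l: "lyap u = (3 * pi / 2 - ip LL u bt) * (mode u)\<^sup>2 + Kw / 2 * ip LL w (\<lambda>x. wgt x * w x)"
    unfolding lyap_def ms(6) ..
  have "\<bar>ip LL u bt\<bar> \<le> 3 * 4 * L2norm LL u"
    by (rule ip_bounded[OF u]) (auto intro!: continuous_intros bt_bounds)
  then have ub: "\<bar>ip LL u bt\<bar> \<le> 1" using small by simp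
  have wl: "ip LL w w \<le> ip LL w (\<lambda>x. wgt x * w x)"
    unfolding ip_def
  proof (rule set_integral_mono)
    show "w x * w x \<le> w x * (wgt x * w x)" if "x \<in> {0..LL}" for x
      using mult_right_mono[of 1 "wgt x" "w x * w x"] wgt_bounds[OF that] by (simp add: mult_ac)
  qed (auto intro!: set_integrable_mult_L2 in_L2_mult_continuous continuous_intros ms(1))
  have "\<bar>ip LL w (\<lambda>x. wgt x * w x)\<bar> \<le> 8 * L2norm LL w * L2norm LL w"
    using wgt_bounds by (intro ip_mult_bounded ms(1) continuous_intros) fastforce+
  then have wu: "ip LL w (\<lambda>x. wgt x * w x) \<le> 8 * ip LL w w"
    unfolding L2norm_power2[symmetric] by (simp add: power2_eq_square)
  have m: "3 * (mode u)\<^sup>2 \<le> (3 * pi / 2 - ip LL u bt) * (mode u)\<^sup>2" 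
    "(3 * pi / 2 - ip LL u bt) * (mode u)\<^sup>2 \<le> 6 * (mode u)\<^sup>2"
    using ub pi_approx by (intro mult_right_mono; auto)+
  have m2: "9 * (mode u)\<^sup>2 \<le> 3 * pi * (mode u)\<^sup>2" "3 * pi * (mode u)\<^sup>2 \<le> 10 * (mode u)\<^sup>2"
    using pi_approx by (intro mult_right_mono; auto)+
  have nn: "0 \<le> (mode u)\<^sup>2" "0 \<le> ip LL w w" by (auto simp: ip_nonneg)
  show "Kw / 2 * ip LL u u \<le> lyap u" "lyap u \<le> 8 * ip LL u u"
    using wl wu m m2 nn unfolding l ms(3) Kw_def by (auto simp: field_simps)
qed

lemma abs_le_sup_derivative:
  assumes dw: "\<And>x. x \<in> {0..LL} \<Longrightarrow> (w has_real_derivative w1 x) (at x within {0..LL})"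
    and w1: "continuous_on {0..LL} w1" and w0: "w 0 = 0" and x: "x \<in> {0..LL}"
  shows "\<bar>w x\<bar> \<le> 3 * L2norm LL w1"
proof -
  have x_sub: "{0..x} \<subseteq> {0..LL}" using x by auto
  have cx: "continuous_on {0..x} w1" using w1 x_sub continuous_on_subset by blast
  have "w x = (LINT s:{0..x}|lborel. w1 s)"
    using LINT_Icc_FTC[of 0 x w w1] x w0 cx has_field_derivative_subset[OF dw x_sub] x_sub by auto
  also have "\<bar>\<dots>\<bar> \<le> (LINT s:{0..x}|lborel. \<bar>w1 s\<bar>)"
    using set_integral_norm_bound[OF borel_integrable_atLeastAtMost'[OF cx]] by simp
  also have "\<dots> \<le> (LINT s:{0..LL}|lborel. \<bar>w1 s\<bar>)"
    using x w1 LINT_Icc_combine[of 0 x LL "\<lambda>s. \<bar>w1 s\<bar>"]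
    by (simp add: borel_integrable_atLeastAtMost' continuous_intros)
      (auto simp: set_lebesgue_integral_def indicator_def intro!: integral_nonneg_AE)
  also have "\<dots> = ip LL (\<lambda>s. \<bar>w1 s\<bar>) (\<lambda>_. 1)" by (simp add: ip_def)
  also have "\<dots> \<le> 3 * 1 * L2norm LL (\<lambda>s. \<bar>w1 s\<bar>)"
    by (rule order_trans[OF abs_ge_self ip_bounded]) (auto intro!: in_L2_continuous continuous_intros w1)
  also have "L2norm LL (\<lambda>s. \<bar>w1 s\<bar>) = L2norm LL w1" by (simp add: L2norm_def)
  finally show ?thesis by simp
qed

text \<open>Here q = u^2/2 + r, with r the averaging error. \<open>phi\<close> and \<open>bt\<close>
  are admissible in \<open>weak\<close> directly, while (1 + x) w goes through the last conclusion
  of \<open>kdv_weak_regularity\<close>; the resulting identities are then fed into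
  \<open>dissipation_arith\<close>.\<close>

lemma lyap_dissipation:
  assumes D: "in_L2 LL D"
    and u: "continuous_on {0..LL} u" and q: "continuous_on {0..LL} q"
    and u0: "u 0 = 0" and uL: "u LL = 0"
    and weak: "\<And>b b1 b2 b3. kdv_test LL b b1 b2 b3 \<Longrightarrow>
      ip LL D b = ip LL u (\<lambda>x. b1 x + b3 x) + ip LL q b1"
    and qu: "\<And>x. x \<in> {0..LL} \<Longrightarrow> (u x)\<^sup>2 / 2 \<le> q x"
    and small: "L2norm LL u \<le> 1 / 10^7"
  defines "r \<equiv> \<lambda>x. q x - (u x)\<^sup>2 / 2"
  shows "dlyap u D \<le> - (ip LL u u)\<^sup>2 / 2000000 + 300 * ip LL r (\<lambda>_. 1) + ip LL r r"
proof -
  obtain u1 u2 where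
    du: "\<And>x. x \<in> {0..LL} \<Longrightarrow> (u has_real_derivative u1 x) (at x within {0..LL})" and
    du1: "\<And>x. x \<in> {0..LL} \<Longrightarrow> (u1 has_real_derivative u2 x) (at x within {0..LL})" and
    u2: "continuous_on {0..LL} u2" and u1L: "u1 LL = 0" and
    Df: "\<And>f f'. (\<And>x. x \<in> {0..LL} \<Longrightarrow> (f has_real_derivative f' x) (at x within {0..LL})) \<Longrightarrow>
       continuous_on {0..LL} f' \<Longrightarrow> f 0 = 0 \<Longrightarrow> f LL = 0 \<Longrightarrow>
       ip LL D f = ip LL f' (\<lambda>x. q x + u x + u2 x)"
    by (rule kdv_weak_regularity[OF _ D u q u0 uL weak]) (auto simp: that)
  have u1: "continuous_on {0..LL} u1" using du1 DERIV_continuous_on by blast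
  note L2 = in_L2_continuous
  note ci = continuous_intros
  have csin: "continuous_on {0..LL} sin" and cbt1: "continuous_on {0..LL} bt1" by (intro ci)+
  define a where "a = mode u"
  define ap where "ap = mode D"
  define w where "w = (\<lambda>x. u x - a * phi x)"
  define w1 where "w1 x = u1 x - a * sin x" for x
  define w2 where "w2 x = u2 x - a * cos x" for x
  note ms = mode_split[OF L2[OF u], folded a_def, folded w_def]
  have dw: "(w has_real_derivative w1 x) (at x within {0..LL})" if "x \<in> {0..LL}" for x
    unfolding w_def w1_def by (auto intro!: derivative_eq_intros du[OF that] bt_derivs)
  have dw1: "(w1 has_real_derivative w2 x) (at x within {0..LL})" if "x \<in> {0..LL}" for x
    unfolding w1_def[abs_def] w2_def by (auto intro!: derivative_eq_intros du1[OF that])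
  have w: "continuous_on {0..LL} w" unfolding w_def by (intro ci u)
  have w1: "continuous_on {0..LL} w1" unfolding w1_def[abs_def] by (intro ci u1)
  have w2: "continuous_on {0..LL} w2" unfolding w2_def[abs_def] by (intro ci u2)
  have wb: "w 0 = 0" "w LL = 0" "w1 LL = 0" by (auto simp: w_def w1_def u0 uL u1L phi_def)
  have r: "continuous_on {0..LL} r" unfolding r_def by (intro ci q u) auto
  have r0: "0 \<le> r x" if "x \<in> {0..LL}" for x using qu[OF that] by (simp add: r_def)
  define S where "S = L2norm LL w"
  define N where "N = L2norm LL w1"
  define R1 where "R1 = ip LL r (\<lambda>_. 1)"
  define R2 where "R2 = L2norm LL r"
  have S0: "0 \<le> S" and N0: "0 \<le> N" and R2: "0 \<le> R2" by (auto simp: S_def N_def R2_def L2norm_nonneg)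
  have S2: "S\<^sup>2 = ip LL w w" and N2: "N\<^sup>2 = ip LL w1 w1" and R22: "R2\<^sup>2 = ip LL r r"
    by (auto simp: S_def N_def R2_def L2norm_power2)
  have SN: "S \<le> N"
    using poincare_orthogonal_phi[OF dw w1 wb(1,2) ms(2)] N0
    unfolding S2[symmetric] N2[symmetric] by (rule power2_le_imp_le)
  have supw: "\<bar>w x\<bar> \<le> 3 * N" if "x \<in> {0..LL}" for x
    unfolding N_def by (rule abs_le_sup_derivative[OF dw w1 wb(1) that])

  define z where "z x = w x + wgt x * w1 x" for x
  have z: "continuous_on {0..LL} z" unfolding z_def[abs_def] by (intro ci w w1)
  have dz: "((\<lambda>x. wgt x * w x) has_real_derivative z x) (at x within {0..LL})" if "x \<in> {0..LL}" for x
    unfolding z_def by (auto intro!: derivative_eq_intros bt_derivs dw[OF that])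
  have Nz: "L2norm LL z \<le> 9 * N"
  proof -
    have "L2norm LL z \<le> L2norm LL w + L2norm LL (\<lambda>x. wgt x * w1 x)"
      unfolding z_def[abs_def] by (intro L2norm_add_le L2 ci w w1)
    also have "L2norm LL (\<lambda>x. wgt x * w1 x) \<le> 8 * L2norm LL w1"
      using wgt_bounds by (intro L2norm_mult_bound L2 ci w1) fastforce+
    finally show ?thesis using SN by (simp add: S_def N_def)
  qed

  have q_expand: "ip LL q g = a\<^sup>2 / 2 * ip LL (\<lambda>x. phi x * phi x) g + a * ip LL w (\<lambda>x. phi x * g x)
      + ip LL w (\<lambda>x. w x * g x) / 2 + ip LL r g" if g: "continuous_on {0..LL} g" for g
  proof -
    have "ip LL q g = ip LL (\<lambda>x. a\<^sup>2 / 2 * (phi x * phi x) + a * (w x * phi x) + 1 / 2 * (w x * w x) + r x) g"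
      by (rule ip_cong) (simp add: r_def w_def power2_eq_square algebra_simps)
    also have "\<dots> = ip LL (\<lambda>x. a\<^sup>2 / 2 * (phi x * phi x) + a * (w x * phi x) + 1 / 2 * (w x * w x)) g + ip LL r g"
      by (intro ip_add_left L2 ci w r g)
    also have "ip LL (\<lambda>x. a\<^sup>2 / 2 * (phi x * phi x) + a * (w x * phi x) + 1 / 2 * (w x * w x)) g
       = ip LL (\<lambda>x. a\<^sup>2 / 2 * (phi x * phi x) + a * (w x * phi x)) g + ip LL (\<lambda>x. 1 / 2 * (w x * w x)) g"
      by (intro ip_add_left L2 ci w r g)
    also have "ip LL (\<lambda>x. a\<^sup>2 / 2 * (phi x * phi x) + a * (w x * phi x)) g
       = ip LL (\<lambda>x. a\<^sup>2 / 2 * (phi x * phi x)) g + ip LL (\<lambda>x. a * (w x * phi x)) g"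
      by (intro ip_add_left L2 ci w r g)
    also have "ip LL (\<lambda>x. a\<^sup>2 / 2 * (phi x * phi x)) g = a\<^sup>2 / 2 * ip LL (\<lambda>x. phi x * phi x) g"
      by (rule ip_scale_left)
    also have "ip LL (\<lambda>x. a * (w x * phi x)) g = a * ip LL w (\<lambda>x. phi x * g x)"
      by (subst ip_scale_left) (simp add: ip_def mult_ac)
    also have "ip LL (\<lambda>x. 1 / 2 * (w x * w x)) g = 1 / 2 * ip LL w (\<lambda>x. w x * g x)"
      by (subst ip_scale_left) (simp add: ip_def mult_ac)
    finally show ?thesis by simp
  qed
  \<comment> \<open>As r is nonnegative, pairing it with a bounded function costs only its integral,
    which is of order \<omega>^2 in the application.\<close>
  have rg: "\<bar>ip LL r g\<bar> \<le> B * R1" if g: "continuous_on {0..LL} g" "\<And>x. x \<in> {0..LL} \<Longrightarrow> \<bar>g x\<bar> \<le> B" for g B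
  proof -
    have "\<bar>ip LL r g\<bar> \<le> (LINT x:{0..LL}|lborel. \<bar>r x * g x\<bar>)"
      unfolding ip_def using set_integral_norm_bound[OF set_integrable_mult_L2[OF L2[OF r] L2[OF g(1)]]] by simp
    also have "\<dots> \<le> (LINT x:{0..LL}|lborel. B * (r x * 1))"
    proof (rule set_integral_mono)
      show "\<bar>r x * g x\<bar> \<le> B * (r x * 1)" if "x \<in> {0..LL}" for x
        using mult_left_mono[OF g(2)[OF that] r0[OF that]] r0[OF that] by (simp add: abs_mult mult_ac)
    qed (auto intro!: borel_integrable_atLeastAtMost' ci r g)
    also have "\<dots> = B * R1" by (simp add: R1_def ip_def)
    finally show ?thesis .
  qed
  have R1: "0 \<le> R1" using rg[of "\<lambda>_. 0" 1] by (simp add: ip_def)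

  define X1 where "X1 = ip LL w (\<lambda>x. phi x * sin x)"
  define X2 where "X2 = ip LL w (\<lambda>x. w x * sin x)"
  define X3 where "X3 = ip LL r sin"
  define Y1 where "Y1 = ip LL w (\<lambda>x. phi x * bt1 x)"
  define Y2 where "Y2 = ip LL w (\<lambda>x. w x * bt1 x)"
  define Y3 where "Y3 = ip LL r bt1"
  define Z0 where "Z0 = ip LL w (\<lambda>x. wgt x * (phi x * sin x))"
  define Z1 where "Z1 = ip LL w (\<lambda>x. phi x * z x)"
  define Z2 where "Z2 = ip LL w (\<lambda>x. w x * z x)"
  define Z3 where "Z3 = ip LL r z"
  define V where "V = ip LL w (\<lambda>x. wgt x * phi x)"
  define Ub where "Ub = ip LL u bt"

  \<comment> \<open>phi' + phi''' = 0 removes the linear part, and \<integral> phi^2 sin = 0 removes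
    the term in a^2.\<close>
  have eq_ap: "3 * pi * ap = a * X1 + X2 / 2 + X3"
  proof -
    have "3 * pi * ap = ip LL D phi" by (simp add: ap_def mode_def)
    also have "\<dots> = ip LL u (\<lambda>x. sin x + - sin x) + ip LL q sin" by (rule weak[OF kdv_test_phi])
    also have "ip LL u (\<lambda>x. sin x + - sin x) = 0" by (simp add: ip_def)
    finally show ?thesis
      by (simp add: q_expand[OF csin] ip_phi_phi_sin X1_def X2_def X3_def)
  qed
  \<comment> \<open>The linear part reproduces \<open>X1\<close>. After multiplication by - a^2 it
    cancels the a^2 \<open>X1\<close> contained in a * (3 \<pi> ap), and the term in \<pi>^2 becomes
    the damping.\<close>
  have eq_bt: "ip LL D bt = X1 + a\<^sup>2 / 2 * pi\<^sup>2 + a * Y1 + Y2 / 2 + Y3"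
  proof -
    have "ip LL D bt = ip LL u (\<lambda>x. bt1 x + bt3 x) + ip LL q bt1" by (rule weak[OF kdv_test_bt])
    also have "ip LL u (\<lambda>x. bt1 x + bt3 x) = ip LL (\<lambda>x. w x + a * phi x) (\<lambda>x. phi x * sin x)"
      by (rule ip_cong) (simp add: bt_sum w_def)
    also have "\<dots> = X1 + ip LL (\<lambda>x. a * phi x) (\<lambda>x. phi x * sin x)"
      unfolding X1_def by (intro ip_add_left L2 ci w)
    also have "ip LL (\<lambda>x. a * phi x) (\<lambda>x. phi x * sin x) = a * ip LL (\<lambda>x. phi x * phi x) sin"
      by (subst ip_scale_left) (simp add: ip_def mult_ac)
    finally show ?thesis
      by (simp add: q_expand[OF cbt1] ip_phi_phi_sin ip_phi_phi_bt1 Y1_def Y2_def Y3_def)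
  qed
  \<comment> \<open>Since phi + cos = 1, u + u'' equals a + w + w''; the constant a is invisible to
    z, the derivative of a function vanishing at both ends.\<close>
  have eq_w: "ip LL D (\<lambda>x. wgt x * w x) = S\<^sup>2 / 2 - 3 / 2 * N\<^sup>2 - (w1 0)\<^sup>2 / 2 - a\<^sup>2 * Z0 + a * Z1 + Z2 / 2 + Z3"
  proof -
    have "ip LL D (\<lambda>x. wgt x * w x) = ip LL z (\<lambda>x. q x + u x + u2 x)"
      by (rule Df) (auto simp: wb intro!: dz z)
    also have "\<dots> = ip LL z (\<lambda>x. q x + (a + (w x + w2 x)))"
      by (rule ip_cong) (simp add: w_def w2_def phi_def algebra_simps)
    also have "\<dots> = ip LL z q + ip LL z (\<lambda>x. a + (w x + w2 x))"
      by (intro ip_add_right L2 ci q w w2 z)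
    also have "ip LL z (\<lambda>x. a + (w x + w2 x)) = ip LL z (\<lambda>_. a) + ip LL z (\<lambda>x. w x + w2 x)"
      by (intro ip_add_right L2 ci q w w2 z)
    also have "ip LL z (\<lambda>_. a) = 0"
    proof -
      have "ip LL (\<lambda>_. a) z = 0"
        by (subst ip_by_parts[OF _ _ dz _ z, where f' = "\<lambda>_. 0"]) (auto simp: wb ip_def)
      then show ?thesis by (simp add: ip_commute)
    qed
    also have "ip LL z (\<lambda>x. w x + w2 x) = S\<^sup>2 / 2 - 3 / 2 * N\<^sup>2 - (w1 0)\<^sup>2 / 2"
    proof -
      \<comment> \<open>Kato's smoothing identity for the multiplier (1 + x) w: the slope of the
        weight yields 3/2 w'^2, and the trace w'(0) leaves a term of good sign.\<close>
      define F where "F x = wgt x * w x * w x / 2 + w x * w1 x + wgt x * w1 x * w1 x / 2" for x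
      have "(LINT x:{0..LL}|lborel. z x * (w x + w2 x) - 1 / 2 * (w x * w x) + 3 / 2 * (w1 x * w1 x)) = F LL - F 0"
      proof (rule LINT_Icc_FTC)
        show "(F has_real_derivative z x * (w x + w2 x) - 1 / 2 * (w x * w x) + 3 / 2 * (w1 x * w1 x)) (at x within {0..LL})"
          if "x \<in> {0..LL}" for x
          unfolding F_def[abs_def]
          by (rule derivative_eq_intros bt_derivs dw[OF that] dw1[OF that] refl | simp)+
            (simp add: z_def field_simps)
      qed (auto intro!: ci w w1 w2 z)
      also have "F LL - F 0 = - (w1 0)\<^sup>2 / 2"
        by (simp add: F_def wb wgt_def power2_eq_square)
      also have "(LINT x:{0..LL}|lborel. z x * (w x + w2 x) - 1 / 2 * (w x * w x) + 3 / 2 * (w1 x * w1 x))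
        = (LINT x:{0..LL}|lborel. z x * (w x + w2 x) - 1 / 2 * (w x * w x)) + (LINT x:{0..LL}|lborel. 3 / 2 * (w1 x * w1 x))"
        by (intro set_integral_add borel_integrable_atLeastAtMost' ci w w1 w2 z)
      also have "(LINT x:{0..LL}|lborel. z x * (w x + w2 x) - 1 / 2 * (w x * w x))
        = (LINT x:{0..LL}|lborel. z x * (w x + w2 x)) - (LINT x:{0..LL}|lborel. 1 / 2 * (w x * w x))"
        by (intro set_integral_diff borel_integrable_atLeastAtMost' ci w w1 w2 z)
      finally show ?thesis unfolding S2 N2 ip_def by (simp only: set_integral_mult_right)
    qed
    also have "ip LL z q = - (a\<^sup>2 * Z0) + a * Z1 + Z2 / 2 + Z3"
    proof -
      have "ip LL (\<lambda>x. phi x * phi x) z = - ip LL (\<lambda>x. 2 * phi x * sin x) (\<lambda>x. wgt x * w x)"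
        by (subst ip_by_parts[OF _ _ dz _ z, where f' = "\<lambda>x. 2 * phi x * sin x"])
          (auto simp: wb intro!: derivative_eq_intros bt_derivs ci)
      also have "ip LL (\<lambda>x. 2 * phi x * sin x) (\<lambda>x. wgt x * w x) = ip LL (\<lambda>x. 2 * w x) (\<lambda>x. wgt x * (phi x * sin x))"
        by (rule ip_cong) simp
      also have "\<dots> = 2 * Z0" unfolding Z0_def by (rule ip_scale_left)
      finally show ?thesis
        by (simp add: ip_commute[of LL z q] q_expand[OF z] Z1_def Z2_def Z3_def)
    qed
    finally show ?thesis by simp
  qed
  \<comment> \<open>The term \<open>ap * V\<close> is present because the time derivative of w is D
    - ap phi rather than D.\<close>
  have dl: "dlyap u D = a * X2 / 2 + a * X3 - 2 * Ub * a * ap - (pi\<^sup>2 / 2) * a^4 - a^3 * Y1 - a\<^sup>2 * Y2 / 2 - a\<^sup>2 * Y3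
     + Kw * (S\<^sup>2 / 2 - 3 / 2 * N\<^sup>2 - a\<^sup>2 * Z0 + a * Z1 + Z2 / 2 + Z3 - ap * V) - Kw * (w1 0)\<^sup>2 / 2"
  proof -
    have Dw: "ip LL D (\<lambda>x. wgt x * w x) = ip LL D (\<lambda>x. wgt x * u x) - a * ip LL D (\<lambda>x. wgt x * phi x)"
    proof -
      have "ip LL D (\<lambda>x. wgt x * w x) = ip LL D (\<lambda>x. wgt x * u x - a * (wgt x * phi x))"
        by (rule ip_cong) (simp add: w_def algebra_simps)
      also have "\<dots> = ip LL D (\<lambda>x. wgt x * u x) - ip LL D (\<lambda>x. a * (wgt x * phi x))"
        by (intro ip_diff_right D L2 ci u)
      finally show ?thesis by (simp only: ip_scale_right)
    qed
    have V: "V = ip LL u (\<lambda>x. wgt x * phi x) - a * ip LL phi (\<lambda>x. wgt x * phi x)"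
    proof -
      have "V = ip LL u (\<lambda>x. wgt x * phi x) - ip LL (\<lambda>x. a * phi x) (\<lambda>x. wgt x * phi x)"
        unfolding V_def w_def by (intro ip_diff_left L2 ci u)
      then show ?thesis by (simp only: ip_scale_left)
    qed
    have "dlyap u D = a * (3 * pi * ap) - 2 * Ub * a * ap - ip LL D bt * a\<^sup>2
      + Kw * (ip LL D (\<lambda>x. wgt x * w x) - ap * V)"
      unfolding dlyap_def Dw V a_def[symmetric] ap_def[symmetric] Ub_def[symmetric]
      by (simp add: algebra_simps)
    then show ?thesis
      unfolding eq_ap eq_bt eq_w by (simp add: algebra_simps power2_eq_square power3_eq_cube power4_eq_xxxx)
  qed

  have bX1: "\<bar>X1\<bar> \<le> 6 * S"
  proof -
    have "\<bar>X1\<bar> \<le> 3 * 2 * L2norm LL w" unfolding X1_def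
    proof (rule ip_bounded[OF L2[OF w]])
      show "\<bar>phi x * sin x\<bar> \<le> 2" for x
        unfolding abs_mult using mult_mono[of "\<bar>phi x\<bar>" 2 "\<bar>sin x\<bar>" 1] phi_bounds(3)[of x] by simp
    qed (auto intro!: ci)
    then show ?thesis by (simp add: S_def)
  qed
  have ww: "\<bar>ip LL w (\<lambda>x. w x * g x)\<bar> \<le> B * S\<^sup>2"
    if "continuous_on {0..LL} g" "\<And>x. x \<in> {0..LL} \<Longrightarrow> \<bar>g x\<bar> \<le> B" "0 \<le> B" for g B
    using ip_mult_bounded[OF L2[OF w] L2[OF w] that] by (simp add: S_def power2_eq_square mult_ac)
  have bX2: "\<bar>X2\<bar> \<le> S\<^sup>2" using ww[of sin 1] by (simp add: X2_def csin)
  have bX3: "\<bar>X3\<bar> \<le> R1" using rg[of sin 1] by (simp add: X3_def csin)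
  have bap: "\<bar>ap\<bar> \<le> \<bar>a\<bar> * S + S\<^sup>2 + R1"
  proof -
    have "9 * \<bar>ap\<bar> \<le> 3 * pi * \<bar>ap\<bar>" using pi_approx by (intro mult_right_mono) auto
    also have "\<dots> = \<bar>a * X1 + X2 / 2 + X3\<bar>" by (simp add: eq_ap[symmetric] abs_mult)
    also have "\<dots> \<le> \<bar>a\<bar> * \<bar>X1\<bar> + \<bar>X2\<bar> / 2 + \<bar>X3\<bar>" unfolding abs_mult[symmetric] by linarith
    also have "\<bar>a\<bar> * \<bar>X1\<bar> \<le> \<bar>a\<bar> * (6 * S)" by (intro mult_left_mono bX1) auto
    finally have "9 * \<bar>ap\<bar> \<le> 6 * (\<bar>a\<bar> * S) + S\<^sup>2 / 2 + R1" using bX2 bX3 by (simp add: mult_ac)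
    moreover have "0 \<le> \<bar>a\<bar> * S" "0 \<le> S\<^sup>2" using S0 by auto
    ultimately show ?thesis using R1 by linarith
  qed
  have bY1: "\<bar>Y1\<bar> \<le> 24 * S"
  proof -
    have "\<bar>Y1\<bar> \<le> 3 * 8 * L2norm LL w" unfolding Y1_def
    proof (rule ip_bounded[OF L2[OF w]])
      show "\<bar>phi x * bt1 x\<bar> \<le> 8" if "x \<in> {0..LL}" for x
        unfolding abs_mult using mult_mono[of "\<bar>phi x\<bar>" 2 "\<bar>bt1 x\<bar>" 4] phi_bounds(3)[of x] bt_bounds(2)[OF that] by simp
    qed (auto intro!: ci)
    then show ?thesis by (simp add: S_def)
  qed
  have bY2: "\<bar>Y2\<bar> \<le> 4 * S\<^sup>2" unfolding Y2_def by (intro ww ci bt_bounds) auto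
  have bY3: "\<bar>Y3\<bar> \<le> 4 * R1" unfolding Y3_def by (intro rg ci bt_bounds) auto
  have wphi: "\<bar>wgt x * phi x\<bar> \<le> 16" if "x \<in> {0..LL}" for x
    unfolding abs_mult using mult_mono[of "\<bar>wgt x\<bar>" 8 "\<bar>phi x\<bar>" 2] phi_bounds(3)[of x] wgt_bounds[OF that] by simp
  have bZ0: "\<bar>Z0\<bar> \<le> 48 * S"
  proof -
    have "\<bar>Z0\<bar> \<le> 3 * 16 * L2norm LL w" unfolding Z0_def
    proof (rule ip_bounded[OF L2[OF w]])
      show "\<bar>wgt x * (phi x * sin x)\<bar> \<le> 16" if "x \<in> {0..LL}" for x
        unfolding mult.assoc[symmetric] abs_mult[of _ "sin x"] using mult_mono[OF wphi[OF that], of "\<bar>sin x\<bar>" 1] by simp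
    qed (auto intro!: ci)
    then show ?thesis by (simp add: S_def)
  qed
  have bV: "\<bar>V\<bar> \<le> 48 * S"
  proof -
    have "\<bar>V\<bar> \<le> 3 * 16 * L2norm LL w" unfolding V_def
      by (rule ip_bounded[OF L2[OF w]]) (auto intro!: ci wphi)
    then show ?thesis by (simp add: S_def)
  qed
  have bZ1: "\<bar>Z1\<bar> \<le> 18 * S * N"
  proof -
    have "\<bar>Z1\<bar> \<le> 2 * L2norm LL w * L2norm LL z" unfolding Z1_def
      by (intro ip_mult_bounded L2 w z ci phi_bounds) auto
    also have "\<dots> \<le> 2 * L2norm LL w * (9 * N)" by (intro mult_left_mono Nz) (auto simp: L2norm_nonneg)
    finally show ?thesis by (simp add: S_def)
  qed
  have bZ2: "\<bar>Z2\<bar> \<le> 27 * N\<^sup>2 * S"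
  proof -
    have "\<bar>Z2\<bar> \<le> (3 * N) * L2norm LL w * L2norm LL z" unfolding Z2_def
      using N0 by (intro ip_mult_bounded L2 w z supw) auto
    also have "\<dots> \<le> (3 * N) * L2norm LL w * (9 * N)" using N0 by (intro mult_left_mono Nz) (auto simp: L2norm_nonneg)
    finally show ?thesis by (simp add: S_def power2_eq_square mult_ac)
  qed
  have bZ3: "\<bar>Z3\<bar> \<le> 9 * N * R2"
  proof -
    have "\<bar>Z3\<bar> \<le> R2 * L2norm LL z" unfolding Z3_def R2_def by (intro ip_bound L2 r z)
    also have "\<dots> \<le> R2 * (9 * N)" by (intro mult_left_mono Nz R2)
    finally show ?thesis by (simp add: mult_ac)
  qed
  have bUb: "\<bar>Ub\<bar> \<le> 72 * \<bar>a\<bar> + 12 * S"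
  proof -
    have "Ub = ip LL (\<lambda>x. w x + a * phi x) bt" unfolding Ub_def by (rule ip_cong) (simp add: w_def)
    also have "\<dots> = ip LL w bt + ip LL (\<lambda>x. a * phi x) bt" by (intro ip_add_left L2 w ci)
    also have "ip LL (\<lambda>x. a * phi x) bt = a * ip LL phi bt" by (rule ip_scale_left)
    finally have "\<bar>Ub\<bar> \<le> \<bar>ip LL w bt\<bar> + \<bar>a\<bar> * \<bar>ip LL phi bt\<bar>" by (simp add: abs_mult[symmetric])
    moreover have "\<bar>ip LL w bt\<bar> \<le> 3 * 4 * L2norm LL w"
      by (rule ip_bounded) (auto intro!: L2 w ci bt_bounds)
    moreover have "\<bar>a\<bar> * \<bar>ip LL phi bt\<bar> \<le> \<bar>a\<bar> * 72"
    proof (rule mult_left_mono)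
      have "\<bar>ip LL phi bt\<bar> \<le> 3 * 4 * L2norm LL phi"
        by (rule ip_bounded) (auto intro!: L2 ci bt_bounds)
      also have "L2norm LL phi \<le> 3 * 2" by (rule L2norm_bounded) (auto intro!: ci phi_bounds)
      finally show "\<bar>ip LL phi bt\<bar> \<le> 72" by simp
    qed simp
    ultimately show ?thesis by (simp add: S_def)
  qed
  have sm: "\<bar>a\<bar> \<le> 1 / 10^7" "S \<le> 1 / 10^7" using ms(4,5) small by (auto simp: S_def)
  have "3 * 3 \<le> pi * pi" using pi_approx by (intro mult_mono) auto
  then have pi2: "9 / 2 \<le> pi\<^sup>2 / 2" by (simp add: power2_eq_square)
  have "dlyap u D \<le> - Kw / 4 * (a^4 + S\<^sup>2) + 300 * R1 + R2\<^sup>2"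
    using dissipation_arith[OF sm(1) S0 sm(2) SN R1 R2 bX2 bX3 bap bY1 bY2 bY3 bZ0 bZ1 bZ2 bZ3 bV bUb pi2]
    unfolding dl using zero_le_power2[of "w1 0"] by (simp add: Kw_def; linarith)
  \<comment> \<open>|u|^4 is at most 200 a^4 + 2 S^2, and 200 / 2000000 = 1 / 10000 lies below Kw /
    4 = 1 / 9216.\<close>
  moreover have "(ip LL u u)\<^sup>2 / 2000000 \<le> Kw / 4 * (a^4 + S\<^sup>2)"
  proof -
    have "ip LL u u = 3 * pi * a\<^sup>2 + S\<^sup>2" using ms(3) S2 by simp
    also have "\<dots> \<le> 10 * a\<^sup>2 + S\<^sup>2" using pi_approx by (intro add_right_mono mult_right_mono) auto
    finally have "(ip LL u u)\<^sup>2 \<le> (10 * a\<^sup>2 + S\<^sup>2)\<^sup>2" by (intro power_mono) (auto simp: ip_nonneg)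
    also have "\<dots> \<le> 2 * ((10 * a\<^sup>2)\<^sup>2 + (S\<^sup>2)\<^sup>2)"
      using sum_squares_bound[of "10 * a\<^sup>2" "S\<^sup>2"] by (simp add: power2_sum)
    also have "(S\<^sup>2)\<^sup>2 \<le> S\<^sup>2"
    proof -
      have "S\<^sup>2 \<le> 1" using sm(2) S0 by (intro power_le_one) auto
      then have "S\<^sup>2 * S\<^sup>2 \<le> S\<^sup>2 * 1" by (intro mult_left_mono) auto
      then show ?thesis by (simp add: power2_eq_square)
    qed
    finally have "(ip LL u u)\<^sup>2 \<le> 2 * (100 * a^4 + S\<^sup>2)" by (simp add: power_mult_distrib power_mult[symmetric])
    moreover have "0 \<le> S\<^sup>2" by simp
    moreover have "0 \<le> a^4" by simp
    ultimately show ?thesis unfolding Kw_def distrib_left by linarith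
  qed
  ultimately show ?thesis
    unfolding R22[symmetric] R1_def[symmetric] by linarith
qed

section \<open>Decay along trajectories\<close>

lemma lyap_tendsto:
  assumes U: "\<And>n. in_L2 LL (U n)" and w: "in_L2 LL w"
    and lim: "(\<lambda>n. L2norm LL (\<lambda>x. U n x - w x)) \<longlonglongrightarrow> 0"
  shows "(\<lambda>n. lyap (U n)) \<longlonglongrightarrow> lyap w"
proof -
  have lin: "(\<lambda>n. ip LL (U n) f) \<longlonglongrightarrow> ip LL w f" if f: "in_L2 LL f" for f
  proof (rule LIM_zero_cancel, rule Lim_null_comparison)
    show "\<forall>\<^sub>F n in sequentially. norm (ip LL (U n) f - ip LL w f) \<le> L2norm LL (\<lambda>x. U n x - w x) * L2norm LL f"
      using ip_bound[OF in_L2_diff[OF U w] f] by (simp add: ip_diff_left[OF U w f])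
    show "(\<lambda>n. L2norm LL (\<lambda>x. U n x - w x) * L2norm LL f) \<longlonglongrightarrow> 0"
      using tendsto_mult_right[OF lim, of "L2norm LL f"] by simp
  qed
  have gL2: "in_L2 LL (\<lambda>x. wgt x * v x)" if "in_L2 LL v" for v
    by (intro in_L2_mult_continuous that continuous_intros)
  have quad: "(\<lambda>n. ip LL (U n) (\<lambda>x. wgt x * U n x)) \<longlonglongrightarrow> ip LL w (\<lambda>x. wgt x * w x)"
  proof -
    define z where "z n = (\<lambda>x. U n x - w x)" for n
    have z: "in_L2 LL (z n)" for n unfolding z_def by (intro in_L2_diff U w)
    have eq: "ip LL (U n) (\<lambda>x. wgt x * U n x) =
      ip LL (z n) (\<lambda>x. wgt x * z n x) + 2 * ip LL (U n) (\<lambda>x. wgt x * w x) - ip LL w (\<lambda>x. wgt x * w x)" for n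
    proof -
      have "ip LL (z n) (\<lambda>x. wgt x * z n x) = ip LL (z n) (\<lambda>x. wgt x * U n x - wgt x * w x)"
        by (rule ip_cong) (simp add: z_def algebra_simps)
      also have "\<dots> = ip LL (z n) (\<lambda>x. wgt x * U n x) - ip LL (z n) (\<lambda>x. wgt x * w x)"
        by (intro ip_diff_right gL2 U w z)
      also have "ip LL (z n) (\<lambda>x. wgt x * U n x) = ip LL (U n) (\<lambda>x. wgt x * U n x) - ip LL w (\<lambda>x. wgt x * U n x)"
        unfolding z_def by (intro ip_diff_left gL2 U w)
      also have "ip LL w (\<lambda>x. wgt x * U n x) = ip LL (U n) (\<lambda>x. wgt x * w x)"
        by (rule trans[OF ip_commute]) (rule ip_cong, simp)
      also have "ip LL (z n) (\<lambda>x. wgt x * w x) = ip LL (U n) (\<lambda>x. wgt x * w x) - ip LL w (\<lambda>x. wgt x * w x)"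
        unfolding z_def by (intro ip_diff_left gL2 U w)
      finally show ?thesis by simp
    qed
    have "(\<lambda>n. ip LL (z n) (\<lambda>x. wgt x * z n x)) \<longlonglongrightarrow> 0"
    proof (rule Lim_null_comparison)
      have "\<bar>ip LL (z n) (\<lambda>x. wgt x * z n x)\<bar> \<le> 8 * L2norm LL (z n) * L2norm LL (z n)" for n
        using wgt_bounds by (intro ip_mult_bounded z continuous_intros) fastforce+
      then show "\<forall>\<^sub>F n in sequentially. norm (ip LL (z n) (\<lambda>x. wgt x * z n x)) \<le> 8 * L2norm LL (z n) * L2norm LL (z n)"
        by simp
      show "(\<lambda>n. 8 * L2norm LL (z n) * L2norm LL (z n)) \<longlonglongrightarrow> 0"
        unfolding z_def using lim by (auto intro!: tendsto_eq_intros)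
    qed
    moreover have "(\<lambda>n. ip LL (U n) (\<lambda>x. wgt x * w x)) \<longlonglongrightarrow> ip LL w (\<lambda>x. wgt x * w x)" by (intro lin gL2 w)
    ultimately have "(\<lambda>n. ip LL (z n) (\<lambda>x. wgt x * z n x) + 2 * ip LL (U n) (\<lambda>x. wgt x * w x) - ip LL w (\<lambda>x. wgt x * w x))
      \<longlonglongrightarrow> 0 + 2 * ip LL w (\<lambda>x. wgt x * w x) - ip LL w (\<lambda>x. wgt x * w x)"
      by (intro tendsto_intros)
    then show ?thesis unfolding eq by simp
  qed
  have L: "in_L2 LL phi" "in_L2 LL bt" "in_L2 LL (\<lambda>x. wgt x * phi x)"
    by (intro in_L2_continuous continuous_intros)+
  have mode: "(\<lambda>n. mode (U n)) \<longlonglongrightarrow> mode w" unfolding mode_def by (intro tendsto_intros lin L) simp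
  show ?thesis unfolding lyap_def by (intro tendsto_intros lin L quad mode)
qed

section \<open>Decay of the functional along a solution\<close>

locale kdv_2pi = kdv_trajectory "2*pi" y0 y m for y0 y m
begin

lemma lyap_av_derivative:
  assumes t: "0 < t" and h: "0 < h"
  shows "((\<lambda>t. lyap (av h t)) has_real_derivative dlyap (av h t) (dq h t)) (at t)"
proof -
  have L: "in_L2 LL phi" "in_L2 LL bt" "in_L2 LL (\<lambda>x. wgt x * phi x)"
    by (intro in_L2_continuous continuous_intros)+
  note d1 = ip_av_derivative[OF _ t h]
  have d2: "((\<lambda>t. ip LL (av h t) (\<lambda>x. wgt x * av h t x)) has_real_derivative 2 * ip LL (dq h t) (\<lambda>x. wgt x * av h t x)) (at t)"
    by (rule ip_av_square_derivative[where G = 8]) (use wgt_bounds t h in \<open>fastforce intro!: continuous_intros\<close>)+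
  have dm: "((\<lambda>t. mode (av h t)) has_real_derivative mode (dq h t)) (at t)"
    unfolding mode_def by (intro DERIV_cdivide d1 L)
  show ?thesis
    unfolding lyap_def dlyap_def
    by (rule derivative_eq_intros d1[OF L(2)] d1[OF L(3)] d2 dm refl)+ (simp add: algebra_simps power2_eq_square)
qed

definition M :: "real \<Rightarrow> real" where "M t = integral {0..t} m"

lemma M_diff: "0 \<le> s \<Longrightarrow> s \<le> t \<Longrightarrow> M t - M s = (LINT r:{s..t}|lborel. m r)"
  using Henstock_Kurzweil_Integration.integral_combine[of 0 s t m] set_borel_integral_eq_integral[OF m_int'[of s t]]
    set_borel_integral_eq_integral(1)[OF m_int[of t]]
  by (simp add: M_def)

lemma M_nonneg: "0 \<le> M t"
  unfolding M_def using m_nonneg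
  by (cases "m integrable_on {0..t}") (auto simp: not_integrable_integral intro: Henstock_Kurzweil_Integration.integral_nonneg)

lemma M_mono: "0 \<le> s \<Longrightarrow> s \<le> t \<Longrightarrow> M s \<le> M t"
proof -
  assume "0 \<le> s" "s \<le> t"
  moreover have "0 \<le> (LINT r:{s..t}|lborel. m r)"
    unfolding set_lebesgue_integral_def by (rule integral_nonneg_AE) (use m_nonneg in \<open>auto simp: indicator_def\<close>)
  ultimately show ?thesis using M_diff[of s t] by simp
qed

lemma M_continuous: "continuous_on {0..} M"
  unfolding continuous_on_eq_continuous_within
proof
  fix t :: real assume t: "t \<in> {0..}"
  have "continuous_on {0..t + 1} M"
    unfolding M_def[abs_def] using t
    by (intro indefinite_integral_continuous_1 set_borel_integral_eq_integral(1) m_int) auto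
  then have "continuous (at t within {0..t + 1}) M" using t by (simp add: continuous_on_eq_continuous_within)
  moreover have "at t within {0..t + 1} = at t within {0..}"
    by (rule at_within_nhd[where S = "{t - 1<..<t + 1}"]) auto
  ultimately show "continuous (at t within {0..}) M" by (simp add: continuous_within)
qed

text \<open>The function \<open>G\<close> is nonincreasing: the variance error at time \<tau> is at
  most \<omega>^2 times 600 + (M (\<tau> + h) - M \<tau>) / h, which is the derivative of the
  bracket subtracted in \<open>G\<close>; 600 is 300 times the 2 of \<open>variance_bounds\<close>.
  The conditions on \<omega> keep the norm of the average between l / 2 and 10^-7.\<close>

lemma av_decay:
  assumes s: "0 < s" "s \<le> t" and h: "0 < h" "h \<le> 1"
    and bd: "\<And>\<tau>. \<tau> \<in> {s..t} \<Longrightarrow> l \<le> L2norm LL (y \<tau>) \<and> L2norm LL (y \<tau>) \<le> 1 / (2 * 10^7)"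
    and om: "\<And>\<sigma> \<tau>. \<sigma> \<in> {0..t+1} \<Longrightarrow> \<tau> \<in> {0..t+1} \<Longrightarrow> \<bar>\<sigma> - \<tau>\<bar> \<le> h \<Longrightarrow> L2norm LL (\<lambda>x. y \<sigma> x - y \<tau> x) \<le> \<omega>"
    and small: "0 \<le> \<omega>" "\<omega> \<le> 1 / (2 * 10^7)" "0 \<le> l" "l = 0 \<or> \<omega> \<le> l / 2"
  shows "lyap (av h t) \<le> lyap (av h s) - (l / 2)^4 / 2000000 * (t - s) + \<omega>\<^sup>2 * (600 * (t - s) + M (t + 1))"
proof -
  define \<kappa> where "\<kappa> = (l / 2)^4 / 2000000"
  define G where "G \<tau> = lyap (av h \<tau>) + \<kappa> * \<tau> - \<omega>\<^sup>2 * (600 * \<tau> + (1 / h) * (LINT \<sigma>:{\<tau>..\<tau>+h}|lborel. M \<sigma>))" for \<tau>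
  have "G t \<le> G s"
  proof (rule DERIV_nonpos_imp_nonincreasing[OF s(2)])
    fix \<tau> assume \<tau>: "s \<le> \<tau>" "\<tau> \<le> t"
    then have \<tau>0: "0 < \<tau>" "0 \<le> \<tau>" using s by auto
    define D where "D = dlyap (av h \<tau>) (dq h \<tau>) + \<kappa> - \<omega>\<^sup>2 * (600 + (1 / h) * (M (\<tau> + h) - M \<tau>))"
    have "(G has_real_derivative D) (at \<tau>)"
      unfolding G_def[abs_def] D_def
      by (rule derivative_eq_intros lyap_av_derivative[OF \<tau>0(1) h(1)]
          LINT_average_derivative[OF M_continuous \<tau>0(1)] refl | use h in simp)+
    moreover have "D \<le> 0"
    proof -
      let ?u = "av h \<tau>"
      have om': "L2norm LL (\<lambda>x. y \<sigma> x - y \<tau> x) \<le> \<omega>" if "\<sigma> \<in> {\<tau>..\<tau>+h}" for \<sigma>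
        using that \<tau> \<tau>0 h by (intro om) auto
      have close: "L2norm LL (\<lambda>x. ?u x - y \<tau> x) \<le> \<omega>" by (rule av_close[OF \<tau>0(2) h(1) om'])
      have nd: "\<bar>L2norm LL ?u - L2norm LL (y \<tau>)\<bar> \<le> \<omega>"
        using L2norm_diff_bound[OF av_L2 y_L2, of \<tau> \<tau> h] close \<tau>0 by linarith
      have up: "L2norm LL ?u \<le> 1 / 10^7" using nd bd[of \<tau>] \<tau> small by auto
      have lo: "l / 2 \<le> L2norm LL ?u"
        using nd bd[of \<tau>] \<tau> small L2norm_nonneg[of LL ?u] by auto
      have "dlyap ?u (dq h \<tau>) \<le> - (ip LL ?u ?u)\<^sup>2 / 2000000
          + 300 * ip LL (\<lambda>x. qv h \<tau> x - (?u x)\<^sup>2 / 2) (\<lambda>_. 1)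
          + ip LL (\<lambda>x. qv h \<tau> x - (?u x)\<^sup>2 / 2) (\<lambda>x. qv h \<tau> x - (?u x)\<^sup>2 / 2)"
        by (rule lyap_dissipation[OF dq_L2[OF \<tau>0(2) h(1)] av_continuous[OF \<tau>0(2)] qv_continuous[OF \<tau>0(2)]
              av_boundary[OF \<tau>0(2)] av_weak[OF \<tau>0(2) h(1)] av_square_le[OF \<tau>0(2) h(1)] up])
      moreover have "ip LL (\<lambda>x. qv h \<tau> x - (?u x)\<^sup>2 / 2) (\<lambda>_. 1) \<le> 2 * \<omega>\<^sup>2"
        by (rule variance_bounds(1)[OF \<tau>0(2) h(1)]) (rule om')
      moreover have "ip LL (\<lambda>x. qv h \<tau> x - (?u x)\<^sup>2 / 2) (\<lambda>x. qv h \<tau> x - (?u x)\<^sup>2 / 2)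
          \<le> \<omega>\<^sup>2 * ((1 / h) * (LINT s:{\<tau>..\<tau>+h}|lborel. m s))"
        by (rule variance_bounds(2)[OF \<tau>0(2) h(1)]) (rule om')
      moreover have "(l / 2)^4 \<le> (ip LL ?u ?u)\<^sup>2"
      proof -
        have "(l / 2)^4 \<le> (L2norm LL ?u)^4" using lo small by (intro power_mono) auto
        also have "\<dots> = ((L2norm LL ?u)\<^sup>2)\<^sup>2" by (simp flip: power_mult)
        finally show ?thesis by (simp only: L2norm_power2)
      qed
      moreover have "M (\<tau> + h) - M \<tau> = (LINT r:{\<tau>..\<tau>+h}|lborel. m r)" using \<tau>0 h by (intro M_diff) auto
      ultimately show ?thesis unfolding D_def \<kappa>_def by (simp only: distrib_left)
    qed
    ultimately show "\<exists>D. DERIV G \<tau> :> D \<and> D \<le> 0" by blast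
  qed
  moreover have "(1 / h) * (LINT \<sigma>:{t..t+h}|lborel. M \<sigma>) \<le> M (t + 1)"
    using s h by (intro LINT_average_le continuous_on_subset[OF M_continuous] M_mono) auto
  moreover have "0 \<le> (1 / h) * (LINT \<sigma>:{s..s+h}|lborel. M \<sigma>)"
    unfolding set_lebesgue_integral_def using h M_nonneg
    by (intro mult_nonneg_nonneg integral_nonneg_AE) (auto simp: indicator_def)
  ultimately have "lyap (av h t) \<le> lyap (av h s) - \<kappa> * (t - s)
     + \<omega>\<^sup>2 * (600 * (t - s) + ((1 / h) * (LINT \<sigma>:{t..t+h}|lborel. M \<sigma>) - (1 / h) * (LINT \<sigma>:{s..s+h}|lborel. M \<sigma>)))"
    unfolding G_def by (simp add: algebra_simps)
  also have "\<dots> \<le> lyap (av h s) - \<kappa> * (t - s) + \<omega>\<^sup>2 * (600 * (t - s) + M (t + 1))"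
    using \<open>(1 / h) * (LINT \<sigma>:{t..t+h}|lborel. M \<sigma>) \<le> M (t + 1)\<close> \<open>0 \<le> (1 / h) * (LINT \<sigma>:{s..s+h}|lborel. M \<sigma>)\<close>
    by (intro add_left_mono mult_left_mono) auto
  finally show ?thesis by (simp only: \<kappa>_def)
qed

text \<open>The window shrinks: uniform continuity allows \<omega> to tend to 0 along with suitable
  h, while the factor of \<omega>^2 stays fixed. Taking l = 0 gives monotonicity; a positive l gives
  linear decrease as long as the norm stays above l.\<close>

lemma lyap_decay:
  assumes s: "0 < s" "s \<le> t" and l: "0 \<le> l"
    and bd: "\<And>\<tau>. \<tau> \<in> {s..t} \<Longrightarrow> l \<le> L2norm LL (y \<tau>) \<and> L2norm LL (y \<tau>) \<le> 1 / (2 * 10^7)"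
  shows "lyap (y t) \<le> lyap (y s) - (l / 2)^4 / 2000000 * (t - s)"
proof -
  define c where "c = (if l = 0 then 1 / (2 * 10^7) else min (l / 2) (1 / (2 * 10^7)))"
  have c: "0 < c" "c \<le> 1 / (2 * 10^7)" "l = 0 \<or> c \<le> l / 2" using l by (auto simp: c_def)
  define \<omega> where "\<omega> n = c * inverse (real (Suc n))" for n
  have \<omega>: "0 < \<omega> n" "\<omega> n \<le> c" for n
    using c(1) mult_left_mono[of "inverse (real (Suc n))" 1 c] by (auto simp: \<omega>_def field_simps)
  have \<omega>lim: "\<omega> \<longlonglongrightarrow> 0"
    unfolding \<omega>_def using tendsto_mult_left[OF LIMSEQ_inverse_real_of_nat, of c] by simp
  have "\<exists>h. 0 < h \<and> h \<le> 1 \<and> (\<forall>\<sigma>\<in>{0..t+1}. \<forall>\<tau>\<in>{0..t+1}. \<bar>\<sigma> - \<tau>\<bar> \<le> h \<longrightarrow> L2norm LL (\<lambda>x. y \<sigma> x - y \<tau> x) \<le> \<omega> n)" for n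
  proof -
    obtain d where d: "0 < d" "\<And>s r. s \<in> {0..t+1} \<Longrightarrow> r \<in> {0..t+1} \<Longrightarrow> \<bar>s - r\<bar> < d \<Longrightarrow> L2norm LL (\<lambda>x. y s x - y r x) \<le> \<omega> n"
      using y_uniformly_continuous[OF \<omega>(1), of "t + 1"] by blast
    show ?thesis by (rule exI[of _ "min 1 (d / 2)"]) (use d in auto)
  qed
  then obtain h where h: "\<And>n. 0 < h n" "\<And>n. h n \<le> 1"
    "\<And>n \<sigma> \<tau>. \<sigma> \<in> {0..t+1} \<Longrightarrow> \<tau> \<in> {0..t+1} \<Longrightarrow> \<bar>\<sigma> - \<tau>\<bar> \<le> h n \<Longrightarrow> L2norm LL (\<lambda>x. y \<sigma> x - y \<tau> x) \<le> \<omega> n"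
    by metis
  have conv: "(\<lambda>n. lyap (av (h n) \<tau>)) \<longlonglongrightarrow> lyap (y \<tau>)" if \<tau>: "\<tau> \<in> {0..t}" for \<tau>
  proof (rule lyap_tendsto)
    show "in_L2 LL (av (h n) \<tau>)" for n using \<tau> by (intro av_L2) auto
    show "in_L2 LL (y \<tau>)" using \<tau> by (intro y_L2) auto
    show "(\<lambda>n. L2norm LL (\<lambda>x. av (h n) \<tau> x - y \<tau> x)) \<longlonglongrightarrow> 0"
    proof (rule Lim_null_comparison[OF _ \<omega>lim])
      have "L2norm LL (\<lambda>x. av (h n) \<tau> x - y \<tau> x) \<le> \<omega> n" for n
      proof (rule av_close)
        show "L2norm LL (\<lambda>x. y s x - y \<tau> x) \<le> \<omega> n" if "s \<in> {\<tau>..\<tau> + h n}" for s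
          using that \<tau> h(1,2)[of n] by (intro h(3)) auto
      qed (use \<tau> h in auto)
      then show "\<forall>\<^sub>F n in sequentially. norm (L2norm LL (\<lambda>x. av (h n) \<tau> x - y \<tau> x)) \<le> \<omega> n"
        by (simp add: L2norm_nonneg)
    qed
  qed
  have step: "lyap (av (h n) t) \<le> lyap (av (h n) s) - (l / 2)^4 / 2000000 * (t - s)
      + (\<omega> n)\<^sup>2 * (600 * (t - s) + M (t + 1))" for n
  proof (rule av_decay[OF s h(1,2) bd])
    show "\<omega> n \<le> 1 / (2 * 10^7)" "l = 0 \<or> \<omega> n \<le> l / 2" "0 \<le> \<omega> n" using \<omega>[of n] c by auto
  qed (use h(3) l in auto)
  have "(\<lambda>n. lyap (av (h n) s) - (l / 2)^4 / 2000000 * (t - s) + (\<omega> n)\<^sup>2 * (600 * (t - s) + M (t + 1)))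
      \<longlonglongrightarrow> lyap (y s) - (l / 2)^4 / 2000000 * (t - s) + 0\<^sup>2 * (600 * (t - s) + M (t + 1))"
    using s by (intro tendsto_intros conv \<omega>lim) auto
  moreover have "(\<lambda>n. lyap (av (h n) t)) \<longlonglongrightarrow> lyap (y t)" using s by (intro conv) auto
  ultimately show ?thesis using LIMSEQ_le[of "\<lambda>n. lyap (av (h n) t)"] step by fastforce
qed

text \<open>A bootstrap: up to the first time t1 at which the norm reaches e,
  \<open>lyap_decay\<close> applies. Then Kw/2 e^2 \<le> lyap (y t1) \<le> lyap (y s) \<le> 8 (e /
  1000)^2, which is impossible because 1 / 4608 exceeds 8 / 10^6.\<close>

lemma stability:
  assumes e: "0 < e" "e \<le> 1 / (2 * 10^7)" and init: "L2norm LL (y 0) < e / 1000" and t: "0 \<le> t"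
  shows "L2norm LL (y t) < e"
proof (rule ccontr)
  define N where "N s = L2norm LL (y s)" for s
  have N: "continuous_on {0..} N" unfolding N_def[abs_def] by (rule L2norm_y_continuous)
  assume "\<not> L2norm LL (y t) < e"
  then have Nt: "e \<le> N t" by (simp add: N_def)
  have "(N \<longlongrightarrow> N 0) (at 0 within {0..})" using N by (simp add: continuous_on_def)
  moreover have "N 0 < e / 1000" using init by (simp add: N_def)
  ultimately have "\<forall>\<^sub>F s in at 0 within {0..}. N s < e / 1000" by (rule order_tendstoD(2))
  then obtain d where d: "0 < d" "\<And>s. 0 < s \<Longrightarrow> s < d \<Longrightarrow> N s < e / 1000"
    unfolding eventually_at by (auto simp: dist_real_def)
  have t0: "0 < t" using Nt init e by (cases "t = 0") (use t in \<open>auto simp: N_def\<close>)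
  \<comment> \<open>The averages are differentiated only at positive times, so the comparison starts
    at a small s > 0, where the norm is still below e / 1000 by continuity.\<close>
  define s where "s = min d t / 2"
  have s: "0 < s" "s \<le> t" "N s < e / 1000" using d t0 by (auto simp: s_def intro!: d(2))
  have ivt: "\<exists>x\<ge>s. x \<le> r \<and> N x = e" if "s \<le> r" "e \<le> N r" for r
    using that s e by (intro IVT' continuous_on_subset[OF N]) auto
  define H where "H = {x \<in> {s..t}. N x = e}"
  have "closed H" unfolding H_def
    using continuous_closed_preimage_constant[of "{s..t}" N e] continuous_on_subset[OF N, of "{s..t}"] s by auto
  moreover have "bounded H"
    by (rule bounded_subset[OF compact_imp_bounded[OF compact_Icc[of s t]]]) (auto simp: H_def)
  ultimately have "compact H" by (simp add: compact_eq_bounded_closed)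
  moreover have "H \<noteq> {}" using ivt[OF s(2) Nt] by (auto simp: H_def)
  ultimately have "\<exists>x\<in>H. \<forall>z\<in>H. x \<le> z" by (rule compact_attains_inf)
  then obtain t1 where t1: "t1 \<in> H" "\<And>x. x \<in> H \<Longrightarrow> t1 \<le> x" by blast
  have t1': "s \<le> t1" "t1 \<le> t" "N t1 = e" using t1(1) by (auto simp: H_def)
  have le: "N \<tau> \<le> e" if \<tau>: "\<tau> \<in> {s..t1}" for \<tau>
  proof (rule ccontr)
    assume *: "\<not> N \<tau> \<le> e"
    then obtain x where x: "s \<le> x" "x \<le> \<tau>" "N x = e" using ivt[of \<tau>] \<tau> by auto
    then have "x \<in> H" using \<tau> t1' by (auto simp: H_def)
    then have "\<tau> = t1" using t1(2)[of x] x \<tau> by auto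
    then show False using * t1' by simp
  qed
  have "lyap (y t1) \<le> lyap (y s) - (0 / 2)^4 / 2000000 * (t1 - s)"
    using le e by (intro lyap_decay s t1') (force simp: N_def L2norm_nonneg)+
  moreover have "Kw / 2 * ip LL (y t1) (y t1) \<le> lyap (y t1)"
    using t1' s e by (intro lyap_equiv y_L2) (auto simp: N_def)
  moreover have "lyap (y s) \<le> 8 * ip LL (y s) (y s)"
    using s e by (intro lyap_equiv y_L2) (auto simp: N_def)
  moreover have "ip LL (y t1) (y t1) = e\<^sup>2" using t1' by (simp add: N_def flip: L2norm_power2)
  moreover have "ip LL (y s) (y s) \<le> (e / 1000)\<^sup>2"
    unfolding L2norm_power2[symmetric] using s by (intro power_mono L2norm_nonneg) (auto simp: N_def)
  moreover have "0 < e\<^sup>2" using e by simp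
  ultimately show False by (simp add: Kw_def power_divide)
qed

text \<open>If the functional stayed above a positive level, the norm would be bounded below, and
  linear decrease would make the functional negative. Once it is under the level, monotonicity keeps
  it there and the lower bound of \<open>lyap_equiv\<close> controls the norm.\<close>

lemma decay_to_zero:
  assumes init: "L2norm LL (y 0) < 1 / (2 * 10^7) / 1000"
  shows "((\<lambda>t. L2norm LL (y t)) \<longlongrightarrow> 0) at_top"
proof -
  have small: "L2norm LL (y t) \<le> 1 / (2 * 10^7)" if "0 \<le> t" for t
    using stability[OF _ order_refl init that] by simp
  have small': "L2norm LL (y t) \<le> 1 / 10^7" if "0 \<le> t" for t using small[OF that] by simp
  have low: "Kw / 2 * ip LL (y t) (y t) \<le> lyap (y t)" and upp: "lyap (y t) \<le> 8 * ip LL (y t) (y t)" if "0 \<le> t" for t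
    using lyap_equiv[OF y_L2 small'] that by auto
  have mono: "lyap (y t) \<le> lyap (y s)" if "0 < s" "s \<le> t" for s t
    using lyap_decay[of s t 0] that small by (auto simp: L2norm_nonneg)
  show ?thesis
  proof (rule tendstoI)
    fix e :: real assume e: "0 < e"
    have "\<exists>T>0. lyap (y T) < Kw / 2 * e\<^sup>2"
    proof (rule ccontr)
      assume "\<not> ?thesis"
      then have big: "Kw / 2 * e\<^sup>2 \<le> lyap (y t)" if "0 < t" for t using that by force
      \<comment> \<open>Kw/2 e^2 \<le> 8 |y|^2 amounts to |y| \<ge> e / 192.\<close>
      have lo: "e / 200 \<le> L2norm LL (y t)" if "0 < t" for t
      proof (rule power2_le_imp_le)
        show "(e / 200)\<^sup>2 \<le> (L2norm LL (y t))\<^sup>2"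
          unfolding L2norm_power2 using big[OF that] upp[of t] that ip_nonneg[of LL "y t"] by (simp add: Kw_def power_divide)
      qed (rule L2norm_nonneg)
      define \<kappa> where "\<kappa> = (e / 200 / 2)^4 / 2000000"
      have \<kappa>: "0 < \<kappa>" using e by (simp add: \<kappa>_def)
      \<comment> \<open>Chosen so that the guaranteed drop \<kappa> (t - 1) equals lyap (y 1) +
        1.\<close>
      define t where "t = 1 + (lyap (y 1) + 1) / \<kappa>"
      have l1: "0 \<le> lyap (y 1)" using low[of 1] ip_nonneg[of LL "y 1"] by (simp add: Kw_def)
      then have t: "1 \<le> t" using \<kappa> by (simp add: t_def)
      have "lyap (y t) \<le> lyap (y 1) - (e / 200 / 2)^4 / 2000000 * (t - 1)"
        using t e lo small by (intro lyap_decay) auto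
      also have "\<dots> = - 1" using \<kappa> by (simp only: \<kappa>_def[symmetric]) (simp add: t_def)
      finally have "lyap (y t) \<le> - 1" .
      moreover have "0 \<le> lyap (y t)" using low[of t] ip_nonneg[of LL "y t"] t by (simp add: Kw_def)
      ultimately show False by simp
    qed
    then obtain T where T: "0 < T" "lyap (y T) < Kw / 2 * e\<^sup>2" by blast
    show "\<forall>\<^sub>F t in at_top. dist (L2norm LL (y t)) 0 < e"
      unfolding eventually_at_top_linorder
    proof (intro exI[of _ T] allI impI)
      fix t assume "T \<le> t"
      then have "Kw / 2 * (L2norm LL (y t))\<^sup>2 < Kw / 2 * e\<^sup>2"
        unfolding L2norm_power2 using low[of t] mono[OF T(1), of t] T by simp
      then have "(L2norm LL (y t))\<^sup>2 < e\<^sup>2" by (simp add: Kw_def)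
      then show "dist (L2norm LL (y t)) 0 < e"
        using e L2norm_nonneg[of LL "y t"] by (simp add: power2_less_imp_less)
    qed
  qed
qed

end

section \<open>Transfer to weak solutions of the nonlinear system\<close>

lemma kdv_solution_2pi:
  assumes "kdv_solution (2*pi) y0 y"
  obtains m where "kdv_2pi y0 y m" "L2norm (2*pi) (y 0) = L2norm (2*pi) y0"
proof -
  obtain m where m: "kdv_trajectory (2*pi) y0 y m"
    using kdv_solution_trajectory[OF assms] by (metis pi_gt_zero zero_less_mult_iff zero_less_numeral)
  moreover have "\<bar>L2norm (2*pi) (y 0) - L2norm (2*pi) y0\<bar> \<le> L2norm (2*pi) (\<lambda>x. y 0 x - y0 x)"
    using assms unfolding kdv_solution_def by (intro L2norm_diff_bound) auto
  moreover have "L2norm (2*pi) (\<lambda>x. y 0 x - y0 x) = 0" using assms by (simp add: kdv_solution_def)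
  ultimately show ?thesis using that[of m] by (simp add: kdv_2pi_def)
qed

theorem theorem1p1:
  fixes L :: real
  assumes "L = 2 * pi"
  shows "(\<forall>\<epsilon>>0. \<exists>\<delta>>0. \<forall>y0 y. kdv_solution L y0 y \<and> L2norm L y0 < \<delta> \<longrightarrow>
             (\<forall>t\<ge>0. L2norm L (y t) < \<epsilon>))
       \<and> (\<exists>\<delta>1>0. \<forall>y0 y. kdv_solution L y0 y \<and> L2norm L y0 < \<delta>1 \<longrightarrow>
             ((\<lambda>t. L2norm L (y t)) \<longlongrightarrow> 0) at_top)"
  unfolding assms
proof (intro conjI allI impI)
  fix \<epsilon> :: real assume "0 < \<epsilon>"
  \<comment> \<open>The tolerance is capped because \<open>stability\<close> works only inside the
    ball where the functional decreases.\<close>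
  define e where "e = min \<epsilon> (1 / (2 * 10^7))"
  have e: "0 < e" "e \<le> 1 / (2 * 10^7)" "e \<le> \<epsilon>" using \<open>0 < \<epsilon>\<close> by (auto simp: e_def)
  show "\<exists>\<delta>>0. \<forall>y0 y. kdv_solution (2*pi) y0 y \<and> L2norm (2*pi) y0 < \<delta> \<longrightarrow> (\<forall>t\<ge>0. L2norm (2*pi) (y t) < \<epsilon>)"
  proof (intro exI[of _ "e / 1000"] conjI allI impI)
    fix y0 y t assume sol: "kdv_solution (2*pi) y0 y \<and> L2norm (2*pi) y0 < e / 1000" and t: "0 \<le> (t :: real)"
    then obtain m where "kdv_2pi y0 y m" "L2norm (2*pi) (y 0) = L2norm (2*pi) y0"
      using kdv_solution_2pi by blast
    then have "L2norm (2*pi) (y t) < e" using kdv_2pi.stability[OF _ e(1,2) _ t] sol by simp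
    then show "L2norm (2*pi) (y t) < \<epsilon>" using e by simp
  qed (use e in simp)
next
  show "\<exists>\<delta>1>0. \<forall>y0 y. kdv_solution (2*pi) y0 y \<and> L2norm (2*pi) y0 < \<delta>1 \<longrightarrow> ((\<lambda>t. L2norm (2*pi) (y t)) \<longlongrightarrow> 0) at_top"
  proof (intro exI[of _ "1 / (2 * 10^7) / 1000 :: real"] conjI allI impI)
    fix y0 y assume sol: "kdv_solution (2*pi) y0 y \<and> L2norm (2*pi) y0 < 1 / (2 * 10^7) / 1000"
    then obtain m where "kdv_2pi y0 y m" "L2norm (2*pi) (y 0) = L2norm (2*pi) y0"
      using kdv_solution_2pi by blast
    then show "((\<lambda>t. L2norm (2*pi) (y t)) \<longlongrightarrow> 0) at_top" using kdv_2pi.decay_to_zero sol by simp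
  qed simp
qed

end
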